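(* A posetal pre-stack $\mathcal{X}:|\mathcal{X}|\to\mathbf{Set}$ is equivalent to a relative realizability tripos if and only if it satisfies the following conditions in such a way that the family $(\pi_i)_{i\in I}$ can be chosen to comprise a single predicate: 1. $\mathcal{X}$ models the logical connectives $\top,\wedge,\Rightarrow,\exists,\forall$ (with quantification along all maps), and 2. there exist a family $(A_i)_{i\in I}$ of sets and a family $(\pi_i\in\mathcal{X}_{A_i})_{i\in I}$ of $\exists$-prime predicates such that the subfibration $\mathcal{A}\subseteq\mathcal{X}$ generated by the $(\pi_i)_{i\in I}$ is closed under finite meets, all $\pi_i$ are modest in $\mathcal{A}$, and $\mathcal{A}$ generates $\mathcal{X}$ under existential quantification.
   Context: **Posetal fibrations.** A posetal fibration $\mathcal{X}:|\mathcal{X}|\to\mathbf{Set}$ is a fibration that is faithful as a functor; its fibers $\mathcal{X}_M$ are preorders, whose elements are called predicates on $M$; $u^*$ is reindexing. It is a pre-stack if $e^*\varphi\le e^*\psi$ implies $\varphi\le\psi$ for every surjection $e$. Equivalence means fibered equivalence over $\mathbf{Set}$. $\mathcal{X}$ models $\top,\wedge,\Rightarrow$ if its fibers have finite meets and Heyting implication preserved by reindexing; it models $\exists$ (resp. $\forall$) if all $u^*$ have left adjoints $\exists_u$ (resp. right adjoints $\forall_u$) satisfying Beck–Chevalley. **Generated subfibration.** $\mathcal{A}$ is the full subfibration of $\mathcal{X}$ on predicates isomorphic to $f^*\pi_i$ for some $i\in I$, $f:M\to A_i$. $\mathcal{A}$ generates $\mathcal{X}$ under existential quantification if for each $\varphi\in\mathcal{X}_M$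 there are $u:N\to M$ and $\psi\in\mathcal{A}_N$ with $\varphi\cong\exists_u\psi$. **$\exists$-prime.** $\pi\in\mathcal{X}_I$ is $\exists$-prime if whenever $I\xleftarrow{u}J\xleftarrow{v}K$ and $\theta\in\mathcal{X}_K$ satisfy $u^*\pi\le\exists_v\theta$, there are a surjection $e:L\to J$ and a map $w:L\to K$ with $vw=e$ and $(ue)^*\pi\le w^*\theta$. **Modest.** $\mu\in\mathcal{A}_I$ is modest in $\mathcal{A}$ if for any span $J\xleftarrow{e}K\xrightarrow{f}I$ with $e$ surjective and any $\varphi\in\mathcal{A}_J$ with $e^*\varphi\le f^*\mu$, there is $h:J\to I$ with $he=f$ and $\varphi\le h^*\mu$. **Relative realizability tripos.** A (weak) pca is a set $\mathcal{B}$ with a partial binary application (associating to the left, written by juxtaposition) such that there are $\mathsf{k},\mathsf{s}\in\mathcal{B}$ with, for all $x,y,z$: $\mathsf{k}xy=x$ (defined); $\mathsf{s}xy$ defined; and if $xz(yz)$ is defined then $\mathsf{s}xyz$ is defined and equal to it. A sub-pca is a subset $\mathcal{B}_\#\subseteq\mathcal{B}$ closed under application (when defined) in which $\mathsf{k},\mathsf{s}$ for $\mathcal{B}$ can be chosen; a pca with a sub-pca is an inclusion of pcas. The relative realizability tripos of $\mathcal{B}_\#\subseteq\mathcal{B}$ is the posetal fibration on $\mathbf{Set}$ whose predicates on $M$ are functions $\varphi:M\to P(\mathcal{B})$, with $\varphi\le\psi$ iff $\exists e\in\mathcal{B}_\#\,\forall m\in M\,\forall a\in\varphi(m)$: $ea$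 is defined and $ea\in\psi(m)$, and reindexing by precomposition. *)

theory Defs
  imports Main "HOL-Library.FuncSet"
begin

section \<open>The universe of sets\<close>

text \<open>
  HOL has no type of all sets. A type of class \<open>set_universe\<close> is a model of (second-order) ZFC:
  its elements are the sets and \<open>elts x\<close> is the HOL set of members of \<open>x\<close>. The axiom of choice is
  inherited from HOL, and pairing follows from power set and replacement. The axioms are, up to
  presentation, those of the type \<open>V\<close> in the AFP entry \<open>ZFC_in_HOL\<close>.
\<close>

class set_universe =
  fixes elts :: "'a \<Rightarrow> 'a set"
  assumes extensionality: "elts x = elts y \<Longrightarrow> x = y"
    and foundation: "wf {(x, y). x \<in> elts y}"
    and separation: "\<exists>y. elts y = {z \<in> elts x. P z}"
    and replacement: "\<exists>y. elts y = f ` elts x"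
    and union: "\<exists>y. elts y = (\<Union>z\<in>elts x. elts z)"
    and power_set: "\<exists>y. elts y = {z. elts z \<subseteq> elts x}"
    and infinity: "\<exists>x. infinite (elts x)"


section \<open>Categories and functors\<close>

record ('o, 'a) cat_data =
  Obj :: "'o set"
  Arr :: "'a set"
  Dom :: "'a \<Rightarrow> 'o"
  Cod :: "'a \<Rightarrow> 'o"
  Id :: "'o \<Rightarrow> 'a"
  Comp :: "'a \<Rightarrow> 'a \<Rightarrow> 'a"  \<comment> \<open>\<open>Comp C g f\<close> is \<open>g\<close> after \<open>f\<close>\<close>

definition Hom :: "('o, 'a, 'm) cat_data_scheme \<Rightarrow> 'o \<Rightarrow> 'o \<Rightarrow> 'a set" where
  "Hom C x y = {f \<in> Arr C. Dom C f = x \<and> Cod C f = y}"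

definition category :: "('o, 'a, 'm) cat_data_scheme \<Rightarrow> bool" where
  "category C \<longleftrightarrow>
     (\<forall>f\<in>Arr C. Dom C f \<in> Obj C \<and> Cod C f \<in> Obj C) \<and>
     (\<forall>x\<in>Obj C. Id C x \<in> Hom C x x) \<and>
     (\<forall>x y z. \<forall>f\<in>Hom C x y. \<forall>g\<in>Hom C y z. Comp C g f \<in> Hom C x z) \<and>
     (\<forall>x y. \<forall>f\<in>Hom C x y. Comp C f (Id C x) = f \<and> Comp C (Id C y) f = f) \<and>
     (\<forall>w x y z. \<forall>f\<in>Hom C w x. \<forall>g\<in>Hom C x y. \<forall>h\<in>Hom C y z.
        Comp C h (Comp C g f) = Comp C (Comp C h g) f)"

definition is_iso :: "('o, 'a, 'm) cat_data_scheme \<Rightarrow> 'a \<Rightarrow> bool" where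
  "is_iso C f \<longleftrightarrow> f \<in> Arr C \<and>
     (\<exists>g\<in>Hom C (Cod C f) (Dom C f). Comp C g f = Id C (Dom C f) \<and> Comp C f g = Id C (Cod C f))"

definition is_functor ::
  "('o, 'a, 'm) cat_data_scheme \<Rightarrow> ('p, 'b, 'n) cat_data_scheme \<Rightarrow> ('o \<Rightarrow> 'p) \<Rightarrow> ('a \<Rightarrow> 'b) \<Rightarrow> bool"
  where
  "is_functor C D Fo Fa \<longleftrightarrow>
     (\<forall>x\<in>Obj C. Fo x \<in> Obj D) \<and>
     (\<forall>x y. \<forall>f\<in>Hom C x y. Fa f \<in> Hom D (Fo x) (Fo y)) \<and>
     (\<forall>x\<in>Obj C. Fa (Id C x) = Id D (Fo x)) \<and>
     (\<forall>x y z. \<forall>f\<in>Hom C x y. \<forall>g\<in>Hom C y z. Fa (Comp C g f) = Comp D (Fa g) (Fa f))"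

definition faithful :: "('o, 'a, 'm) cat_data_scheme \<Rightarrow> ('a \<Rightarrow> 'b) \<Rightarrow> bool" where
  "faithful C Fa \<longleftrightarrow> (\<forall>x y. inj_on Fa (Hom C x y))"

text \<open>
  \<open>is_pullback C p q u v\<close> says that the following square is a pullback.
  \<open>
      P --q--> K
      |        |
      p        v
      |        |
      J --u--> I
  \<close>
\<close>

definition is_pullback :: "('o, 'a, 'm) cat_data_scheme \<Rightarrow> 'a \<Rightarrow> 'a \<Rightarrow> 'a \<Rightarrow> 'a \<Rightarrow> bool" where
  "is_pullback C p q u v \<longleftrightarrow>
     {p, q, u, v} \<subseteq> Arr C \<and> Dom C p = Dom C q \<and> Cod C p = Dom C u \<and> Cod C q = Dom C v \<and>
     Cod C u = Cod C v \<and> Comp C u p = Comp C v q \<and>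
     (\<forall>x. \<forall>a\<in>Hom C x (Dom C u). \<forall>b\<in>Hom C x (Dom C v). Comp C u a = Comp C v b \<longrightarrow>
        (\<exists>!w. w \<in> Hom C x (Dom C p) \<and> Comp C p w = a \<and> Comp C q w = b))"


section \<open>The category of sets\<close>

record 'u set_map =
  sdom :: 'u
  scod :: 'u
  sfun :: "'u \<Rightarrow> 'u"

definition SET :: "('u::set_universe, 'u set_map) cat_data" where
  "SET = \<lparr> Obj = UNIV,
           Arr = {f. sfun f \<in> elts (sdom f) \<rightarrow>\<^sub>E elts (scod f)},
           Dom = sdom,
           Cod = scod,
           Id = (\<lambda>M. \<lparr> sdom = M, scod = M, sfun = restrict (\<lambda>x. x) (elts M) \<rparr>),
           Comp = (\<lambda>g f. \<lparr> sdom = sdom f, scod = scod g,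
                           sfun = compose (elts (sdom f)) (sfun g) (sfun f) \<rparr>) \<rparr>"

definition surjection :: "'u::set_universe set_map \<Rightarrow> bool" where
  "surjection e \<longleftrightarrow> e \<in> Arr SET \<and> sfun e ` elts (sdom e) = elts (scod e)"


section \<open>Posetal fibrations\<close>

text \<open>A category together with the data of a functor to sets.\<close>

record ('o, 'a, 'u) over_set = "('o, 'a) cat_data" +
  pobj :: "'o \<Rightarrow> 'u"
  parr :: "'a \<Rightarrow> 'u set_map"

definition cartesian :: "('o, 'a, 'u::set_universe) over_set \<Rightarrow> 'a \<Rightarrow> bool" where
  "cartesian X a \<longleftrightarrow> a \<in> Arr X \<and>
     (\<forall>x. \<forall>b\<in>Hom X x (Cod X a). \<forall>w\<in>Hom SET (pobj X x) (pobj X (Dom X a)).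
        parr X b = Comp SET (parr X a) w \<longrightarrow>
        (\<exists>!c. c \<in> Hom X x (Dom X a) \<and> parr X c = w \<and> Comp X a c = b))"

definition fibration :: "('o, 'a, 'u::set_universe) over_set \<Rightarrow> bool" where
  "fibration X \<longleftrightarrow> category X \<and> is_functor X SET (pobj X) (parr X) \<and>
     (\<forall>\<psi>\<in>Obj X. \<forall>M. \<forall>u\<in>Hom SET M (pobj X \<psi>). \<exists>a. cartesian X a \<and> Cod X a = \<psi> \<and> parr X a = u)"

definition posetal_fibration :: "('o, 'a, 'u::set_universe) over_set \<Rightarrow> bool" where
  "posetal_fibration X \<longleftrightarrow> fibration X \<and> faithful X (parr X)"

definition fiber :: "('o, 'a, 'u::set_universe) over_set \<Rightarrow> 'u \<Rightarrow> 'o set" where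
  "fiber X M = {\<phi> \<in> Obj X. pobj X \<phi> = M}"

definition fib_le :: "('o, 'a, 'u::set_universe) over_set \<Rightarrow> 'o \<Rightarrow> 'o \<Rightarrow> bool" where
  "fib_le X \<phi> \<psi> \<longleftrightarrow> (\<exists>a\<in>Hom X \<phi> \<psi>. parr X a = Id SET (pobj X \<phi>))"

definition fib_iso :: "('o, 'a, 'u::set_universe) over_set \<Rightarrow> 'o \<Rightarrow> 'o \<Rightarrow> bool" where
  "fib_iso X \<phi> \<psi> \<longleftrightarrow> fib_le X \<phi> \<psi> \<and> fib_le X \<psi> \<phi>"

text \<open>
  Reindexing along \<open>u\<close> with respect to a cleavage given by Hilbert choice. As with the adjoints below,
  the choice is immaterial up to isomorphism in the fiber.
\<close>

definition reindex :: "('o, 'a, 'u::set_universe) over_set \<Rightarrow> 'u set_map \<Rightarrow> 'o \<Rightarrow> 'o" where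
  "reindex X u \<psi> = Dom X (SOME a. cartesian X a \<and> Cod X a = \<psi> \<and> parr X a = u)"

definition pre_stack :: "('o, 'a, 'u::set_universe) over_set \<Rightarrow> bool" where
  "pre_stack X \<longleftrightarrow>
     (\<forall>e. surjection e \<longrightarrow> (\<forall>\<phi>\<in>fiber X (scod e). \<forall>\<psi>\<in>fiber X (scod e).
        fib_le X (reindex X e \<phi>) (reindex X e \<psi>) \<longrightarrow> fib_le X \<phi> \<psi>))"


section \<open>Fibered equivalence\<close>

definition fibered_functor ::
  "('o, 'a, 'u::set_universe) over_set \<Rightarrow> ('p, 'b, 'u) over_set \<Rightarrow> ('o \<Rightarrow> 'p) \<Rightarrow> ('a \<Rightarrow> 'b) \<Rightarrow> bool"
  where
  "fibered_functor X Y Fo Fa \<longleftrightarrow> is_functor X Y Fo Fa \<and>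
     (\<forall>x\<in>Obj X. pobj Y (Fo x) = pobj X x) \<and>
     (\<forall>a\<in>Arr X. parr Y (Fa a) = parr X a) \<and>
     (\<forall>a. cartesian X a \<longrightarrow> cartesian Y (Fa a))"

definition vertical_nat_iso ::
  "('o, 'a, 'u::set_universe) over_set \<Rightarrow> ('p, 'b, 'u) over_set \<Rightarrow> ('o \<Rightarrow> 'p) \<Rightarrow> ('a \<Rightarrow> 'b) \<Rightarrow>
   ('o \<Rightarrow> 'p) \<Rightarrow> ('a \<Rightarrow> 'b) \<Rightarrow> ('o \<Rightarrow> 'b) \<Rightarrow> bool"
  where
  "vertical_nat_iso X Y Fo Fa Go Ga \<eta> \<longleftrightarrow>
     (\<forall>x\<in>Obj X. \<eta> x \<in> Hom Y (Fo x) (Go x) \<and> is_iso Y (\<eta> x) \<and> parr Y (\<eta> x) = Id SET (pobj X x)) \<and>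
     (\<forall>x y. \<forall>f\<in>Hom X x y. Comp Y (\<eta> y) (Fa f) = Comp Y (Ga f) (\<eta> x))"

definition fibered_equivalent ::
  "('o, 'a, 'u::set_universe) over_set \<Rightarrow> ('p, 'b, 'u) over_set \<Rightarrow> bool" where
  "fibered_equivalent X Y \<longleftrightarrow>
     (\<exists>Fo Fa Go Ga. fibered_functor X Y Fo Fa \<and> fibered_functor Y X Go Ga \<and>
        (\<exists>\<eta>. vertical_nat_iso X X (Go \<circ> Fo) (Ga \<circ> Fa) id id \<eta>) \<and>
        (\<exists>\<epsilon>. vertical_nat_iso Y Y (Fo \<circ> Go) (Fa \<circ> Ga) id id \<epsilon>))"


section \<open>Logical connectives and quantifiers\<close>

definition is_top :: "('o, 'a, 'u::set_universe) over_set \<Rightarrow> 'u \<Rightarrow> 'o \<Rightarrow> bool" where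
  "is_top X M \<tau> \<longleftrightarrow> \<tau> \<in> fiber X M \<and> (\<forall>\<phi>\<in>fiber X M. fib_le X \<phi> \<tau>)"

definition is_meet :: "('o, 'a, 'u::set_universe) over_set \<Rightarrow> 'u \<Rightarrow> 'o \<Rightarrow> 'o \<Rightarrow> 'o \<Rightarrow> bool" where
  "is_meet X M \<phi> \<psi> \<chi> \<longleftrightarrow> {\<phi>, \<psi>, \<chi>} \<subseteq> fiber X M \<and>
     (\<forall>\<theta>\<in>fiber X M. fib_le X \<theta> \<chi> \<longleftrightarrow> fib_le X \<theta> \<phi> \<and> fib_le X \<theta> \<psi>)"

definition is_imp :: "('o, 'a, 'u::set_universe) over_set \<Rightarrow> 'u \<Rightarrow> 'o \<Rightarrow> 'o \<Rightarrow> 'o \<Rightarrow> bool" where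
  "is_imp X M \<phi> \<psi> \<chi> \<longleftrightarrow> {\<phi>, \<psi>, \<chi>} \<subseteq> fiber X M \<and>
     (\<forall>\<theta> \<mu>. is_meet X M \<theta> \<phi> \<mu> \<longrightarrow> (fib_le X \<theta> \<chi> \<longleftrightarrow> fib_le X \<mu> \<psi>))"

definition models_top :: "('o, 'a, 'u::set_universe) over_set \<Rightarrow> bool" where
  "models_top X \<longleftrightarrow> (\<forall>M. \<exists>\<tau>. is_top X M \<tau>) \<and>
     (\<forall>N M. \<forall>u\<in>Hom SET N M. \<forall>\<tau>. is_top X M \<tau> \<longrightarrow> is_top X N (reindex X u \<tau>))"

definition models_and :: "('o, 'a, 'u::set_universe) over_set \<Rightarrow> bool" where
  "models_and X \<longleftrightarrow> (\<forall>M. \<forall>\<phi>\<in>fiber X M. \<forall>\<psi>\<in>fiber X M. \<exists>\<chi>. is_meet X M \<phi> \<psi> \<chi>) \<and>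
     (\<forall>N M. \<forall>u\<in>Hom SET N M. \<forall>\<phi> \<psi> \<chi>. is_meet X M \<phi> \<psi> \<chi> \<longrightarrow>
        is_meet X N (reindex X u \<phi>) (reindex X u \<psi>) (reindex X u \<chi>))"

definition models_imp :: "('o, 'a, 'u::set_universe) over_set \<Rightarrow> bool" where
  "models_imp X \<longleftrightarrow> (\<forall>M. \<forall>\<phi>\<in>fiber X M. \<forall>\<psi>\<in>fiber X M. \<exists>\<chi>. is_imp X M \<phi> \<psi> \<chi>) \<and>
     (\<forall>N M. \<forall>u\<in>Hom SET N M. \<forall>\<phi> \<psi> \<chi>. is_imp X M \<phi> \<psi> \<chi> \<longrightarrow>
        is_imp X N (reindex X u \<phi>) (reindex X u \<psi>) (reindex X u \<chi>))"

text \<open>Adjoints between preorders, given as Galois connections (so \<open>L\<close> and \<open>R\<close> are monotone).\<close>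

definition left_adjoint ::
  "('o, 'a, 'u::set_universe) over_set \<Rightarrow> 'u set_map \<Rightarrow> ('o \<Rightarrow> 'o) \<Rightarrow> bool" where
  "left_adjoint X u L \<longleftrightarrow> L \<in> fiber X (sdom u) \<rightarrow> fiber X (scod u) \<and>
     (\<forall>\<phi>\<in>fiber X (sdom u). \<forall>\<psi>\<in>fiber X (scod u).
        fib_le X (L \<phi>) \<psi> \<longleftrightarrow> fib_le X \<phi> (reindex X u \<psi>))"

definition right_adjoint ::
  "('o, 'a, 'u::set_universe) over_set \<Rightarrow> 'u set_map \<Rightarrow> ('o \<Rightarrow> 'o) \<Rightarrow> bool" where
  "right_adjoint X u R \<longleftrightarrow> R \<in> fiber X (sdom u) \<rightarrow> fiber X (scod u) \<and>
     (\<forall>\<phi>\<in>fiber X (sdom u). \<forall>\<psi>\<in>fiber X (scod u).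
        fib_le X \<psi> (R \<phi>) \<longleftrightarrow> fib_le X (reindex X u \<psi>) \<phi>)"

definition ex_along :: "('o, 'a, 'u::set_universe) over_set \<Rightarrow> 'u set_map \<Rightarrow> 'o \<Rightarrow> 'o" where
  "ex_along X u = (SOME L. left_adjoint X u L)"

definition all_along :: "('o, 'a, 'u::set_universe) over_set \<Rightarrow> 'u set_map \<Rightarrow> 'o \<Rightarrow> 'o" where
  "all_along X u = (SOME R. right_adjoint X u R)"

definition models_ex :: "('o, 'a, 'u::set_universe) over_set \<Rightarrow> bool" where
  "models_ex X \<longleftrightarrow> (\<forall>u\<in>Arr SET. \<exists>L. left_adjoint X u L) \<and>
     (\<forall>p q u v. is_pullback SET p q u v \<longrightarrow> (\<forall>\<phi>\<in>fiber X (sdom u).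
        fib_iso X (ex_along X q (reindex X p \<phi>)) (reindex X v (ex_along X u \<phi>))))"

definition models_all :: "('o, 'a, 'u::set_universe) over_set \<Rightarrow> bool" where
  "models_all X \<longleftrightarrow> (\<forall>u\<in>Arr SET. \<exists>R. right_adjoint X u R) \<and>
     (\<forall>p q u v. is_pullback SET p q u v \<longrightarrow> (\<forall>\<phi>\<in>fiber X (sdom u).
        fib_iso X (all_along X q (reindex X p \<phi>)) (reindex X v (all_along X u \<phi>))))"


section \<open>Generated subfibrations, existential primes, and modesty\<close>

definition full_sub :: "('o, 'a, 'u::set_universe) over_set \<Rightarrow> 'o set \<Rightarrow> ('o, 'a, 'u) over_set" where
  "full_sub X P = X\<lparr> Obj := Obj X \<inter> P, Arr := {a \<in> Arr X. Dom X a \<in> P \<and> Cod X a \<in> P} \<rparr>"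

definition generated_sub ::
  "('o, 'a, 'u::set_universe) over_set \<Rightarrow> 'u \<Rightarrow> ('u \<Rightarrow> 'u) \<Rightarrow> ('u \<Rightarrow> 'o) \<Rightarrow> ('o, 'a, 'u) over_set" where
  "generated_sub X I A \<pi> = full_sub X
     {\<phi> \<in> Obj X. \<exists>i\<in>elts I. \<exists>f\<in>Hom SET (pobj X \<phi>) (A i). fib_iso X \<phi> (reindex X f (\<pi> i))}"

definition closed_under_finite_meets ::
  "('o, 'a, 'u::set_universe) over_set \<Rightarrow> ('o, 'a, 'u) over_set \<Rightarrow> bool" where
  "closed_under_finite_meets X A \<longleftrightarrow>
     (\<forall>M \<tau>. is_top X M \<tau> \<longrightarrow> \<tau> \<in> Obj A) \<and>
     (\<forall>M \<phi> \<psi> \<chi>. \<phi> \<in> Obj A \<longrightarrow> \<psi> \<in> Obj A \<longrightarrow> is_meet X M \<phi> \<psi> \<chi> \<longrightarrow> \<chi> \<in> Obj A)"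

definition generates_under_ex ::
  "('o, 'a, 'u::set_universe) over_set \<Rightarrow> ('o, 'a, 'u) over_set \<Rightarrow> bool" where
  "generates_under_ex A X \<longleftrightarrow>
     (\<forall>M. \<forall>\<phi>\<in>fiber X M. \<exists>N. \<exists>u\<in>Hom SET N M. \<exists>\<psi>\<in>fiber A N. fib_iso X \<phi> (ex_along X u \<psi>))"

definition ex_prime :: "('o, 'a, 'u::set_universe) over_set \<Rightarrow> 'o \<Rightarrow> bool" where
  "ex_prime X \<pi> \<longleftrightarrow> \<pi> \<in> Obj X \<and>
     (\<forall>J K. \<forall>u\<in>Hom SET J (pobj X \<pi>). \<forall>v\<in>Hom SET K J. \<forall>\<theta>\<in>fiber X K.
        fib_le X (reindex X u \<pi>) (ex_along X v \<theta>) \<longrightarrow>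
        (\<exists>L. \<exists>e\<in>Hom SET L J. \<exists>w\<in>Hom SET L K. surjection e \<and> Comp SET v w = e \<and>
           fib_le X (reindex X (Comp SET u e) \<pi>) (reindex X w \<theta>)))"

definition modest :: "('o, 'a, 'u::set_universe) over_set \<Rightarrow> 'o \<Rightarrow> bool" where
  "modest A \<mu> \<longleftrightarrow> \<mu> \<in> Obj A \<and>
     (\<forall>J K. \<forall>e\<in>Hom SET K J. \<forall>f\<in>Hom SET K (pobj A \<mu>). \<forall>\<phi>\<in>fiber A J.
        surjection e \<longrightarrow> fib_le A (reindex A e \<phi>) (reindex A f \<mu>) \<longrightarrow>
        (\<exists>h\<in>Hom SET J (pobj A \<mu>). Comp SET h e = f \<and> fib_le A \<phi> (reindex A h \<mu>)))"

text \<open>The conditions on a family of predicates \<open>\<pi> i\<close> on sets \<open>A i\<close>, for \<open>i\<close> in the index set \<open>I\<close>.\<close>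

definition modest_prime_generators ::
  "('o, 'a, 'u::set_universe) over_set \<Rightarrow> 'u \<Rightarrow> ('u \<Rightarrow> 'u) \<Rightarrow> ('u \<Rightarrow> 'o) \<Rightarrow> bool" where
  "modest_prime_generators X I A \<pi> \<longleftrightarrow>
     (\<forall>i\<in>elts I. \<pi> i \<in> fiber X (A i) \<and> ex_prime X (\<pi> i)) \<and>
     closed_under_finite_meets X (generated_sub X I A \<pi>) \<and>
     (\<forall>i\<in>elts I. modest (generated_sub X I A \<pi>) (\<pi> i)) \<and>
     generates_under_ex (generated_sub X I A \<pi>) X"


section \<open>Partial combinatory algebras and relative realizability\<close>

text \<open>
  \<open>papp app\<close> is application of possibly undefined values. It is strict, so a compound application is
  defined only if all its parts are.
\<close>

definition papp :: "('b \<Rightarrow> 'b \<Rightarrow> 'b option) \<Rightarrow> 'b option \<Rightarrow> 'b option \<Rightarrow> 'b option" where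
  "papp app p q = Option.bind p (\<lambda>x. Option.bind q (app x))"

definition closed_app :: "'b set \<Rightarrow> ('b \<Rightarrow> 'b \<Rightarrow> 'b option) \<Rightarrow> bool" where
  "closed_app B app \<longleftrightarrow> (\<forall>x\<in>B. \<forall>y\<in>B. \<forall>z. app x y = Some z \<longrightarrow> z \<in> B)"

definition combinators :: "'b set \<Rightarrow> ('b \<Rightarrow> 'b \<Rightarrow> 'b option) \<Rightarrow> 'b \<Rightarrow> 'b \<Rightarrow> bool" where
  "combinators B app k s \<longleftrightarrow> k \<in> B \<and> s \<in> B \<and>
     (\<forall>x\<in>B. \<forall>y\<in>B. papp app (papp app (Some k) (Some x)) (Some y) = Some x) \<and>
     (\<forall>x\<in>B. \<forall>y\<in>B. papp app (papp app (Some s) (Some x)) (Some y) \<noteq> None) \<and>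
     (\<forall>x\<in>B. \<forall>y\<in>B. \<forall>z\<in>B. \<forall>r.
        papp app (papp app (Some x) (Some z)) (papp app (Some y) (Some z)) = Some r \<longrightarrow>
        papp app (papp app (papp app (Some s) (Some x)) (Some y)) (Some z) = Some r)"

definition pca :: "'b set \<Rightarrow> ('b \<Rightarrow> 'b \<Rightarrow> 'b option) \<Rightarrow> bool" where
  "pca B app \<longleftrightarrow> closed_app B app \<and> (\<exists>k\<in>B. \<exists>s\<in>B. combinators B app k s)"

definition pca_inclusion :: "'b set \<Rightarrow> 'b set \<Rightarrow> ('b \<Rightarrow> 'b \<Rightarrow> 'b option) \<Rightarrow> bool" where
  "pca_inclusion B' B app \<longleftrightarrow> pca B app \<and> B' \<subseteq> B \<and> closed_app B' app \<and>
     (\<exists>k\<in>B'. \<exists>s\<in>B'. combinators B app k s)"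

text \<open>
  The fibration of a \<open>'u\<close>-indexed preorder (Grothendieck construction): an arrow from \<open>\<phi>\<close> over \<open>M\<close> to
  \<open>\<psi>\<close> over \<open>N\<close> is a map \<open>u\<close> with \<open>\<phi> \<le> u\<^sup>*\<psi>\<close> in the fiber over \<open>M\<close>.
\<close>

definition total_fibration ::
  "('u::set_universe \<Rightarrow> 'p set) \<Rightarrow> ('u \<Rightarrow> 'p \<Rightarrow> 'p \<Rightarrow> bool) \<Rightarrow> ('u set_map \<Rightarrow> 'p \<Rightarrow> 'p) \<Rightarrow>
   ('u \<times> 'p, ('u \<times> 'p) \<times> 'u set_map \<times> ('u \<times> 'p), 'u) over_set" where
  "total_fibration P le pull =
     \<lparr> Obj = {(M, \<phi>). \<phi> \<in> P M},
       Arr = {((M, \<phi>), u, (N, \<psi>)) | M \<phi> u N \<psi>.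
                \<phi> \<in> P M \<and> \<psi> \<in> P N \<and> u \<in> Hom SET M N \<and> le M \<phi> (pull u \<psi>)},
       Dom = (\<lambda>(x, u, y). x),
       Cod = (\<lambda>(x, u, y). y),
       Id = (\<lambda>x. (x, Id SET (fst x), x)),
       Comp = (\<lambda>(y, v, z) (x, u, y'). (x, Comp SET v u, z)),
       pobj = fst,
       parr = (\<lambda>(x, u, y). u) \<rparr>"

definition rr_tripos ::
  "'b set \<Rightarrow> 'b set \<Rightarrow> ('b \<Rightarrow> 'b \<Rightarrow> 'b option) \<Rightarrow>
   ('u::set_universe \<times> ('u \<Rightarrow> 'b set),
    ('u \<times> ('u \<Rightarrow> 'b set)) \<times> 'u set_map \<times> ('u \<times> ('u \<Rightarrow> 'b set)), 'u) over_set" where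
  "rr_tripos B' B app =
     total_fibration
       (\<lambda>M. elts M \<rightarrow>\<^sub>E Pow B)
       (\<lambda>M \<phi> \<psi>. \<exists>e\<in>B'. \<forall>m\<in>elts M. \<forall>a\<in>\<phi> m. \<exists>b. app e a = Some b \<and> b \<in> \<psi> m)
       (\<lambda>u \<psi>. compose (elts (sdom u)) \<psi> (sfun u))"

end

theory Submission
  imports Defs
begin

text \<open>
  Left to right, everything is computed with realizers, the generating predicate being \<open>b \<mapsto> {b}\<close>.

  Right to left, let \<open>\<pi>\<close> over \<open>A\<close> be the modest prime generator. Modesty makes \<open>f\<^sup>*\<pi> \<le> g\<^sup>*\<pi>\<close> force \<open>g\<close>
  to be a function of \<open>f\<close>, so the fiberwise order on maps into \<open>A\<close> is given by a class of partial
  functions \<open>A \<rightharpoonup> A\<close>. Existential primeness, together with generation under \<open>\<exists>\<close>, identifies predicates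
  on \<open>M\<close> with functions \<open>M \<rightarrow> P(A)\<close>, ordered by tracking with a partial function of this class.
  Closure under finite meets gives a pairing on \<open>A\<close>; implication and universal quantification give a
  predicate \<open>\<forall>(b, d) \<in> S. \<pi>(b) \<Rightarrow> \<pi>(d)\<close> on relations \<open>S \<subseteq> A \<times> A\<close>, whose elements serve as codes of
  partial functions and make \<open>A\<close> a pca. The sub-pca consists of the elements \<open>a\<close> with \<open>\<top> \<le> a\<^sup>*\<pi>\<close>.
  Since surjections split by the axiom of choice, coverings never have to be refined.
\<close>

section \<open>Small sets\<close>

text \<open>The operations \<open>reindex\<close>, \<open>ex_along\<close> and
  \<open>all_along\<close> are Hilbert choices, fixed only up to isomorphism in a fiber. So
  faithfulness is used to trade arrows for a relation, and each connective is reached through its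
  universal property. The crux of the converse is to name tracking functions by elements of A. The
  predicate \<forall>(b, d) \<in> S. \<pi>(b) \<Rightarrow> \<pi>(d) on all relations S is not known
  to be a reindexing of \<pi>; generation only presents it as an existential quantification of one.
  Hence a relation may have many codes, and an element of A may code several relations. Primeness
  selects codes as a function of a parameter, tracked by that parameter. Modesty, applied to all
  triples (code, argument, value) at once, shows that an element of A and an argument still
  determine the value. The parameter ranges over all of A even if the map to be curried is given
  only over some family: a relation may be empty, so partiality is absorbed by the code. This is why
  s x y can be defined for all x and y.\<close>

definition small :: "'a::set_universe set \<Rightarrow> bool" where
  "small S \<longleftrightarrow> (\<exists>x. elts x = S)"

definition code :: "'a::set_universe set \<Rightarrow> 'a" where
  "code S = (SOME x. elts x = S)"

lemma elts_code [simp]: "small S \<Longrightarrow> elts (code S) = S"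
  unfolding small_def code_def by (rule someI_ex)

lemma small_elts [simp]: "small (elts x)"
  by (auto simp: small_def)

lemma small_subset:
  assumes "small S" "T \<subseteq> S" shows "small T"
proof -
  obtain x where "elts x = S" using assms(1) by (auto simp: small_def)
  moreover obtain y where "elts y = {z \<in> elts x. z \<in> T}" using separation[of x "\<lambda>z. z \<in> T"] by blast
  ultimately have "elts y = T" using assms(2) by blast
  thus ?thesis by (auto simp: small_def)
qed

lemma small_image: "small S \<Longrightarrow> small (f ` S)" for f :: "'a::set_universe \<Rightarrow> 'a"
proof -
  assume "small S"
  then obtain x where "elts x = S" by (auto simp: small_def)
  moreover obtain y where "elts y = f ` elts x" using replacement[of f x] by blast
  ultimately show ?thesis by (auto simp: small_def)
qed

text \<open>The sets \<open>T x\<close> are HOL sets, so replacement is applied to their codes and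
  the union axiom to the result.\<close>

lemma small_UN:
  fixes T :: "'a::set_universe \<Rightarrow> 'a set"
  assumes "small S" "\<And>x. x \<in> S \<Longrightarrow> small (T x)" shows "small (\<Union>x\<in>S. T x)"
proof -
  obtain y where y: "elts y = (\<lambda>x. code (T x)) ` S"
    using small_image[OF assms(1), of "\<lambda>x. code (T x)"] by (auto simp: small_def)
  obtain z where "elts z = (\<Union>w\<in>elts y. elts w)" using union by blast
  hence "elts z = (\<Union>x\<in>S. T x)" using assms(2) by (simp add: y)
  thus ?thesis by (auto simp: small_def)
qed

lemma small_subsets: "small {z. elts z \<subseteq> elts x}"
  unfolding small_def using power_set by metis

text \<open>Pairing comes from replacement: an infinite set supplies two distinct elements, which
  are sent to \<open>a\<close> and \<open>b\<close>.\<close>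

lemma small_doubleton [simp]: "small {a, b}"
proof -
  obtain x :: 'a where x: "infinite (elts x)" using infinity by blast
  then obtain p where p: "p \<in> elts x" by fastforce
  have "infinite (elts x - {p})" using x by simp
  then obtain q where q: "q \<in> elts x - {p}" using infinite_imp_nonempty by blast
  have "(\<lambda>z. if z = p then a else b) ` elts x = {a, b}" using p q by (auto simp: image_iff)
  thus ?thesis by (metis small_image small_elts)
qed

lemma small_singleton [simp]: "small {a}"
  using small_doubleton[of a a] by simp

section \<open>Ordered pairs and dependent sums in the universe\<close>

definition opair :: "'a::set_universe \<Rightarrow> 'a \<Rightarrow> 'a" where
  "opair a b = code {code {a}, code {a, b}}"

lemma opair_eq_iff [simp]: "opair a b = opair c d \<longleftrightarrow> a = c \<and> b = d"
proof
  assume "opair a b = opair c d"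
  hence "{code {a}, code {a, b}} = {code {c}, code {c, d}}"
    by (metis opair_def elts_code small_doubleton)
  hence "elts ` {code {a}, code {a, b}} = elts ` {code {c}, code {c, d}}" by simp
  hence "{{a}, {a, b}} = {{c}, {c, d}}" by simp
  thus "a = c \<and> b = d" by (auto simp: doubleton_eq_iff)
qed auto

lemma opair_in_image [simp]: "opair a b \<in> case_prod opair ` S \<longleftrightarrow> (a, b) \<in> S"
  by force

text \<open>The projections are total on the universe, with unspecified values off the pairs, so the
  same two functions serve as maps out of every set of pairs.\<close>

definition unpair :: "'a::set_universe \<Rightarrow> 'a \<times> 'a" where
  "unpair = inv (case_prod opair)"

abbreviation ufst :: "'a::set_universe \<Rightarrow> 'a" where "ufst z \<equiv> fst (unpair z)"
abbreviation usnd :: "'a::set_universe \<Rightarrow> 'a" where "usnd z \<equiv> snd (unpair z)"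

lemma unpair_opair [simp]: "unpair (opair a b) = (a, b)"
proof -
  have "inj (case_prod opair :: 'a \<times> 'a \<Rightarrow> 'a)" by (auto simp: inj_def)
  from inv_f_f[OF this, of "(a, b)"] show ?thesis by (simp add: unpair_def)
qed

definition usigma :: "'a::set_universe \<Rightarrow> ('a \<Rightarrow> 'a set) \<Rightarrow> 'a" where
  "usigma x T = code (case_prod opair ` (SIGMA a:elts x. T a))"

lemma elts_usigma:
  assumes "\<And>a. a \<in> elts x \<Longrightarrow> small (T a)"
  shows "elts (usigma x T) = case_prod opair ` (SIGMA a:elts x. T a)"
proof -
  have "case_prod opair ` (SIGMA a:elts x. T a) = (\<Union>a\<in>elts x. opair a ` T a)" by auto
  moreover have "small \<dots>" using assms by (intro small_UN small_image) auto
  ultimately show ?thesis unfolding usigma_def by simp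
qed


section \<open>Maps of sets\<close>

text \<open>A HOL function presents an arrow of \<open>SET\<close>; the restriction is forced by the
  extensionality of \<open>sfun\<close>. Every arrow has this form by \<open>hom_smapE\<close>, and
  two presentations agree iff the functions agree on \<open>elts M\<close>, so arrows are calculated
  with as lambda terms.\<close>

definition smap :: "'u::set_universe \<Rightarrow> 'u \<Rightarrow> ('u \<Rightarrow> 'u) \<Rightarrow> 'u set_map" where
  "smap M N f = \<lparr> sdom = M, scod = N, sfun = restrict f (elts M) \<rparr>"

lemma smap_sel [simp]: "sdom (smap M N f) = M" "scod (smap M N f) = N"
  "x \<in> elts M \<Longrightarrow> sfun (smap M N f) x = f x"
  by (simp_all add: smap_def)

lemma SET_sel [simp]: "Obj SET = UNIV" "Dom SET = sdom" "Cod SET = scod"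
  by (simp_all add: SET_def)

lemma smap_hom [simp, intro]: "f \<in> elts M \<rightarrow> elts N \<Longrightarrow> smap M N f \<in> Hom SET M N"
  by (auto simp: Hom_def SET_def smap_def)

lemma smap_arr [simp, intro]: "f \<in> elts M \<rightarrow> elts N \<Longrightarrow> smap M N f \<in> Arr SET"
  using smap_hom by (auto simp: Hom_def)

lemma Hom_SET_iff:
  "u \<in> Hom SET M N \<longleftrightarrow> sdom u = M \<and> scod u = N \<and> sfun u \<in> elts M \<rightarrow>\<^sub>E elts N"
  by (auto simp: Hom_def SET_def)

lemma smap_cong: "(\<And>x. x \<in> elts M \<Longrightarrow> f x = g x) \<Longrightarrow> smap M N f = smap M N g"
  by (auto simp: smap_def restrict_def)

lemma smap_eqD: "smap M N f = smap M N g \<Longrightarrow> x \<in> elts M \<Longrightarrow> f x = g x"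
  by (metis smap_sel(3))

lemma hom_smapE:
  assumes "u \<in> Hom SET M N"
  obtains f where "u = smap M N f" "f \<in> elts M \<rightarrow> elts N"
proof
  show "u = smap M N (sfun u)" using assms
    by (cases u) (auto simp: Hom_SET_iff smap_def PiE_def extensional_restrict)
  show "sfun u \<in> elts M \<rightarrow> elts N" using assms by (auto simp: Hom_SET_iff)
qed

lemma comp_smap [simp]:
  "f \<in> elts M \<rightarrow> elts N \<Longrightarrow> Comp SET (smap N K g) (smap M N f) = smap M K (\<lambda>x. g (f x))"
  by (auto simp: SET_def smap_def compose_def fun_eq_iff)

lemma Id_smap: "Id SET M = smap M M (\<lambda>x. x)"
  by (simp add: SET_def smap_def)

lemma Id_hom [simp, intro]: "Id SET M \<in> Hom SET M M"
  unfolding Id_smap by auto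

lemma comp_hom [intro]:
  "u \<in> Hom SET M N \<Longrightarrow> v \<in> Hom SET N K \<Longrightarrow> Comp SET v u \<in> Hom SET M K"
  by (elim hom_smapE) auto

lemma comp_id [simp]:
  assumes "u \<in> Hom SET M N"
  shows "Comp SET u (Id SET M) = u" "Comp SET (Id SET N) u = u"
  using assms by (auto elim!: hom_smapE simp: Id_smap)

lemma comp_assoc:
  assumes "u \<in> Hom SET M N" "v \<in> Hom SET N K" "w \<in> Hom SET K L"
  shows "Comp SET w (Comp SET v u) = Comp SET (Comp SET w v) u"
proof -
  obtain f g h where u: "u = smap M N f" and f: "f \<in> elts M \<rightarrow> elts N"
    and v: "v = smap N K g" and g: "g \<in> elts N \<rightarrow> elts K" and w: "w = smap K L h"
    using assms by (metis hom_smapE)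
  moreover have "(\<lambda>x. g (f x)) \<in> elts M \<rightarrow> elts K" using f g by auto
  ultimately show ?thesis by simp
qed

lemma surjection_split:
  assumes "e \<in> Hom SET K J" "surjection e"
  obtains s where "s \<in> Hom SET J K" "Comp SET e s = Id SET J"
proof -
  obtain f where f: "e = smap K J f" "f \<in> elts K \<rightarrow> elts J" using assms(1) by (rule hom_smapE)
  have im: "f ` elts K = elts J" using assms(2) by (auto simp: surjection_def f(1))
  define g where "g = inv_into (elts K) f"
  have g: "g \<in> elts J \<rightarrow> elts K" using im by (auto simp: g_def intro!: inv_into_into)
  have "f (g j) = j" if "j \<in> elts J" for j using that im by (auto simp: g_def f_inv_into_f)
  hence "Comp SET e (smap J K g) = Id SET J" using g by (auto simp: f(1) Id_smap intro: smap_cong)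
  thus thesis using that smap_hom[OF g] by blast
qed

section \<open>Pullback squares of sets in terms of elements\<close>

lemma is_pullbackI:
  assumes p: "p \<in> elts P \<rightarrow> elts J" and q: "q \<in> elts P \<rightarrow> elts K"
    and u: "u \<in> elts J \<rightarrow> elts I" and v: "v \<in> elts K \<rightarrow> elts I"
    and comm: "\<And>x. x \<in> elts P \<Longrightarrow> u (p x) = v (q x)"
    and ex: "\<And>j k. j \<in> elts J \<Longrightarrow> k \<in> elts K \<Longrightarrow> u j = v k \<Longrightarrow> \<exists>x\<in>elts P. p x = j \<and> q x = k"
    and inj: "\<And>x y. x \<in> elts P \<Longrightarrow> y \<in> elts P \<Longrightarrow> p x = p y \<Longrightarrow> q x = q y \<Longrightarrow> x = y"
  shows "is_pullback SET (smap P J p) (smap P K q) (smap J I u) (smap K I v)"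
proof -
  have "\<exists>!w. w \<in> Hom SET x P \<and> Comp SET (smap P J p) w = a \<and> Comp SET (smap P K q) w = b"
    if a: "a \<in> Hom SET x J" and b: "b \<in> Hom SET x K" and e: "Comp SET (smap J I u) a = Comp SET (smap K I v) b"
    for x a b
  proof -
    obtain f where f: "a = smap x J f" "f \<in> elts x \<rightarrow> elts J" using a by (rule hom_smapE)
    obtain g where g: "b = smap x K g" "g \<in> elts x \<rightarrow> elts K" using b by (rule hom_smapE)
    have uv: "u (f z) = v (g z)" if "z \<in> elts x" for z
    proof -
      have "smap x I (\<lambda>z. u (f z)) = smap x I (\<lambda>z. v (g z))" using e f(2) g(2) by (simp add: f(1) g(1))
      from smap_eqD[OF this that] show ?thesis .
    qed
    hence "\<forall>z\<in>elts x. \<exists>y\<in>elts P. p y = f z \<and> q y = g z"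
      using ex f(2) g(2) by (metis PiE)
    then obtain h where h: "\<forall>z\<in>elts x. h z \<in> elts P \<and> p (h z) = f z \<and> q (h z) = g z"
      by metis
    show ?thesis
    proof (rule ex1I[of _ "smap x P h"])
      have "h \<in> elts x \<rightarrow> elts P" using h by auto
      thus "smap x P h \<in> Hom SET x P \<and> Comp SET (smap P J p) (smap x P h) = a
          \<and> Comp SET (smap P K q) (smap x P h) = b"
        using h by (auto simp: f g intro!: smap_cong)
    next
      fix w assume w: "w \<in> Hom SET x P \<and> Comp SET (smap P J p) w = a \<and> Comp SET (smap P K q) w = b"
      then obtain k where k: "w = smap x P k" "k \<in> elts x \<rightarrow> elts P" by (auto elim: hom_smapE)
      have pk: "smap x J (\<lambda>z. p (k z)) = smap x J f" "smap x K (\<lambda>z. q (k z)) = smap x K g"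
        using w k by (simp_all add: f g)
      have "k z = h z" if z: "z \<in> elts x" for z
        using smap_eqD[OF pk(1) z] smap_eqD[OF pk(2) z] h z k(2) inj[of "k z" "h z"] by auto
      thus "w = smap x P h" unfolding k(1) by (rule smap_cong)
    qed
  qed
  moreover have "Comp SET (smap J I u) (smap P J p) = Comp SET (smap K I v) (smap P K q)"
    using p q comm by (auto intro: smap_cong)
  ultimately show ?thesis using p q u v unfolding is_pullback_def by auto
qed

lemma is_pullbackD:
  assumes "is_pullback SET p q u v"
  obtains P J K I p' q' u' v' where
    "p = smap P J p'" "q = smap P K q'" "u = smap J I u'" "v = smap K I v'"
    "p' \<in> elts P \<rightarrow> elts J" "q' \<in> elts P \<rightarrow> elts K" "u' \<in> elts J \<rightarrow> elts I" "v' \<in> elts K \<rightarrow> elts I"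
    "\<And>x. x \<in> elts P \<Longrightarrow> u' (p' x) = v' (q' x)"
    "\<And>j k. j \<in> elts J \<Longrightarrow> k \<in> elts K \<Longrightarrow> u' j = v' k \<Longrightarrow> \<exists>x\<in>elts P. p' x = j \<and> q' x = k"
proof -
  let ?P = "sdom p" and ?J = "sdom u" and ?K = "sdom v" and ?I = "scod u"
  have h: "p \<in> Hom SET ?P ?J" "q \<in> Hom SET ?P ?K" "u \<in> Hom SET ?J ?I" "v \<in> Hom SET ?K ?I"
    using assms by (auto simp: is_pullback_def Hom_def)
  obtain p' where p: "p = smap ?P ?J p'" "p' \<in> elts ?P \<rightarrow> elts ?J" using h(1) by (rule hom_smapE)
  obtain q' where q: "q = smap ?P ?K q'" "q' \<in> elts ?P \<rightarrow> elts ?K" using h(2) by (rule hom_smapE)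
  obtain u' where u: "u = smap ?J ?I u'" "u' \<in> elts ?J \<rightarrow> elts ?I" using h(3) by (rule hom_smapE)
  obtain v' where v: "v = smap ?K ?I v'" "v' \<in> elts ?K \<rightarrow> elts ?I" using h(4) by (rule hom_smapE)
  have "Comp SET u p = Comp SET v q" using assms by (simp add: is_pullback_def)
  hence "Comp SET (smap ?J ?I u') (smap ?P ?J p') = Comp SET (smap ?K ?I v') (smap ?P ?K q')"
    using p(1) q(1) u(1) v(1) by simp
  hence c: "smap ?P ?I (\<lambda>x. u' (p' x)) = smap ?P ?I (\<lambda>x. v' (q' x))" using p(2) q(2) by simp
  have "\<exists>x\<in>elts ?P. p' x = j \<and> q' x = k" if jk: "j \<in> elts ?J" "k \<in> elts ?K" "u' j = v' k" for j k
  proof -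
    \<comment> \<open>Elements of the pullback are recovered from its universal property by testing
      on a one-point set.\<close>
    define T where "T = code {j}"
    have T: "elts T = {j}" by (simp add: T_def)
    let ?a = "smap T ?J (\<lambda>_. j)" and ?b = "smap T ?K (\<lambda>_. k)"
    have ab: "?a \<in> Hom SET T ?J" "?b \<in> Hom SET T ?K" using jk by auto
    have "Comp SET (smap ?J ?I u') ?a = Comp SET (smap ?K ?I v') ?b" using jk by simp
    hence "Comp SET u ?a = Comp SET v ?b" using u(1) v(1) by simp
    then obtain w where w: "w \<in> Hom SET T ?P" "Comp SET p w = ?a" "Comp SET q w = ?b"
      using assms ab unfolding is_pullback_def by auto metis
    obtain w' where w': "w = smap T ?P w'" "w' \<in> elts T \<rightarrow> elts ?P" using w(1) by (rule hom_smapE)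
    have "Comp SET (smap ?P ?J p') w = ?a" "Comp SET (smap ?P ?K q') w = ?b"
      using w p(1) q(1) by simp_all
    hence pq: "smap T ?J (\<lambda>x. p' (w' x)) = ?a" "smap T ?K (\<lambda>x. q' (w' x)) = ?b" using w' by simp_all
    have "p' (w' j) = j" "q' (w' j) = k"
      using smap_eqD[OF pq(1), of j] smap_eqD[OF pq(2), of j] by (simp_all add: T)
    thus ?thesis using w'(2) T by auto
  qed
  thus thesis using that[OF p(1) q(1) u(1) v(1) p(2) q(2) u(2) v(2)] smap_eqD[OF c] by blast
qed

section \<open>Posetal fibrations\<close>

text \<open>In a posetal fibration at most one arrow from \<open>\<phi>\<close> to
  \<open>\<psi>\<close> lies over \<open>u\<close>, so its existence is all that matters. This
  relation stands in for arrows from here on.\<close>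

definition reaches :: "('o, 'a, 'u::set_universe) over_set \<Rightarrow> 'o \<Rightarrow> 'u set_map \<Rightarrow> 'o \<Rightarrow> bool" where
  "reaches X \<phi> u \<psi> \<longleftrightarrow> (\<exists>a\<in>Hom X \<phi> \<psi>. parr X a = u)"

lemma fib_le_reaches: "fib_le X \<phi> \<psi> \<longleftrightarrow> reaches X \<phi> (Id SET (pobj X \<phi>)) \<psi>"
  by (simp add: fib_le_def reaches_def)

lemma fiber_iff: "\<phi> \<in> fiber X M \<longleftrightarrow> \<phi> \<in> Obj X \<and> pobj X \<phi> = M"
  by (simp add: fiber_def)

locale posetal =
  fixes X :: "('o, 'a, 'u::set_universe) over_set"
  assumes posetal: "posetal_fibration X"
begin

abbreviation le (infix "\<preceq>" 50) where "\<phi> \<preceq> \<psi> \<equiv> fib_le X \<phi> \<psi>"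
abbreviation iso (infix "\<cong>" 50) where "\<phi> \<cong> \<psi> \<equiv> fib_iso X \<phi> \<psi>"

lemma category_X: "category X" and functor_X: "is_functor X SET (pobj X) (parr X)"
  and faithful_X: "faithful X (parr X)"
  using posetal by (auto simp: posetal_fibration_def fibration_def)

lemma Hom_Obj: "a \<in> Hom X \<phi> \<psi> \<Longrightarrow> \<phi> \<in> Obj X \<and> \<psi> \<in> Obj X"
  using category_X by (auto simp: category_def Hom_def)

lemma Hom_Id: "\<phi> \<in> Obj X \<Longrightarrow> Id X \<phi> \<in> Hom X \<phi> \<phi>"
  using category_X by (auto simp: category_def)

lemma Hom_Comp: "a \<in> Hom X \<phi> \<psi> \<Longrightarrow> b \<in> Hom X \<psi> \<chi> \<Longrightarrow> Comp X b a \<in> Hom X \<phi> \<chi>"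
  using category_X unfolding category_def by blast

lemma parr_Hom: "a \<in> Hom X \<phi> \<psi> \<Longrightarrow> parr X a \<in> Hom SET (pobj X \<phi>) (pobj X \<psi>)"
  using functor_X unfolding is_functor_def by blast

lemma parr_Id: "\<phi> \<in> Obj X \<Longrightarrow> parr X (Id X \<phi>) = Id SET (pobj X \<phi>)"
  using functor_X unfolding is_functor_def by blast

lemma parr_Comp:
  "a \<in> Hom X \<phi> \<psi> \<Longrightarrow> b \<in> Hom X \<psi> \<chi> \<Longrightarrow> parr X (Comp X b a) = Comp SET (parr X b) (parr X a)"
  using functor_X unfolding is_functor_def by blast

lemma parr_inj: "a \<in> Hom X \<phi> \<psi> \<Longrightarrow> b \<in> Hom X \<phi> \<psi> \<Longrightarrow> parr X a = parr X b \<Longrightarrow> a = b"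
  using faithful_X unfolding faithful_def inj_on_def by blast

lemma reachesD:
  assumes "reaches X \<phi> u \<psi>"
  shows "\<phi> \<in> Obj X" "\<psi> \<in> Obj X" "u \<in> Hom SET (pobj X \<phi>) (pobj X \<psi>)"
  using assms Hom_Obj parr_Hom by (auto simp: reaches_def)

lemma reaches_comp: "reaches X \<phi> u \<psi> \<Longrightarrow> reaches X \<psi> v \<chi> \<Longrightarrow> reaches X \<phi> (Comp SET v u) \<chi>"
  unfolding reaches_def using Hom_Comp parr_Comp by metis

lemma reaches_id: "\<phi> \<in> Obj X \<Longrightarrow> reaches X \<phi> (Id SET (pobj X \<phi>)) \<phi>"
  unfolding reaches_def using Hom_Id parr_Id by metis

lemma le_refl: "\<phi> \<in> fiber X M \<Longrightarrow> \<phi> \<preceq> \<phi>"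
  using reaches_id by (auto simp: fib_le_reaches fiber_iff)

lemma le_fiber: "\<phi> \<preceq> \<psi> \<Longrightarrow> \<phi> \<in> Obj X \<and> \<psi> \<in> Obj X \<and> pobj X \<phi> = pobj X \<psi>"
proof -
  assume "\<phi> \<preceq> \<psi>"
  note r = reachesD[OF this[unfolded fib_le_reaches]]
  from r(3) have "pobj X \<phi> = pobj X \<psi>" by (simp add: Hom_SET_iff Id_smap)
  with r show ?thesis by blast
qed

lemma le_reaches: "\<phi> \<preceq> \<psi> \<Longrightarrow> reaches X \<psi> u \<chi> \<Longrightarrow> reaches X \<phi> u \<chi>"
  using reaches_comp[of \<phi> "Id SET (pobj X \<phi>)" \<psi> u \<chi>] reachesD(3)[of \<psi> u \<chi>] le_fiber[of \<phi> \<psi>]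
  by (simp add: fib_le_reaches)

lemma reaches_le: "reaches X \<phi> u \<psi> \<Longrightarrow> \<psi> \<preceq> \<chi> \<Longrightarrow> reaches X \<phi> u \<chi>"
  using reaches_comp[of \<phi> u \<psi> "Id SET (pobj X \<psi>)" \<chi>] reachesD(3)[of \<phi> u \<psi>]
  by (simp add: fib_le_reaches)

lemma le_trans [trans]: "\<phi> \<preceq> \<psi> \<Longrightarrow> \<psi> \<preceq> \<chi> \<Longrightarrow> \<phi> \<preceq> \<chi>"
  using reaches_le by (simp add: fib_le_reaches)

lemma le_fiber1: "\<phi> \<preceq> \<psi> \<Longrightarrow> \<psi> \<in> fiber X M \<Longrightarrow> \<phi> \<in> fiber X M"
  using le_fiber by (auto simp: fiber_iff)

text \<open>Uniqueness of a factorization and its composition equation both follow from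
  faithfulness; what remains of cartesianness is a condition on \<open>reaches\<close>.\<close>

lemma cartesian_iff:
  "cartesian X a \<longleftrightarrow> a \<in> Arr X \<and> (\<forall>\<theta>\<in>Obj X. \<forall>w\<in>Hom SET (pobj X \<theta>) (pobj X (Dom X a)).
     reaches X \<theta> (Comp SET (parr X a) w) (Cod X a) \<longrightarrow> reaches X \<theta> w (Dom X a))"
  (is "?l \<longleftrightarrow> ?r")
proof
  assume l: ?l
  show ?r
  proof (intro conjI ballI impI)
    fix \<theta> w assume *: "\<theta> \<in> Obj X" "w \<in> Hom SET (pobj X \<theta>) (pobj X (Dom X a))"
      "reaches X \<theta> (Comp SET (parr X a) w) (Cod X a)"
    then obtain b where "b \<in> Hom X \<theta> (Cod X a)" "parr X b = Comp SET (parr X a) w"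
      by (auto simp: reaches_def)
    with l * show "reaches X \<theta> w (Dom X a)" unfolding cartesian_def reaches_def by blast
  qed (use l in \<open>simp add: cartesian_def\<close>)
next
  assume r: ?r
  hence a: "a \<in> Hom X (Dom X a) (Cod X a)" by (simp add: Hom_def)
  show ?l unfolding cartesian_def
  proof (intro conjI allI ballI impI)
    fix \<theta> b w assume b: "b \<in> Hom X \<theta> (Cod X a)" and w: "w \<in> Hom SET (pobj X \<theta>) (pobj X (Dom X a))"
      and bw: "parr X b = Comp SET (parr X a) w"
    have "reaches X \<theta> (Comp SET (parr X a) w) (Cod X a)" using b bw by (auto simp: reaches_def)
    hence "reaches X \<theta> w (Dom X a)" using r w Hom_Obj[OF b] by blast
    then obtain c where c: "c \<in> Hom X \<theta> (Dom X a)" "parr X c = w" by (auto simp: reaches_def)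
    have "Comp X a c = b"
      by (rule parr_inj[OF Hom_Comp[OF c(1) a] b]) (simp add: parr_Comp[OF c(1) a] c(2) bw)
    thus "\<exists>!c. c \<in> Hom X \<theta> (Dom X a) \<and> parr X c = w \<and> Comp X a c = b"
      using c parr_inj by blast
  qed (use r in simp)
qed

lemma reindex_cartesian:
  assumes "u \<in> Hom SET M N" "\<psi> \<in> fiber X N"
  obtains a where "cartesian X a" "Cod X a = \<psi>" "parr X a = u" "Dom X a = reindex X u \<psi>"
    "a \<in> Hom X (reindex X u \<psi>) \<psi>" "reindex X u \<psi> \<in> fiber X M"
proof -
  have "\<exists>a. cartesian X a \<and> Cod X a = \<psi> \<and> parr X a = u"
    using posetal assms by (auto simp: posetal_fibration_def fibration_def fiber_iff)
  then obtain a where a: "cartesian X a \<and> Cod X a = \<psi> \<and> parr X a = u" "Dom X a = reindex X u \<psi>"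
    unfolding reindex_def by (metis (mono_tags, lifting) someI_ex)
  hence h: "a \<in> Hom X (reindex X u \<psi>) \<psi>" by (auto simp: Hom_def cartesian_def)
  have "reindex X u \<psi> \<in> fiber X M" using parr_Hom[OF h] Hom_Obj[OF h] a(1) assms(1)
    by (auto simp: fiber_iff Hom_SET_iff)
  thus thesis using that a h by blast
qed

lemma reindex_fiber: "u \<in> Hom SET M N \<Longrightarrow> \<psi> \<in> fiber X N \<Longrightarrow> reindex X u \<psi> \<in> fiber X M"
  using reindex_cartesian by blast

lemma reaches_reindex:
  assumes "u \<in> Hom SET M N" "\<psi> \<in> fiber X N" "\<theta> \<in> fiber X L" "w \<in> Hom SET L M"
  shows "reaches X \<theta> w (reindex X u \<psi>) \<longleftrightarrow> reaches X \<theta> (Comp SET u w) \<psi>"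
proof -
  obtain a where a: "cartesian X a" "Cod X a = \<psi>" "parr X a = u" "Dom X a = reindex X u \<psi>"
    "a \<in> Hom X (reindex X u \<psi>) \<psi>" "reindex X u \<psi> \<in> fiber X M"
    using assms(1,2) by (rule reindex_cartesian)
  have "reaches X (reindex X u \<psi>) u \<psi>" using a by (auto simp: reaches_def)
  hence "reaches X \<theta> (Comp SET u w) \<psi>" if "reaches X \<theta> w (reindex X u \<psi>)"
    using reaches_comp[OF that] by blast
  moreover have "reaches X \<theta> w (reindex X u \<psi>)" if "reaches X \<theta> (Comp SET u w) \<psi>"
    using a(1) that assms(3,4) a(6) unfolding cartesian_iff a fiber_iff by simp
  ultimately show ?thesis by blast
qed

lemma le_reindex:
  assumes "u \<in> Hom SET M N" "\<psi> \<in> fiber X N" "\<theta> \<in> fiber X M"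
  shows "\<theta> \<preceq> reindex X u \<psi> \<longleftrightarrow> reaches X \<theta> u \<psi>"
  using reaches_reindex[OF assms Id_hom] assms by (simp add: fib_le_reaches fiber_iff)

lemma reindex_reaches: "u \<in> Hom SET M N \<Longrightarrow> \<psi> \<in> fiber X N \<Longrightarrow> reaches X (reindex X u \<psi>) u \<psi>"
  using le_reindex le_refl reindex_fiber by blast

lemma reindex_mono:
  assumes "u \<in> Hom SET M N" "\<phi> \<preceq> \<psi>" "\<psi> \<in> fiber X N"
  shows "reindex X u \<phi> \<preceq> reindex X u \<psi>"
proof -
  have p: "\<phi> \<in> fiber X N" using assms le_fiber1 by blast
  show ?thesis using reaches_le[OF reindex_reaches[OF assms(1) p] assms(2)] assms p
    by (simp add: le_reindex reindex_fiber)
qed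

lemma reindex_comp:
  assumes "u \<in> Hom SET M N" "v \<in> Hom SET N K" "\<psi> \<in> fiber X K"
  shows "reindex X u (reindex X v \<psi>) \<preceq> reindex X (Comp SET v u) \<psi>"
    "reindex X (Comp SET v u) \<psi> \<preceq> reindex X u (reindex X v \<psi>)"
proof -
  have vu: "Comp SET v u \<in> Hom SET M K" using assms by blast
  note f = reindex_fiber[OF assms(2,3)]
  show "reindex X u (reindex X v \<psi>) \<preceq> reindex X (Comp SET v u) \<psi>"
    using reaches_comp[OF reindex_reaches[OF assms(1) f] reindex_reaches[OF assms(2,3)]]
    by (simp add: le_reindex[OF vu assms(3) reindex_fiber[OF assms(1) f]])
  show "reindex X (Comp SET v u) \<psi> \<preceq> reindex X u (reindex X v \<psi>)"
    using reindex_reaches[OF vu assms(3)]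
    by (simp add: le_reindex[OF assms(1) f reindex_fiber[OF vu assms(3)]]
        reaches_reindex[OF assms(2,3) reindex_fiber[OF vu assms(3)] assms(1)])
qed

abbreviation pull :: "'u \<Rightarrow> 'u \<Rightarrow> ('u \<Rightarrow> 'u) \<Rightarrow> 'o \<Rightarrow> 'o" where
  "pull M N f \<equiv> reindex X (smap M N f)"

lemma pull_fiber [intro]:
  "f \<in> elts M \<rightarrow> elts N \<Longrightarrow> \<psi> \<in> fiber X N \<Longrightarrow> pull M N f \<psi> \<in> fiber X M"
  by (rule reindex_fiber[OF smap_hom])

lemma pull_mono:
  "f \<in> elts M \<rightarrow> elts N \<Longrightarrow> \<phi> \<preceq> \<psi> \<Longrightarrow> \<psi> \<in> fiber X N \<Longrightarrow> pull M N f \<phi> \<preceq> pull M N f \<psi>"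
  by (rule reindex_mono[OF smap_hom])

text \<open>The chosen cleavage need not be split, so functoriality of reindexing is an equivalence
  only, given as two inequalities ready for \<open>le_trans\<close>.\<close>

lemma pull_pull:
  assumes "f \<in> elts M \<rightarrow> elts N" "g \<in> elts N \<rightarrow> elts K" "\<psi> \<in> fiber X K"
  shows "pull M N f (pull N K g \<psi>) \<preceq> pull M K (\<lambda>x. g (f x)) \<psi>"
    "pull M K (\<lambda>x. g (f x)) \<psi> \<preceq> pull M N f (pull N K g \<psi>)"
  using reindex_comp[OF smap_hom[OF assms(1)] smap_hom[OF assms(2)] assms(3)] assms(1) by simp_all

lemma iso_trans [trans]: "\<phi> \<cong> \<psi> \<Longrightarrow> \<psi> \<cong> \<chi> \<Longrightarrow> \<phi> \<cong> \<chi>"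
  using le_trans by (auto simp: fib_iso_def)

lemma iso_pobj: "\<phi> \<cong> \<psi> \<Longrightarrow> pobj X \<phi> = pobj X \<psi>"
  using le_fiber unfolding fib_iso_def by blast

end


section \<open>Fibered equivalences\<close>

text \<open>Since arrows are determined by the maps they lie over, an object map of this kind
  already carries a fibered equivalence; nothing about arrows has to be given.\<close>

definition reflecting ::
  "('o, 'a, 'u::set_universe) over_set \<Rightarrow> ('p, 'b, 'u) over_set \<Rightarrow> ('o \<Rightarrow> 'p) \<Rightarrow> bool" where
  "reflecting X Y F \<longleftrightarrow>
     (\<forall>\<phi>\<in>Obj X. F \<phi> \<in> Obj Y \<and> pobj Y (F \<phi>) = pobj X \<phi>) \<and>
     (\<forall>\<phi>\<in>Obj X. \<forall>\<psi>\<in>Obj X. \<forall>u. reaches X \<phi> u \<psi> \<longleftrightarrow> reaches Y (F \<phi>) u (F \<psi>)) \<and>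
     (\<forall>\<psi>\<in>Obj Y. \<exists>\<phi>\<in>Obj X. fib_iso Y (F \<phi>) \<psi>)"

definition lift ::
  "('o, 'a, 'u::set_universe) over_set \<Rightarrow> ('p, 'b, 'u) over_set \<Rightarrow> ('o \<Rightarrow> 'p) \<Rightarrow> 'a \<Rightarrow> 'b" where
  "lift X Y F a = (SOME b. b \<in> Hom Y (F (Dom X a)) (F (Cod X a)) \<and> parr Y b = parr X a)"

lemma reflecting_fibered_functor:
  fixes X :: "('o, 'a, 'u::set_universe) over_set" and Y :: "('p, 'b, 'u) over_set"
  assumes "posetal_fibration X" "posetal_fibration Y" and r: "reflecting X Y F"
  shows "fibered_functor X Y F (lift X Y F)"
    and "\<And>a \<phi> \<psi>. a \<in> Hom X \<phi> \<psi> \<Longrightarrow> lift X Y F a \<in> Hom Y (F \<phi>) (F \<psi>) \<and> parr Y (lift X Y F a) = parr X a"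
proof -
  interpret X: posetal X by unfold_locales fact
  interpret Y: posetal Y by unfold_locales fact
  have obj: "F \<phi> \<in> Obj Y" "pobj Y (F \<phi>) = pobj X \<phi>" if "\<phi> \<in> Obj X" for \<phi>
    using r that by (auto simp: reflecting_def)
  have iff: "reaches X \<phi> u \<psi> \<longleftrightarrow> reaches Y (F \<phi>) u (F \<psi>)" if "\<phi> \<in> Obj X" "\<psi> \<in> Obj X" for \<phi> u \<psi>
    using r that by (auto simp: reflecting_def)
  show l: "lift X Y F a \<in> Hom Y (F \<phi>) (F \<psi>) \<and> parr Y (lift X Y F a) = parr X a"
    if a: "a \<in> Hom X \<phi> \<psi>" for a \<phi> \<psi>
  proof -
    have "reaches Y (F \<phi>) (parr X a) (F \<psi>)"
      using iff X.Hom_Obj[OF a] a unfolding reaches_def by blast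
    hence "\<exists>b. b \<in> Hom Y (F (Dom X a)) (F (Cod X a)) \<and> parr Y b = parr X a"
      using a by (auto simp: reaches_def Hom_def)
    from someI_ex[OF this] show ?thesis using a unfolding lift_def by (simp add: Hom_def)
  qed
  have "is_functor X Y F (lift X Y F)" unfolding is_functor_def
  proof (intro conjI ballI allI)
    fix \<phi> assume p: "\<phi> \<in> Obj X"
    show "F \<phi> \<in> Obj Y" using obj p by blast
    show "lift X Y F (Id X \<phi>) = Id Y (F \<phi>)"
      using l[OF X.Hom_Id[OF p]] Y.Hom_Id[OF obj(1)[OF p]]
      by (auto intro!: Y.parr_inj simp: X.parr_Id Y.parr_Id p obj)
  next
    fix \<phi> \<psi> \<chi> a b assume a: "a \<in> Hom X \<phi> \<psi>" and b: "b \<in> Hom X \<psi> \<chi>"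
    show "lift X Y F (Comp X b a) = Comp Y (lift X Y F b) (lift X Y F a)"
      using l[OF X.Hom_Comp[OF a b]] l[OF a] l[OF b]
      by (intro Y.parr_inj[OF _ Y.Hom_Comp]) (auto simp: X.parr_Comp[OF a b] Y.parr_Comp)
  qed (use l in blast)
  moreover have "cartesian Y (lift X Y F a)" if c: "cartesian X a" for a
  proof -
    let ?\<phi> = "Dom X a" and ?\<psi> = "Cod X a"
    have a: "a \<in> Hom X ?\<phi> ?\<psi>" using c by (auto simp: cartesian_def Hom_def)
    note la = l[OF a] note o = X.Hom_Obj[OF a]
    have "reaches Y \<theta> w (F ?\<phi>)" if t: "\<theta> \<in> Obj Y" "w \<in> Hom SET (pobj Y \<theta>) (pobj Y (F ?\<phi>))"
      "reaches Y \<theta> (Comp SET (parr X a) w) (F ?\<psi>)" for \<theta> w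
    proof -
      \<comment> \<open>A test object of \<open>Y\<close> is isomorphic to some
        \<open>F \<zeta>\<close>, so the cartesian property can be tested in
        \<open>X\<close>.\<close>
      obtain \<zeta> where z: "\<zeta> \<in> Obj X" "fib_iso Y (F \<zeta>) \<theta>" using r t(1) by (auto simp: reflecting_def)
      have "reaches Y (F \<zeta>) (Comp SET (parr X a) w) (F ?\<psi>)"
        using Y.le_reaches t(3) z(2) by (auto simp: fib_iso_def)
      hence "reaches X \<zeta> (Comp SET (parr X a) w) ?\<psi>" using iff z o by blast
      moreover have "w \<in> Hom SET (pobj X \<zeta>) (pobj X ?\<phi>)"
        using t(2) Y.iso_pobj[OF z(2)] obj(2)[OF z(1)] obj(2)[OF conjunct1[OF o]] by simp
      ultimately have "reaches X \<zeta> w ?\<phi>" using c z(1) by (auto simp: X.cartesian_iff)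
      hence "reaches Y (F \<zeta>) w (F ?\<phi>)" using iff z o by blast
      thus ?thesis using Y.le_reaches z(2) by (auto simp: fib_iso_def)
    qed
    thus ?thesis unfolding Y.cartesian_iff using la by (auto simp: Hom_def)
  qed
  moreover have "parr Y (lift X Y F a) = parr X a" if "a \<in> Arr X" for a
    using l[of a "Dom X a" "Cod X a"] that by (simp add: Hom_def)
  ultimately show "fibered_functor X Y F (lift X Y F)" using obj unfolding fibered_functor_def by blast
qed

text \<open>The inverse laws and naturality are equations between parallel arrows over the same map,
  so faithfulness proves them once the objects are known to be isomorphic in the fibers.\<close>

lemma vertical_nat_isoI:
  assumes "posetal_fibration X" and F: "\<And>x. x \<in> Obj X \<Longrightarrow> fib_iso X (F x) x"
    and A: "\<And>a \<phi> \<psi>. a \<in> Hom X \<phi> \<psi> \<Longrightarrow> A a \<in> Hom X (F \<phi>) (F \<psi>) \<and> parr X (A a) = parr X a"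
  shows "\<exists>\<eta>. vertical_nat_iso X X F A id id \<eta>"
proof -
  interpret posetal X by unfold_locales fact
  define \<eta> where "\<eta> x = (SOME b. b \<in> Hom X (F x) x \<and> parr X b = Id SET (pobj X x))" for x
  have pF: "pobj X (F x) = pobj X x" if "x \<in> Obj X" for x
    using iso_pobj[OF F[OF that]] .
  have n: "\<eta> x \<in> Hom X (F x) x" "parr X (\<eta> x) = Id SET (pobj X x)" if "x \<in> Obj X" for x
  proof -
    have "\<exists>b. b \<in> Hom X (F x) x \<and> parr X b = Id SET (pobj X x)"
      using F[OF that] pF[OF that] by (auto simp: fib_iso_def fib_le_def)
    from someI_ex[OF this] show "\<eta> x \<in> Hom X (F x) x" "parr X (\<eta> x) = Id SET (pobj X x)"
      by (auto simp: \<eta>_def)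
  qed
  have "is_iso X (\<eta> x)" if x: "x \<in> Obj X" for x
  proof -
    obtain b where b: "b \<in> Hom X x (F x)" "parr X b = Id SET (pobj X x)"
      using F[OF x] by (auto simp: fib_iso_def fib_le_def)
    note nx = n[OF x] note Fx = Hom_Obj[OF nx(1), THEN conjunct1]
    have "Comp X b (\<eta> x) = Id X (F x)"
      by (rule parr_inj[OF Hom_Comp[OF nx(1) b(1)] Hom_Id[OF Fx]])
        (simp add: parr_Comp[OF nx(1) b(1)] b nx parr_Id[OF Fx] pF[OF x] comp_id[OF Id_hom])
    moreover have "Comp X (\<eta> x) b = Id X x"
      by (rule parr_inj[OF Hom_Comp[OF b(1) nx(1)] Hom_Id[OF x]])
        (simp add: parr_Comp[OF b(1) nx(1)] b nx parr_Id[OF x] pF[OF x] comp_id[OF Id_hom])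
    ultimately show ?thesis unfolding is_iso_def using b nx by (auto simp: Hom_def)
  qed
  moreover have "Comp X (\<eta> y) (A f) = Comp X f (\<eta> x)" if f: "f \<in> Hom X x y" for x y f
  proof -
    note o = Hom_Obj[OF f] note a = A[OF f]
    note nx = n[OF o[THEN conjunct1]] note ny = n[OF o[THEN conjunct2]]
    show ?thesis
      by (rule parr_inj[OF Hom_Comp[OF conjunct1[OF a] ny(1)] Hom_Comp[OF nx(1) f]])
        (simp add: parr_Comp[OF conjunct1[OF a] ny(1)] parr_Comp[OF nx(1) f] a nx ny
          comp_id[OF parr_Hom[OF f]])
  qed
  ultimately have "vertical_nat_iso X X F A id id \<eta>"
    unfolding vertical_nat_iso_def using n by simp
  thus ?thesis by blast
qed

lemma fibered_equivalent_sym: "fibered_equivalent X Y \<Longrightarrow> fibered_equivalent Y X"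
  unfolding fibered_equivalent_def by blast

text \<open>The inverse \<open>G\<close> picks preimages up to isomorphism. It is again
  \<open>reflecting\<close>, because \<open>reaches\<close> is invariant under isomorphism on both
  sides, so the same lemma makes both object maps fibered functors.\<close>

lemma fibered_equivalentI:
  fixes X :: "('o, 'a, 'u::set_universe) over_set" and Y :: "('p, 'b, 'u) over_set"
  assumes X: "posetal_fibration X" and Y: "posetal_fibration Y" and r: "reflecting X Y F"
  shows "fibered_equivalent X Y"
proof -
  interpret X: posetal X by unfold_locales fact
  interpret Y: posetal Y by unfold_locales fact
  have obj: "F \<phi> \<in> Obj Y" "pobj Y (F \<phi>) = pobj X \<phi>" if "\<phi> \<in> Obj X" for \<phi>
    using r that by (auto simp: reflecting_def)
  have iff: "reaches X \<phi> u \<psi> \<longleftrightarrow> reaches Y (F \<phi>) u (F \<psi>)" if "\<phi> \<in> Obj X" "\<psi> \<in> Obj X" for \<phi> u \<psi>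
    using r that by (auto simp: reflecting_def)
  define G where "G \<psi> = (SOME \<phi>. \<phi> \<in> Obj X \<and> fib_iso Y (F \<phi>) \<psi>)" for \<psi>
  have G: "G \<psi> \<in> Obj X" "fib_iso Y (F (G \<psi>)) \<psi>" if "\<psi> \<in> Obj Y" for \<psi>
  proof -
    have "\<exists>\<phi>. \<phi> \<in> Obj X \<and> fib_iso Y (F \<phi>) \<psi>" using r that by (auto simp: reflecting_def)
    from someI_ex[OF this] show "G \<psi> \<in> Obj X" "fib_iso Y (F (G \<psi>)) \<psi>" by (auto simp: G_def)
  qed
  have isoF: "fib_iso X \<phi> \<psi>" if "\<phi> \<in> Obj X" "\<psi> \<in> Obj X" "fib_iso Y (F \<phi>) (F \<psi>)" for \<phi> \<psi>
    using that by (simp add: fib_iso_def fib_le_reaches iff obj)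
  have GF: "fib_iso X (G (F \<phi>)) \<phi>" if "\<phi> \<in> Obj X" for \<phi>
    using isoF G obj that by blast
  have pG: "pobj X (G \<psi>) = pobj Y \<psi>" if "\<psi> \<in> Obj Y" for \<psi>
    using Y.iso_pobj[OF G(2)[OF that]] obj(2)[OF G(1)[OF that]] by simp
  have rG: "reaches Y \<phi> u \<psi> \<longleftrightarrow> reaches X (G \<phi>) u (G \<psi>)" if "\<phi> \<in> Obj Y" "\<psi> \<in> Obj Y" for \<phi> u \<psi>
    using G(2)[OF that(1)] G(2)[OF that(2)] Y.le_reaches Y.reaches_le
    unfolding fib_iso_def iff[OF G(1)[OF that(1)] G(1)[OF that(2)]] by metis
  have r': "reflecting Y X G" unfolding reflecting_def using G(1) pG rG GF obj by blast
  note lF = reflecting_fibered_functor[OF X Y r] and lG = reflecting_fibered_functor[OF Y X r']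
  have "\<exists>\<eta>. vertical_nat_iso X X (G \<circ> F) (lift Y X G \<circ> lift X Y F) id id \<eta>"
    using GF lF(2) lG(2) by (intro vertical_nat_isoI[OF X]) (simp, metis comp_apply)
  moreover have "\<exists>\<eta>. vertical_nat_iso Y Y (F \<circ> G) (lift X Y F \<circ> lift Y X G) id id \<eta>"
    using G lF(2) lG(2) by (intro vertical_nat_isoI[OF Y]) (simp, metis comp_apply)
  ultimately show ?thesis unfolding fibered_equivalent_def using lF(1) lG(1) by blast
qed

lemma vertical_nat_iso_fib_iso:
  assumes "posetal_fibration X" "vertical_nat_iso X X F A id id \<eta>" "x \<in> Obj X"
    "pobj X (F x) = pobj X x"
  shows "fib_iso X (F x) x"
proof -
  interpret posetal X by unfold_locales fact
  have n: "\<eta> x \<in> Hom X (F x) x" "is_iso X (\<eta> x)" "parr X (\<eta> x) = Id SET (pobj X x)"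
    using assms unfolding vertical_nat_iso_def by auto
  then obtain g where g: "g \<in> Hom X x (F x)" "Comp X (\<eta> x) g = Id X x"
    by (auto simp: is_iso_def Hom_def)
  \<comment> \<open>The inverse arrow is vertical too: composed with an arrow over the identity it
    gives an identity.\<close>
  have "Comp SET (Id SET (pobj X x)) (parr X g) = Id SET (pobj X x)"
    using parr_Comp[OF g(1) n(1)] by (simp add: g n parr_Id assms)
  hence "parr X g = Id SET (pobj X x)" using parr_Hom[OF g(1)] assms(4) by simp
  thus ?thesis using n g assms(4) unfolding fib_iso_def fib_le_def by auto
qed

text \<open>Of an equivalence only the object map is kept. It reflects \<open>reaches\<close>
  because the quasi-inverse carries an arrow back and \<open>G (F x)\<close> is isomorphic to
  \<open>x\<close>.\<close>

lemma fibered_equivalentE: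
  fixes X :: "('o, 'a, 'u::set_universe) over_set" and Y :: "('p, 'b, 'u) over_set"
  assumes X: "posetal_fibration X" and Y: "posetal_fibration Y" and "fibered_equivalent X Y"
  obtains F where "reflecting X Y F"
proof -
  interpret X: posetal X by unfold_locales fact
  interpret Y: posetal Y by unfold_locales fact
  obtain F A G B \<eta> \<epsilon> where F: "fibered_functor X Y F A" and G: "fibered_functor Y X G B"
    and n: "vertical_nat_iso X X (G \<circ> F) (B \<circ> A) id id \<eta>"
    and e: "vertical_nat_iso Y Y (F \<circ> G) (A \<circ> B) id id \<epsilon>"
    using assms(3) unfolding fibered_equivalent_def by blast
  have oF: "F x \<in> Obj Y" "pobj Y (F x) = pobj X x" if "x \<in> Obj X" for x
    using F that by (auto simp: fibered_functor_def is_functor_def)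
  have oG: "G x \<in> Obj X" "pobj X (G x) = pobj Y x" if "x \<in> Obj Y" for x
    using G that by (auto simp: fibered_functor_def is_functor_def)
  have GF: "fib_iso X (G (F x)) x" if "x \<in> Obj X" for x
    using vertical_nat_iso_fib_iso[OF X n that] oF oG that by simp
  have FG: "fib_iso Y (F (G x)) x" if "x \<in> Obj Y" for x
    using vertical_nat_iso_fib_iso[OF Y e that] oF oG that by simp
  have rF: "reaches Y (F x) u (F y)" if "reaches X x u y" for x u y
    using F that unfolding reaches_def fibered_functor_def is_functor_def Hom_def by fastforce
  have rG: "reaches X (G x) u (G y)" if "reaches Y x u y" for x u y
    using G that unfolding reaches_def fibered_functor_def is_functor_def Hom_def by fastforce
  have "reaches X x u y" if "x \<in> Obj X" "y \<in> Obj X" "reaches Y (F x) u (F y)" for x u y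
    using rG[OF that(3)] GF[OF that(1)] GF[OF that(2)] X.le_reaches X.reaches_le
    unfolding fib_iso_def by blast
  hence "reflecting X Y F" unfolding reflecting_def using oF oG FG rF by blast
  thus thesis by (rule that)
qed

section \<open>Full subfibrations\<close>

context posetal
begin

context
  fixes P :: "'o set"
  assumes P_reindex: "\<And>M N u \<phi>. u \<in> Hom SET M N \<Longrightarrow> \<phi> \<in> fiber X N \<Longrightarrow> \<phi> \<in> P \<Longrightarrow> reindex X u \<phi> \<in> P"
begin

lemma sub_sel: "Obj (full_sub X P) = Obj X \<inter> P" "pobj (full_sub X P) = pobj X"
  "parr (full_sub X P) = parr X" "Id (full_sub X P) = Id X" "Comp (full_sub X P) = Comp X"
  "Dom (full_sub X P) = Dom X" "Cod (full_sub X P) = Cod X"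
  by (simp_all add: full_sub_def)

lemma sub_Hom: "a \<in> Hom (full_sub X P) \<phi> \<psi> \<longleftrightarrow> a \<in> Hom X \<phi> \<psi> \<and> \<phi> \<in> P \<and> \<psi> \<in> P"
  by (auto simp: Hom_def full_sub_def)

lemma sub_reaches: "reaches (full_sub X P) \<phi> u \<psi> \<longleftrightarrow> reaches X \<phi> u \<psi> \<and> \<phi> \<in> P \<and> \<psi> \<in> P"
  by (auto simp: reaches_def sub_Hom sub_sel)

lemma sub_cartesian:
  assumes a: "cartesian X a" "Dom X a \<in> P" "Cod X a \<in> P" shows "cartesian (full_sub X P) a"
  unfolding cartesian_def
proof (intro conjI allI ballI impI)
  show "a \<in> Arr (full_sub X P)" using a by (simp add: full_sub_def cartesian_def)
  fix \<theta> b w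
  assume b: "b \<in> Hom (full_sub X P) \<theta> (Cod (full_sub X P) a)"
    and w: "w \<in> Hom SET (pobj (full_sub X P) \<theta>) (pobj (full_sub X P) (Dom (full_sub X P) a))"
    and bw: "parr (full_sub X P) b = Comp SET (parr (full_sub X P) a) w"
  have "\<exists>!c. c \<in> Hom X \<theta> (Dom X a) \<and> parr X c = w \<and> Comp X a c = b"
    using a(1) b w bw unfolding cartesian_def sub_sel sub_Hom by blast
  thus "\<exists>!c. c \<in> Hom (full_sub X P) \<theta> (Dom (full_sub X P) a) \<and> parr (full_sub X P) c = w \<and>
      Comp (full_sub X P) a c = b"
    using a b unfolding sub_sel sub_Hom by blast
qed

lemma sub_posetal: "posetal_fibration (full_sub X P)"
  unfolding posetal_fibration_def fibration_def
proof (intro conjI ballI allI)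
  show "category (full_sub X P)" unfolding category_def sub_Hom sub_sel
  proof (intro conjI allI ballI)
    fix w x y z f g h assume "f \<in> Hom (full_sub X P) w x" "g \<in> Hom (full_sub X P) x y"
      "h \<in> Hom (full_sub X P) y z"
    thus "Comp X h (Comp X g f) = Comp X (Comp X h g) f"
      using category_X unfolding category_def sub_Hom by blast
  next
    fix x y f assume f: "f \<in> Hom (full_sub X P) x y"
    show "Comp X f (Id X x) = f" "Comp X (Id X y) f = f"
      using f category_X unfolding category_def sub_Hom by blast+
  next
    fix f assume "f \<in> Arr (full_sub X P)"
    hence f: "f \<in> Hom X (Dom X f) (Cod X f)" "Dom X f \<in> P" "Cod X f \<in> P"
      by (auto simp: full_sub_def Hom_def)
    thus "Dom X f \<in> Obj X \<inter> P" "Cod X f \<in> Obj X \<inter> P" using Hom_Obj by blast+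
  qed (use Hom_Id Hom_Comp sub_Hom in blast)+
  show "is_functor (full_sub X P) SET (pobj (full_sub X P)) (parr (full_sub X P))"
    unfolding is_functor_def sub_Hom sub_sel
    by (auto simp: sub_Hom parr_Hom parr_Id parr_Comp)
  show "faithful (full_sub X P) (parr (full_sub X P))"
    using parr_inj unfolding faithful_def sub_sel inj_on_def by (auto simp: sub_Hom)
  fix \<psi> M u assume "\<psi> \<in> Obj (full_sub X P)" "u \<in> Hom SET M (pobj (full_sub X P) \<psi>)"
  hence p: "\<psi> \<in> fiber X (pobj X \<psi>)" "\<psi> \<in> P" and u: "u \<in> Hom SET M (pobj X \<psi>)"
    by (auto simp: sub_sel fiber_iff)
  obtain a where "cartesian X a" "Cod X a = \<psi>" "parr X a = u" "Dom X a = reindex X u \<psi>"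
    using u p(1) by (rule reindex_cartesian)
  thus "\<exists>a. cartesian (full_sub X P) a \<and> Cod (full_sub X P) a = \<psi> \<and> parr (full_sub X P) a = u"
    using sub_cartesian[of a] P_reindex[OF u p] p unfolding sub_sel by metis
qed

lemma sub_fiber: "\<phi> \<in> fiber (full_sub X P) M \<longleftrightarrow> \<phi> \<in> fiber X M \<and> \<phi> \<in> P"
  by (auto simp: fiber_iff sub_sel)

lemma sub_le: "fib_le (full_sub X P) \<phi> \<psi> \<longleftrightarrow> \<phi> \<preceq> \<psi> \<and> \<phi> \<in> P \<and> \<psi> \<in> P"
  by (simp add: fib_le_reaches sub_reaches sub_sel)

text \<open>\<open>reindex\<close> on the subfibration is a separate Hilbert choice and may differ
  from the one on \<open>X\<close>; the two are compared by the universal property that both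
  satisfy.\<close>

lemma sub_reindex_iso:
  assumes u: "u \<in> Hom SET M N" and p: "\<psi> \<in> fiber X N" "\<psi> \<in> P"
  shows "reindex (full_sub X P) u \<psi> \<in> P" "reindex (full_sub X P) u \<psi> \<cong> reindex X u \<psi>"
proof -
  interpret S: posetal "full_sub X P" by unfold_locales (rule sub_posetal)
  have p': "\<psi> \<in> fiber (full_sub X P) N" using p sub_fiber by blast
  have f: "reindex (full_sub X P) u \<psi> \<in> fiber (full_sub X P) M" by (rule S.reindex_fiber[OF u p'])
  thus "reindex (full_sub X P) u \<psi> \<in> P" using sub_fiber by blast
  have "reaches X (reindex (full_sub X P) u \<psi>) u \<psi>"
    using S.reindex_reaches[OF u p'] sub_reaches by blast
  hence 1: "reindex (full_sub X P) u \<psi> \<preceq> reindex X u \<psi>" using le_reindex[OF u p(1)] f sub_fiber by blast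
  have "reindex X u \<psi> \<in> fiber (full_sub X P) M" using reindex_fiber[OF u p(1)] P_reindex[OF u p] sub_fiber by blast
  moreover have "reaches (full_sub X P) (reindex X u \<psi>) u \<psi>"
    using reindex_reaches[OF u p(1)] P_reindex[OF u p] p sub_reaches by blast
  ultimately have "reindex X u \<psi> \<preceq> reindex (full_sub X P) u \<psi>"
    using S.le_reindex[OF u p'] sub_le by blast
  with 1 show "reindex (full_sub X P) u \<psi> \<cong> reindex X u \<psi>" by (simp add: fib_iso_def)
qed

text \<open>This frees modesty from the order and reindexing of the subfibration, each replaced by
  an equivalent one of \<open>X\<close>.\<close>

lemma sub_modest:
  "modest (full_sub X P) \<mu> \<longleftrightarrow> \<mu> \<in> Obj X \<and> \<mu> \<in> P \<and>
     (\<forall>J K. \<forall>e\<in>Hom SET K J. \<forall>f\<in>Hom SET K (pobj X \<mu>). \<forall>\<phi>\<in>fiber X J \<inter> P.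
        surjection e \<longrightarrow> reindex X e \<phi> \<preceq> reindex X f \<mu> \<longrightarrow>
        (\<exists>h\<in>Hom SET J (pobj X \<mu>). Comp SET h e = f \<and> \<phi> \<preceq> reindex X h \<mu>))"
proof (cases "\<mu> \<in> Obj X \<and> \<mu> \<in> P")
  case True
  hence m: "\<mu> \<in> fiber X (pobj X \<mu>)" "\<mu> \<in> P" by (auto simp: fiber_iff)
  have 1: "fib_le (full_sub X P) (reindex (full_sub X P) e \<phi>) (reindex (full_sub X P) f \<mu>) \<longleftrightarrow>
      reindex X e \<phi> \<preceq> reindex X f \<mu>"
    if "e \<in> Hom SET K J" "f \<in> Hom SET K (pobj X \<mu>)" "\<phi> \<in> fiber X J" "\<phi> \<in> P" for J K e f \<phi>
    using sub_reindex_iso[OF that(1,3,4)] sub_reindex_iso[OF that(2) m] le_trans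
    unfolding sub_le fib_iso_def by blast
  have 2: "fib_le (full_sub X P) \<phi> (reindex (full_sub X P) h \<mu>) \<longleftrightarrow> \<phi> \<preceq> reindex X h \<mu>"
    if "\<phi> \<in> P" "h \<in> Hom SET J (pobj X \<mu>)" for J h \<phi>
    using sub_reindex_iso[OF that(2) m] that(1) le_trans unfolding sub_le fib_iso_def by blast
  show ?thesis unfolding modest_def sub_sel sub_fiber
    using True 1 2 by (simp add: Ball_def sub_fiber conj_commute cong: conj_cong)
qed (auto simp: modest_def sub_sel)

end

section \<open>The subfibration generated by a family of predicates\<close>

context
  fixes I :: 'u and A :: "'u \<Rightarrow> 'u" and \<pi> :: "'u \<Rightarrow> 'o"
  assumes \<pi>: "\<And>i. i \<in> elts I \<Longrightarrow> \<pi> i \<in> fiber X (A i)"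
begin

definition generated :: "'o set" where
  "generated = {\<phi> \<in> Obj X. \<exists>i\<in>elts I. \<exists>f\<in>Hom SET (pobj X \<phi>) (A i). \<phi> \<cong> reindex X f (\<pi> i)}"

lemma generated_sub_eq: "generated_sub X I A \<pi> = full_sub X generated"
  by (simp add: generated_sub_def generated_def)

lemma generated_iff:
  "\<phi> \<in> fiber X M \<Longrightarrow> \<phi> \<in> generated \<longleftrightarrow> (\<exists>i\<in>elts I. \<exists>f\<in>elts M \<rightarrow> elts (A i). \<phi> \<cong> pull M (A i) f (\<pi> i))"
  unfolding generated_def fiber_iff using smap_hom by (auto elim!: hom_smapE)

lemma generated_reindex:
  assumes u: "u \<in> Hom SET M N" and p: "\<phi> \<in> fiber X N" "\<phi> \<in> generated"
  shows "reindex X u \<phi> \<in> generated"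
proof -
  obtain i f where i: "i \<in> elts I" "f \<in> elts N \<rightarrow> elts (A i)" "\<phi> \<cong> pull N (A i) f (\<pi> i)"
    using p generated_iff by blast
  obtain g where g: "u = smap M N g" "g \<in> elts M \<rightarrow> elts N" using u by (rule hom_smapE)
  have "pull M N g \<phi> \<cong> pull M N g (pull N (A i) f (\<pi> i))"
    using i(3) p(1) pull_mono[OF g(2)] pull_fiber[OF i(2) \<pi>[OF i(1)]] unfolding fib_iso_def by blast
  also have "\<dots> \<cong> pull M (A i) (\<lambda>x. f (g x)) (\<pi> i)"
    using pull_pull[OF g(2) i(2) \<pi>[OF i(1)]] by (simp add: fib_iso_def)
  finally have "pull M N g \<phi> \<cong> pull M (A i) (\<lambda>x. f (g x)) (\<pi> i)" .
  moreover have "(\<lambda>x. f (g x)) \<in> elts M \<rightarrow> elts (A i)" using g(2) i(2) by auto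
  ultimately show ?thesis unfolding g(1) using generated_iff[OF pull_fiber[OF g(2) p(1)]] i(1) by blast
qed

lemma generated_modest:
  "modest (generated_sub X I A \<pi>) \<mu> \<longleftrightarrow> \<mu> \<in> Obj X \<and> \<mu> \<in> generated \<and>
     (\<forall>J K. \<forall>e\<in>Hom SET K J. \<forall>f\<in>Hom SET K (pobj X \<mu>). \<forall>\<phi>\<in>fiber X J \<inter> generated.
        surjection e \<longrightarrow> reindex X e \<phi> \<preceq> reindex X f \<mu> \<longrightarrow>
        (\<exists>h\<in>Hom SET J (pobj X \<mu>). Comp SET h e = f \<and> \<phi> \<preceq> reindex X h \<mu>))"
  unfolding generated_sub_eq by (rule sub_modest) (rule generated_reindex)

lemma generated_fiber: "\<phi> \<in> fiber (generated_sub X I A \<pi>) M \<longleftrightarrow> \<phi> \<in> fiber X M \<and> \<phi> \<in> generated"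
  unfolding generated_sub_eq by (rule sub_fiber) (rule generated_reindex)

lemma generated_Obj: "Obj (generated_sub X I A \<pi>) = generated"
  by (auto simp: generated_sub_eq full_sub_def generated_def)

end

end

section \<open>Realizability over an inclusion of pcas\<close>

locale pca_incl =
  fixes B B' :: "'b set" and app :: "'b \<Rightarrow> 'b \<Rightarrow> 'b option" and k s :: 'b
  assumes sub: "B' \<subseteq> B" and closed: "closed_app B app" and closed': "closed_app B' app"
    and k': "k \<in> B'" and s': "s \<in> B'" and combinators: "combinators B app k s"
begin

text \<open>The values k x, s x and s x y always exist on the carrier, so they get total names and
  realizers become ordinary terms instead of chains of \<open>papp\<close>.\<close>

definition "kx x = the (app k x)"
definition "sx x = the (app s x)"
definition "sxy x y = the (app (sx x) y)"

lemma in_B: "x \<in> B' \<Longrightarrow> x \<in> B" using sub by blast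

lemma app_B: "app x y = Some z \<Longrightarrow> x \<in> B \<Longrightarrow> y \<in> B \<Longrightarrow> z \<in> B"
  using closed unfolding closed_app_def by blast

lemma app_B': "app x y = Some z \<Longrightarrow> x \<in> B' \<Longrightarrow> y \<in> B' \<Longrightarrow> z \<in> B'"
  using closed' unfolding closed_app_def by blast

lemma k_app: "x \<in> B \<Longrightarrow> app k x = Some (kx x)"
  and kx_app: "x \<in> B \<Longrightarrow> y \<in> B \<Longrightarrow> app (kx x) y = Some x"
proof -
  have *: "\<And>x y. x \<in> B \<Longrightarrow> y \<in> B \<Longrightarrow> papp app (papp app (Some k) (Some x)) (Some y) = Some x"
    using combinators by (auto simp: combinators_def)
  show 1: "app k x = Some (kx x)" if "x \<in> B" for x
    using *[OF that that] by (auto simp: papp_def kx_def split: bind_splits)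
  show "app (kx x) y = Some x" if "x \<in> B" "y \<in> B"
    using *[OF that] 1[OF that(1)] by (auto simp: papp_def)
qed

lemma s_app: "x \<in> B \<Longrightarrow> app s x = Some (sx x)"
  and sx_app: "x \<in> B \<Longrightarrow> y \<in> B \<Longrightarrow> app (sx x) y = Some (sxy x y)"
proof -
  have *: "\<And>x y. x \<in> B \<Longrightarrow> y \<in> B \<Longrightarrow> papp app (papp app (Some s) (Some x)) (Some y) \<noteq> None"
    using combinators by (auto simp: combinators_def)
  show 1: "app s x = Some (sx x)" if "x \<in> B" for x
    using *[OF that that] by (auto simp: papp_def sx_def split: bind_splits)
  show "app (sx x) y = Some (sxy x y)" if "x \<in> B" "y \<in> B"
    using *[OF that] 1[OF that(1)] by (auto simp: papp_def sxy_def)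
qed

text \<open>A weak pca gives only this direction: definedness of s x y z is inferred from that of
  xz(yz), never conversely.\<close>

lemma sxy_app:
  assumes "x \<in> B" "y \<in> B" "z \<in> B" "app x z = Some a" "app y z = Some b" "app a b = Some r"
  shows "app (sxy x y) z = Some r"
proof -
  have "papp app (papp app (Some x) (Some z)) (papp app (Some y) (Some z)) = Some r"
    using assms by (simp add: papp_def)
  hence "papp app (papp app (papp app (Some s) (Some x)) (Some y)) (Some z) = Some r"
    using combinators assms by (auto simp: combinators_def)
  thus ?thesis using assms by (simp add: papp_def s_app sx_app)
qed

lemma kx_B [simp, intro]: "x \<in> B \<Longrightarrow> kx x \<in> B" and kx_B' [simp, intro]: "x \<in> B' \<Longrightarrow> kx x \<in> B'"
  using app_B[OF k_app] app_B'[OF k_app] k' in_B by auto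

lemma sx_B [simp, intro]: "x \<in> B \<Longrightarrow> sx x \<in> B" and sx_B' [simp, intro]: "x \<in> B' \<Longrightarrow> sx x \<in> B'"
  using app_B[OF s_app] app_B'[OF s_app] s' in_B by auto

lemma sxy_B [simp, intro]: "x \<in> B \<Longrightarrow> y \<in> B \<Longrightarrow> sxy x y \<in> B"
  and sxy_B' [simp, intro]: "x \<in> B' \<Longrightarrow> y \<in> B' \<Longrightarrow> sxy x y \<in> B'"
  using app_B[OF sx_app] app_B'[OF sx_app] in_B by auto

lemma ks_B [simp, intro]: "k \<in> B" "s \<in> B" using k' s' in_B by auto

section \<open>Combinators for identity, composition, pairing and currying\<close>

definition "ii = sxy k k"

lemma ii_B' [simp, intro]: "ii \<in> B'" and ii_B [simp, intro]: "ii \<in> B"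
  using k' in_B by (auto simp: ii_def)

lemma ii_app [simp]: "x \<in> B \<Longrightarrow> app ii x = Some x"
  unfolding ii_def by (rule sxy_app[OF _ _ _ k_app k_app kx_app]) auto

text \<open>The composite x -> f (e x).\<close>

definition "seq f e = sxy (kx f) e"

lemma seq_B [simp, intro]: "e \<in> B \<Longrightarrow> f \<in> B \<Longrightarrow> seq f e \<in> B"
  and seq_B' [simp, intro]: "e \<in> B' \<Longrightarrow> f \<in> B' \<Longrightarrow> seq f e \<in> B'"
  by (auto simp: seq_def)

lemma seq_app: "app e x = Some y \<Longrightarrow> app f y = Some z \<Longrightarrow> e \<in> B \<Longrightarrow> f \<in> B \<Longrightarrow> x \<in> B \<Longrightarrow> app (seq f e) x = Some z"
  unfolding seq_def by (rule sxy_app[OF _ _ _ kx_app]) auto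

text \<open>\<open>pr x y\<close> is the Church pair z -> z x y. Bracket abstraction gives
  \<open>pr1 x\<close> as y -> \<open>pr x y\<close> and \<open>pc\<close> as x ->
  \<open>pr1 x\<close>, with every partial application defined.\<close>

definition "pr1 x = sxy (kx (sx (sxy ii (kx x)))) k"
definition "pr x y = sxy (sxy ii (kx x)) (kx y)"
definition "pc = sxy (seq s (seq k (seq s (seq (sx ii) k)))) (kx k)"

lemma pr_B [simp, intro]: "x \<in> B \<Longrightarrow> y \<in> B \<Longrightarrow> pr x y \<in> B"
  and pr1_B [simp, intro]: "x \<in> B \<Longrightarrow> pr1 x \<in> B"
  by (auto simp: pr_def pr1_def)

lemma pr_B' [simp, intro]: "x \<in> B' \<Longrightarrow> y \<in> B' \<Longrightarrow> pr x y \<in> B'"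
  by (auto simp: pr_def)

lemma pc_B' [simp, intro]: "pc \<in> B'" and pc_B [simp, intro]: "pc \<in> B"
  using k' s' in_B by (auto simp: pc_def)

lemma pr1_app: "x \<in> B \<Longrightarrow> y \<in> B \<Longrightarrow> app (pr1 x) y = Some (pr x y)"
  unfolding pr1_def pr_def by (rule sxy_app[OF _ _ _ kx_app k_app sx_app]) auto

lemma pc_app:
  assumes "x \<in> B" shows "app pc x = Some (pr1 x)"
proof -
  have "app (seq (sx ii) k) x = Some (sxy ii (kx x))"
    using assms by (intro seq_app[OF k_app sx_app]) auto
  hence "app (seq s (seq (sx ii) k)) x = Some (sx (sxy ii (kx x)))"
    by (rule seq_app[OF _ s_app]) (use assms in auto)
  hence "app (seq k (seq s (seq (sx ii) k))) x = Some (kx (sx (sxy ii (kx x))))"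
    by (rule seq_app[OF _ k_app]) (use assms in auto)
  hence "app (seq s (seq k (seq s (seq (sx ii) k)))) x = Some (sx (kx (sx (sxy ii (kx x)))))"
    by (rule seq_app[OF _ s_app]) (use assms in auto)
  thus ?thesis unfolding pc_def pr1_def
    using assms by (intro sxy_app[OF _ _ _ _ kx_app sx_app]) auto
qed

lemma pr_app: "app z x = Some w \<Longrightarrow> app w y = Some r \<Longrightarrow> x \<in> B \<Longrightarrow> y \<in> B \<Longrightarrow> z \<in> B \<Longrightarrow> app (pr x y) z = Some r"
  unfolding pr_def by (rule sxy_app[OF _ _ _ sxy_app[OF _ _ _ ii_app kx_app] kx_app]) auto

text \<open>A Church pair applied to k returns its first component, and applied to k i, for i the
  identity, its second.\<close>

definition "p1 = sxy ii (kx k)"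
definition "p2 = sxy ii (kx (kx ii))"

lemma p_B' [simp, intro]: "p1 \<in> B'" "p2 \<in> B'" and p_B [simp, intro]: "p1 \<in> B" "p2 \<in> B"
  using k' s' in_B by (auto simp: p1_def p2_def)

lemma p1_app: "x \<in> B \<Longrightarrow> y \<in> B \<Longrightarrow> app p1 (pr x y) = Some x"
  unfolding p1_def by (rule sxy_app[OF _ _ _ ii_app kx_app pr_app[OF k_app kx_app]]) auto

lemma p2_app: "x \<in> B \<Longrightarrow> y \<in> B \<Longrightarrow> app p2 (pr x y) = Some y"
  unfolding p2_def by (rule sxy_app[OF _ _ _ ii_app kx_app pr_app[OF kx_app ii_app]]) auto

text \<open>The term x -> (y -> e (pr x y)). Its value at x exists even when e (pr x y) is undefined
  for every y, as implication and universal quantification require.\<close>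

definition "curried e = seq (sx (kx e)) pc"

lemma curried_B' [simp, intro]: "e \<in> B' \<Longrightarrow> curried e \<in> B'"
  by (auto simp: curried_def)

lemma curried_app:
  assumes "e \<in> B" "x \<in> B"
  obtains d where "d \<in> B" "app (curried e) x = Some d"
    "\<And>y z. y \<in> B \<Longrightarrow> app e (pr x y) = Some z \<Longrightarrow> app d y = Some z"
proof
  show "sxy (kx e) (pr1 x) \<in> B" using assms by auto
  show "app (curried e) x = Some (sxy (kx e) (pr1 x))" unfolding curried_def
    using assms by (intro seq_app[OF pc_app sx_app]) auto
  show "app (sxy (kx e) (pr1 x)) y = Some z" if "y \<in> B" "app e (pr x y) = Some z" for y z
    using assms that by (intro sxy_app[OF _ _ _ kx_app pr1_app that(2)]) auto
qed

definition "pairing e f = sxy (seq pc e) f"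

lemma pairing_B' [simp, intro]: "e \<in> B' \<Longrightarrow> f \<in> B' \<Longrightarrow> pairing e f \<in> B'"
  by (auto simp: pairing_def)

lemma pairing_app:
  assumes "e \<in> B" "f \<in> B" "x \<in> B" "app e x = Some a" "app f x = Some b"
  shows "app (pairing e f) x = Some (pr a b)"
proof -
  have "a \<in> B" "b \<in> B" using assms app_B by blast+
  thus ?thesis unfolding pairing_def using assms
    by (intro sxy_app[OF _ _ _ seq_app[OF _ pc_app] _ pr1_app]) auto
qed


section \<open>The order on realizability predicates\<close>

definition rle :: "'m set \<Rightarrow> ('m \<Rightarrow> 'b set) \<Rightarrow> ('m \<Rightarrow> 'b set) \<Rightarrow> bool" where
  "rle M \<phi> \<psi> \<longleftrightarrow> (\<exists>e\<in>B'. \<forall>m\<in>M. \<forall>a\<in>\<phi> m. \<exists>b. app e a = Some b \<and> b \<in> \<psi> m)"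

definition pred :: "'m set \<Rightarrow> ('m \<Rightarrow> 'b set) \<Rightarrow> bool" where
  "pred M \<phi> \<longleftrightarrow> (\<forall>m\<in>M. \<phi> m \<subseteq> B)"

lemma rleI: "e \<in> B' \<Longrightarrow> (\<And>m a. m \<in> M \<Longrightarrow> a \<in> \<phi> m \<Longrightarrow> \<exists>b. app e a = Some b \<and> b \<in> \<psi> m) \<Longrightarrow> rle M \<phi> \<psi>"
  by (auto simp: rle_def)

lemma rleE:
  assumes "rle M \<phi> \<psi>"
  obtains e where "e \<in> B'" "e \<in> B" "\<And>m a. m \<in> M \<Longrightarrow> a \<in> \<phi> m \<Longrightarrow> \<exists>b. app e a = Some b \<and> b \<in> \<psi> m"
  using assms in_B by (auto simp: rle_def)

lemma predD: "pred M \<phi> \<Longrightarrow> m \<in> M \<Longrightarrow> a \<in> \<phi> m \<Longrightarrow> a \<in> B"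
  by (auto simp: pred_def)

lemma pred_comp: "pred M \<phi> \<Longrightarrow> f \<in> N \<rightarrow> M \<Longrightarrow> pred N (\<lambda>n. \<phi> (f n))"
  by (auto simp: pred_def)

lemma rle_subset: "pred M \<phi> \<Longrightarrow> (\<And>m. m \<in> M \<Longrightarrow> \<phi> m \<subseteq> \<psi> m) \<Longrightarrow> rle M \<phi> \<psi>"
  by (rule rleI[OF ii_B']) (auto simp: predD)

lemma rle_refl: "pred M \<phi> \<Longrightarrow> rle M \<phi> \<phi>"
  by (rule rle_subset) auto

lemma rle_trans [trans]:
  assumes "rle M \<phi> \<psi>" "rle M \<psi> \<chi>" "pred M \<phi>"
  shows "rle M \<phi> \<chi>"
proof -
  obtain e where e: "e \<in> B'" "e \<in> B" "\<And>m a. m \<in> M \<Longrightarrow> a \<in> \<phi> m \<Longrightarrow> \<exists>b. app e a = Some b \<and> b \<in> \<psi> m"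
    using assms(1) by (rule rleE) blast
  obtain f where f: "f \<in> B'" "f \<in> B" "\<And>m a. m \<in> M \<Longrightarrow> a \<in> \<psi> m \<Longrightarrow> \<exists>b. app f a = Some b \<and> b \<in> \<chi> m"
    using assms(2) by (rule rleE) blast
  show ?thesis
  proof (rule rleI)
    show "seq f e \<in> B'" using e f by auto
    fix m a assume m: "m \<in> M" "a \<in> \<phi> m"
    obtain b where b: "app e a = Some b" "b \<in> \<psi> m" using e(3)[OF m] by blast
    obtain c where "app f b = Some c" "c \<in> \<chi> m" using f(3)[OF m(1) b(2)] by blast
    thus "\<exists>c. app (seq f e) a = Some c \<and> c \<in> \<chi> m"
      using seq_app[OF b(1)] e f predD[OF assms(3) m] by blast
  qed
qed

lemma rle_comp: "rle M \<phi> \<psi> \<Longrightarrow> f \<in> N \<rightarrow> M \<Longrightarrow> rle N (\<lambda>n. \<phi> (f n)) (\<lambda>n. \<psi> (f n))"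
  unfolding rle_def by (meson PiE)

section \<open>Connectives and quantifiers on realizability predicates\<close>

definition rmeet :: "('m \<Rightarrow> 'b set) \<Rightarrow> ('m \<Rightarrow> 'b set) \<Rightarrow> 'm \<Rightarrow> 'b set" where
  "rmeet \<phi> \<psi> m = {pr a b | a b. a \<in> \<phi> m \<and> b \<in> \<psi> m}"

definition rimp :: "('m \<Rightarrow> 'b set) \<Rightarrow> ('m \<Rightarrow> 'b set) \<Rightarrow> 'm \<Rightarrow> 'b set" where
  "rimp \<phi> \<psi> m = {c \<in> B. \<forall>a\<in>\<phi> m. \<exists>b. app c a = Some b \<and> b \<in> \<psi> m}"

definition rex :: "'n set \<Rightarrow> ('n \<Rightarrow> 'm) \<Rightarrow> ('n \<Rightarrow> 'b set) \<Rightarrow> 'm \<Rightarrow> 'b set" where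
  "rex N u \<phi> m = (\<Union>n\<in>{n \<in> N. u n = m}. \<phi> n)"

text \<open>Without the dummy argument \<open>b\<close>, realizers of \<open>\<psi> \<le> rall N u \<phi>\<close> would have to be defined also over the
  points outside the image of \<open>u\<close>, where a realizer of \<open>u\<^sup>*\<psi> \<le> \<phi>\<close> need not be.\<close>

definition rall :: "'n set \<Rightarrow> ('n \<Rightarrow> 'm) \<Rightarrow> ('n \<Rightarrow> 'b set) \<Rightarrow> 'm \<Rightarrow> 'b set" where
  "rall N u \<phi> m = {c \<in> B. \<forall>n\<in>N. u n = m \<longrightarrow> (\<forall>b\<in>B. \<exists>d. app c b = Some d \<and> d \<in> \<phi> n)}"

lemma pred_rmeet [intro]: "pred M \<phi> \<Longrightarrow> pred M \<psi> \<Longrightarrow> pred M (rmeet \<phi> \<psi>)"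
  by (auto simp: pred_def rmeet_def intro!: pr_B)

lemma pred_rimp [intro]: "pred M (rimp \<phi> \<psi>)"
  by (auto simp: pred_def rimp_def)

lemma pred_rex [intro]: "pred N \<phi> \<Longrightarrow> pred M (rex N u \<phi>)"
  by (auto simp: pred_def rex_def)

lemma pred_rall [intro]: "pred M (rall N u \<phi>)"
  by (auto simp: pred_def rall_def)

lemma rle_top:
  assumes "pred M \<phi>" shows "rle M \<phi> (\<lambda>_. B)"
  by (rule rle_subset[OF assms]) (use assms in \<open>auto simp: pred_def\<close>)

lemma rle_rmeet:
  assumes "pred M \<theta>" "pred M \<phi>" "pred M \<psi>"
  shows "rle M \<theta> (rmeet \<phi> \<psi>) \<longleftrightarrow> rle M \<theta> \<phi> \<and> rle M \<theta> \<psi>"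
proof safe
  have "rle M (rmeet \<phi> \<psi>) \<phi>"
    by (rule rleI[OF p_B'(1)]) (use assms in \<open>auto simp: rmeet_def p1_app predD\<close>)
  thus "rle M \<theta> (rmeet \<phi> \<psi>) \<Longrightarrow> rle M \<theta> \<phi>" using rle_trans assms(1) by blast
  have "rle M (rmeet \<phi> \<psi>) \<psi>"
    by (rule rleI[OF p_B'(2)]) (use assms in \<open>auto simp: rmeet_def p2_app predD\<close>)
  thus "rle M \<theta> (rmeet \<phi> \<psi>) \<Longrightarrow> rle M \<theta> \<psi>" using rle_trans assms(1) by blast
  assume 1: "rle M \<theta> \<phi>" and 2: "rle M \<theta> \<psi>"
  obtain e where e: "e \<in> B'" "e \<in> B" "\<And>m a. m \<in> M \<Longrightarrow> a \<in> \<theta> m \<Longrightarrow> \<exists>b. app e a = Some b \<and> b \<in> \<phi> m"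
    using 1 by (rule rleE) blast
  obtain f where f: "f \<in> B'" "f \<in> B" "\<And>m a. m \<in> M \<Longrightarrow> a \<in> \<theta> m \<Longrightarrow> \<exists>b. app f a = Some b \<and> b \<in> \<psi> m"
    using 2 by (rule rleE) blast
  show "rle M \<theta> (rmeet \<phi> \<psi>)"
  proof (rule rleI)
    show "pairing e f \<in> B'" using e f by auto
    fix m a assume m: "m \<in> M" "a \<in> \<theta> m"
    obtain b where b: "app e a = Some b" "b \<in> \<phi> m" using e(3)[OF m] by blast
    obtain c where c: "app f a = Some c" "c \<in> \<psi> m" using f(3)[OF m] by blast
    have "app (pairing e f) a = Some (pr b c)" using pairing_app[OF e(2) f(2) predD[OF assms(1) m] b(1) c(1)] .
    thus "\<exists>c. app (pairing e f) a = Some c \<and> c \<in> rmeet \<phi> \<psi> m" using b c by (auto simp: rmeet_def)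
  qed
qed

lemma rle_rimp:
  assumes "pred M \<theta>" "pred M \<phi>"
  shows "rle M \<theta> (rimp \<phi> \<psi>) \<longleftrightarrow> rle M (rmeet \<theta> \<phi>) \<psi>"
proof
  assume "rle M \<theta> (rimp \<phi> \<psi>)"
  then obtain e where e: "e \<in> B'" "e \<in> B" "\<And>m a. m \<in> M \<Longrightarrow> a \<in> \<theta> m \<Longrightarrow> \<exists>b. app e a = Some b \<and> b \<in> rimp \<phi> \<psi> m"
    by (rule rleE) blast
  show "rle M (rmeet \<theta> \<phi>) \<psi>"
  proof (rule rleI)
    \<comment> \<open>Uncurrying: the realizer is x -> e (p1 x) (p2 x).\<close>
    show "sxy (seq e p1) p2 \<in> B'" using e by auto
    fix m x assume m: "m \<in> M" and "x \<in> rmeet \<theta> \<phi> m"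
    then obtain a b where x: "x = pr a b" and a: "a \<in> \<theta> m" and b: "b \<in> \<phi> m" by (auto simp: rmeet_def)
    have B: "a \<in> B" "b \<in> B" using predD[OF assms(1) m a] predD[OF assms(2) m b] by simp_all
    obtain c where c: "app e a = Some c" "c \<in> rimp \<phi> \<psi> m" using e(3)[OF m a] by blast
    obtain d where d: "app c b = Some d" "d \<in> \<psi> m" using c(2) b by (auto simp: rimp_def)
    have "app (sxy (seq e p1) p2) x = Some d" unfolding x
      by (rule sxy_app[OF _ _ _ seq_app[OF p1_app c(1)] p2_app d(1)]) (use B e in auto)
    thus "\<exists>d. app (sxy (seq e p1) p2) x = Some d \<and> d \<in> \<psi> m" using d by blast
  qed
next
  assume "rle M (rmeet \<theta> \<phi>) \<psi>"
  then obtain e where e: "e \<in> B'" "e \<in> B" "\<And>m a. m \<in> M \<Longrightarrow> a \<in> rmeet \<theta> \<phi> m \<Longrightarrow> \<exists>b. app e a = Some b \<and> b \<in> \<psi> m"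
    by (rule rleE) blast
  show "rle M \<theta> (rimp \<phi> \<psi>)"
  proof (rule rleI)
    show "curried e \<in> B'" using e by auto
    fix m a assume m: "m \<in> M" and a: "a \<in> \<theta> m"
    obtain d where d: "d \<in> B" "app (curried e) a = Some d"
      "\<And>y z. y \<in> B \<Longrightarrow> app e (pr a y) = Some z \<Longrightarrow> app d y = Some z"
      using e(2) predD[OF assms(1) m a] by (rule curried_app) blast
    have "\<exists>c. app d b = Some c \<and> c \<in> \<psi> m" if b: "b \<in> \<phi> m" for b
    proof -
      have "pr a b \<in> rmeet \<theta> \<phi> m" using a b by (auto simp: rmeet_def)
      thus ?thesis using e(3)[OF m] d(3) predD[OF assms(2) m b] by blast
    qed
    thus "\<exists>d. app (curried e) a = Some d \<and> d \<in> rimp \<phi> \<psi> m" using d by (auto simp: rimp_def)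
  qed
qed

text \<open>Both sides have the same realizers, \<open>rex\<close> being a union over the fibers of
  \<open>u\<close>.\<close>

lemma rle_rex:
  assumes "u \<in> N \<rightarrow> M"
  shows "rle M (rex N u \<phi>) \<psi> \<longleftrightarrow> rle N \<phi> (\<lambda>n. \<psi> (u n))"
  using assms unfolding rle_def rex_def by fastforce

lemma rle_rall:
  assumes "u \<in> N \<rightarrow> M" "pred M \<psi>"
  shows "rle M \<psi> (rall N u \<phi>) \<longleftrightarrow> rle N (\<lambda>n. \<psi> (u n)) \<phi>"
proof
  assume "rle M \<psi> (rall N u \<phi>)"
  then obtain e where e: "e \<in> B'" "e \<in> B" "\<And>m a. m \<in> M \<Longrightarrow> a \<in> \<psi> m \<Longrightarrow> \<exists>b. app e a = Some b \<and> b \<in> rall N u \<phi> m"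
    by (rule rleE) blast
  show "rle N (\<lambda>n. \<psi> (u n)) \<phi>"
  proof (rule rleI)
    \<comment> \<open>The dummy argument of \<open>rall\<close> is filled with \<open>k\<close>,
      which lies in the sub-pca: the realizer is a -> (e a) k.\<close>
    show "sxy e (kx k) \<in> B'" using e k' by auto
    fix n a assume n: "n \<in> N" and a: "a \<in> \<psi> (u n)"
    have m: "u n \<in> M" using n assms(1) by blast
    obtain c where c: "app e a = Some c" "c \<in> rall N u \<phi> (u n)" using e(3)[OF m a] by blast
    obtain d where d: "app c k = Some d" "d \<in> \<phi> n" using c(2) n ks_B(1) by (auto simp: rall_def)
    have "app (sxy e (kx k)) a = Some d"
      by (rule sxy_app[OF _ _ _ c(1) kx_app d(1)]) (use predD[OF assms(2) m a] e in auto)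
    thus "\<exists>d. app (sxy e (kx k)) a = Some d \<and> d \<in> \<phi> n" using d by blast
  qed
next
  assume "rle N (\<lambda>n. \<psi> (u n)) \<phi>"
  then obtain e where e: "e \<in> B'" "e \<in> B" "\<And>n a. n \<in> N \<Longrightarrow> a \<in> \<psi> (u n) \<Longrightarrow> \<exists>b. app e a = Some b \<and> b \<in> \<phi> n"
    by (rule rleE) blast
  show "rle M \<psi> (rall N u \<phi>)"
  proof (rule rleI)
    \<comment> \<open>\<open>p1\<close> discards the dummy argument, and currying keeps the outer
      value defined over points outside the image of \<open>u\<close>.\<close>
    show "curried (seq e p1) \<in> B'" using e by auto
    fix m a assume m: "m \<in> M" and a: "a \<in> \<psi> m"
    have aB: "a \<in> B" using predD[OF assms(2) m a] .
    have eB: "seq e p1 \<in> B" using e by auto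
    obtain d where d: "d \<in> B" "app (curried (seq e p1)) a = Some d"
      "\<And>y z. y \<in> B \<Longrightarrow> app (seq e p1) (pr a y) = Some z \<Longrightarrow> app d y = Some z"
      using eB aB by (rule curried_app) blast
    have "\<exists>c. app d b = Some c \<and> c \<in> \<phi> n" if n: "n \<in> N" "u n = m" and b: "b \<in> B" for n b
    proof -
      obtain c where c: "app e a = Some c" "c \<in> \<phi> n" using e(3)[OF n(1)] n(2) a by blast
      have "app (seq e p1) (pr a b) = Some c"
        by (rule seq_app[OF p1_app c(1)]) (use aB b e in auto)
      thus ?thesis using d(3) b c by blast
    qed
    thus "\<exists>d. app (curried (seq e p1)) a = Some d \<and> d \<in> rall N u \<phi> m" using d by (auto simp: rall_def)
  qed
qed

end

lemma pca_inclusionE: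
  assumes "pca_inclusion B' B app"
  obtains k s where "pca_incl B B' app k s"
  using assms unfolding pca_inclusion_def pca_def pca_incl_def by blast

section \<open>Relative realizability triposes\<close>

lemma rr_Obj: "Obj (rr_tripos B' B app) = {(M, \<phi>). \<phi> \<in> elts M \<rightarrow>\<^sub>E Pow B}"
  and rr_pobj: "pobj (rr_tripos B' B app) = fst"
  by (simp_all add: rr_tripos_def total_fibration_def)

lemma rr_Arr: "(x, u, y) \<in> Arr (rr_tripos B' B app) \<longleftrightarrow>
  snd x \<in> elts (fst x) \<rightarrow>\<^sub>E Pow B \<and> snd y \<in> elts (fst y) \<rightarrow>\<^sub>E Pow B \<and> u \<in> Hom SET (fst x) (fst y) \<and>
  (\<exists>e\<in>B'. \<forall>m\<in>elts (fst x). \<forall>a\<in>snd x m. \<exists>b. app e a = Some b \<and> b \<in> snd y (sfun u m))"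
  by (cases x; cases y) (auto simp: rr_tripos_def total_fibration_def Hom_SET_iff compose_def)

lemma rr_sel: "Dom (rr_tripos B' B app) (x, u, y) = x" "Cod (rr_tripos B' B app) (x, u, y) = y"
  "Id (rr_tripos B' B app) x = (x, Id SET (fst x), x)" "parr (rr_tripos B' B app) (x, u, y) = u"
  "Comp (rr_tripos B' B app) (y, v, z) (x, u, y') = (x, Comp SET v u, z)"
  by (simp_all add: rr_tripos_def total_fibration_def)

lemma rr_reaches: "reaches (rr_tripos B' B app) x u y \<longleftrightarrow> (x, u, y) \<in> Arr (rr_tripos B' B app)"
proof
  assume "reaches (rr_tripos B' B app) x u y"
  then obtain a where "a \<in> Arr (rr_tripos B' B app)" "Dom (rr_tripos B' B app) a = x"
    "Cod (rr_tripos B' B app) a = y" "parr (rr_tripos B' B app) a = u"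
    by (auto simp: reaches_def Hom_def)
  thus "(x, u, y) \<in> Arr (rr_tripos B' B app)" by (cases a) (simp add: rr_sel)
next
  assume "(x, u, y) \<in> Arr (rr_tripos B' B app)"
  thus "reaches (rr_tripos B' B app) x u y"
    unfolding reaches_def Hom_def by (intro bexI[of _ "(x, u, y)"]) (simp_all add: rr_sel)
qed



context pca_incl
begin

abbreviation "R \<equiv> rr_tripos B' B app"

lemma rr_reaches_iff: "reaches R (M, \<phi>) u (N, \<psi>) \<longleftrightarrow>
  \<phi> \<in> elts M \<rightarrow>\<^sub>E Pow B \<and> \<psi> \<in> elts N \<rightarrow>\<^sub>E Pow B \<and> u \<in> Hom SET M N \<and>
  rle (elts M) \<phi> (\<lambda>m. \<psi> (sfun u m))"
  by (simp add: rr_reaches rr_Arr rle_def)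

lemma rr_Hom: "a \<in> Hom R x y \<longleftrightarrow> (\<exists>u. a = (x, u, y) \<and> reaches R x u y)"
  unfolding rr_reaches Hom_def by (cases a) (auto simp: rr_sel)

lemma sfun_comp: "u \<in> Hom SET M N \<Longrightarrow> v \<in> Hom SET N K \<Longrightarrow> m \<in> elts M \<Longrightarrow>
    sfun (Comp SET v u) m = sfun v (sfun u m)"
proof -
  assume "u \<in> Hom SET M N" "m \<in> elts M"
  hence "m \<in> elts (sdom u)" by (simp add: Hom_SET_iff)
  thus ?thesis by (simp add: SET_def compose_def)
qed

lemma pred_PiE: "\<phi> \<in> elts M \<rightarrow>\<^sub>E Pow B \<Longrightarrow> pred (elts M) \<phi>"
  by (auto simp: pred_def)

lemma rle_cong: "(\<And>m. m \<in> M \<Longrightarrow> \<phi> m = \<phi>' m) \<Longrightarrow> (\<And>m. m \<in> M \<Longrightarrow> \<psi> m = \<psi>' m) \<Longrightarrow>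
    rle M \<phi> \<psi> \<longleftrightarrow> rle M \<phi>' \<psi>'"
  by (auto simp: rle_def)

lemma rr_reaches_id:
  assumes "x \<in> Obj R" shows "reaches R x (Id SET (fst x)) x"
proof -
  obtain M \<phi> where x: "x = (M, \<phi>)" "\<phi> \<in> elts M \<rightarrow>\<^sub>E Pow B" using assms by (auto simp: rr_Obj)
  have "rle (elts M) \<phi> (\<lambda>m. \<phi> (sfun (Id SET M) m)) \<longleftrightarrow> rle (elts M) \<phi> \<phi>"
    by (rule rle_cong) (simp_all add: Id_smap)
  thus ?thesis using rle_refl[OF pred_PiE[OF x(2)]] x by (simp add: rr_reaches_iff Id_hom)
qed

lemma rr_reaches_comp:
  assumes "reaches R x u y" "reaches R y v z"
  shows "reaches R x (Comp SET v u) z"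
proof -
  obtain M \<phi> N \<psi> K \<chi> where [simp]: "x = (M, \<phi>)" "y = (N, \<psi>)" "z = (K, \<chi>)"
    by (cases x; cases y; cases z)
  have u: "u \<in> Hom SET M N" "\<phi> \<in> elts M \<rightarrow>\<^sub>E Pow B" "rle (elts M) \<phi> (\<lambda>m. \<psi> (sfun u m))"
    and v: "v \<in> Hom SET N K" "\<chi> \<in> elts K \<rightarrow>\<^sub>E Pow B" "rle (elts N) \<psi> (\<lambda>n. \<chi> (sfun v n))"
    using assms by (simp_all add: rr_reaches_iff)
  have "sfun u \<in> elts M \<rightarrow> elts N" using u(1) by (auto simp: Hom_SET_iff)
  from rle_comp[OF v(3) this] u(3) have "rle (elts M) \<phi> (\<lambda>m. \<chi> (sfun v (sfun u m)))"
    using rle_trans pred_PiE[OF u(2)] by blast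
  moreover have "rle (elts M) \<phi> (\<lambda>m. \<chi> (sfun v (sfun u m))) \<longleftrightarrow>
      rle (elts M) \<phi> (\<lambda>m. \<chi> (sfun (Comp SET v u) m))"
    by (rule rle_cong) (simp_all add: sfun_comp[OF u(1) v(1)])
  ultimately show ?thesis using u v by (auto simp: rr_reaches_iff)
qed

lemma rr_reachesD:
  assumes "reaches R x u y"
  shows "x \<in> Obj R" "y \<in> Obj R" "u \<in> Hom SET (fst x) (fst y)"
  using assms by (cases x; cases y; auto simp: rr_reaches_iff rr_Obj)+

lemma rr_category: "category R"
  unfolding category_def
proof (intro conjI allI ballI)
  fix f assume f: "f \<in> Arr R"
  obtain x u y where [simp]: "f = (x, u, y)" by (cases f)
  have "reaches R x u y" using f by (simp add: rr_reaches)
  thus "Dom R f \<in> Obj R" "Cod R f \<in> Obj R" using rr_reachesD(1,2)[of x u y] by (simp_all add: rr_sel)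
next
  fix x assume "x \<in> Obj R"
  thus "Id R x \<in> Hom R x x" using rr_reaches_id by (simp add: rr_sel rr_Hom)
next
  fix x y z f g assume "f \<in> Hom R x y" "g \<in> Hom R y z"
  thus "Comp R g f \<in> Hom R x z" unfolding rr_Hom using rr_reaches_comp by (elim exE conjE) (simp add: rr_sel)
next
  fix x y f assume "f \<in> Hom R x y"
  then obtain u where u: "f = (x, u, y)" "reaches R x u y" by (auto simp: rr_Hom)
  note comp_id[OF rr_reachesD(3)[OF u(2)]]
  thus "Comp R f (Id R x) = f" "Comp R (Id R y) f = f" by (simp_all add: u(1) rr_sel)
next
  fix w x y z f g h assume "f \<in> Hom R w x" "g \<in> Hom R x y" "h \<in> Hom R y z"
  then obtain u v t where f: "f = (w, u, x)" "reaches R w u x"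
    and g: "g = (x, v, y)" "reaches R x v y" and h: "h = (y, t, z)" "reaches R y t z"
    unfolding rr_Hom by blast
  show "Comp R h (Comp R g f) = Comp R (Comp R h g) f"
    using comp_assoc[OF rr_reachesD(3)[OF f(2)] rr_reachesD(3)[OF g(2)] rr_reachesD(3)[OF h(2)]]
    by (simp add: f(1) g(1) h(1) rr_sel)
qed

lemma rr_functor: "is_functor R SET (pobj R) (parr R)"
  unfolding is_functor_def
proof (intro conjI allI ballI)
  fix x y f assume "f \<in> Hom R x y"
  then obtain u where u: "f = (x, u, y)" "reaches R x u y" by (auto simp: rr_Hom)
  thus "parr R f \<in> Hom SET (pobj R x) (pobj R y)"
    using rr_reachesD(3)[OF u(2)] by (simp add: rr_sel rr_pobj)
next
  fix x y z f g assume "f \<in> Hom R x y" "g \<in> Hom R y z"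
  thus "parr R (Comp R g f) = Comp SET (parr R g) (parr R f)" by (auto simp: rr_Hom rr_sel)
qed (simp_all add: rr_sel rr_pobj)

lemma rr_cartesian:
  assumes \<psi>: "\<psi> \<in> elts N \<rightarrow>\<^sub>E Pow B" and u: "u \<in> Hom SET M N"
  shows "\<exists>a. cartesian R a \<and> Cod R a = (N, \<psi>) \<and> parr R a = u"
proof -
  define \<phi> where "\<phi> = compose (elts M) \<psi> (sfun u)"
  have uf: "sfun u \<in> elts M \<rightarrow> elts N" using u by (auto simp: Hom_SET_iff)
  hence \<phi>: "\<phi> \<in> elts M \<rightarrow>\<^sub>E Pow B" using \<psi> by (fastforce simp: \<phi>_def compose_def)
  have \<phi>m: "\<phi> m = \<psi> (sfun u m)" if "m \<in> elts M" for m using that by (simp add: \<phi>_def compose_def)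
  let ?a = "((M, \<phi>), u, (N, \<psi>))"
  have "rle (elts M) \<phi> (\<lambda>m. \<psi> (sfun u m)) \<longleftrightarrow> rle (elts M) \<phi> \<phi>"
    by (rule rle_cong) (simp_all add: \<phi>m)
  hence r: "reaches R (M, \<phi>) u (N, \<psi>)" using \<phi> \<psi> u rle_refl[OF pred_PiE[OF \<phi>]] by (simp add: rr_reaches_iff)
  have "\<exists>!c. c \<in> Hom R x (M, \<phi>) \<and> parr R c = w \<and> Comp R ?a c = b"
    if b: "b \<in> Hom R x (N, \<psi>)" and w: "w \<in> Hom SET (fst x) M" and bw: "parr R b = Comp SET u w" for x b w
  proof -
    obtain K \<chi> where x: "x = (K, \<chi>)" by (cases x)
    have b': "b = (x, Comp SET u w, (N, \<psi>))" "reaches R x (Comp SET u w) (N, \<psi>)"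
      using b bw by (auto simp: rr_Hom rr_sel)
    have w': "w \<in> Hom SET K M" "sfun w \<in> elts K \<rightarrow> elts M" using w x by (auto simp: Hom_SET_iff)
    have "rle (elts K) \<chi> (\<lambda>m. \<psi> (sfun (Comp SET u w) m)) \<longleftrightarrow> rle (elts K) \<chi> (\<lambda>m. \<phi> (sfun w m))"
    proof (rule rle_cong)
      fix m assume m: "m \<in> elts K"
      have "sfun w m \<in> elts M" using w'(2) m by blast
      thus "\<psi> (sfun (Comp SET u w) m) = \<phi> (sfun w m)" by (simp add: sfun_comp[OF w'(1) u m] \<phi>m)
    qed simp
    hence "reaches R x w (M, \<phi>)" using b'(2) w' \<phi> unfolding x by (auto simp: rr_reaches_iff)
    thus ?thesis by (intro ex1I[of _ "(x, w, (M, \<phi>))"]) (auto simp: rr_Hom rr_sel b'(1))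
  qed
  hence "cartesian R ?a" unfolding cartesian_def using r by (simp add: rr_reaches rr_sel rr_pobj)
  thus ?thesis by (auto simp: rr_sel intro!: exI[of _ ?a])
qed

lemma rr_posetal: "posetal_fibration R"
  unfolding posetal_fibration_def fibration_def faithful_def
proof (intro conjI ballI allI)
  fix \<psi> M u assume "\<psi> \<in> Obj R" "u \<in> Hom SET M (pobj R \<psi>)"
  thus "\<exists>a. cartesian R a \<and> Cod R a = \<psi> \<and> parr R a = u"
    using rr_cartesian by (cases \<psi>) (auto simp: rr_Obj rr_pobj)
next
  show "inj_on (parr R) (Hom R x y)" for x y by (auto simp: inj_on_def rr_Hom rr_sel)
qed (rule rr_category rr_functor)+

end


section \<open>Logic of relative realizability triposes\<close>

text \<open>An equivalence with the tripos enters only through \<open>F\<close>, which assigns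
  realizability predicates to predicates of \<open>X\<close>, respects and reflects the order over
  every map, and is surjective up to equivalence. All conditions are verified in \<open>X\<close>
  itself, so no structure is transported back along a quasi-inverse.\<close>

locale rr_model = posetal X + pca_incl "elts C" B' app k s
  for X :: "('o, 'a, 'u::set_universe) over_set" and C :: 'u and B' app k s +
  fixes F :: "'o \<Rightarrow> 'u \<Rightarrow> 'u set"
  assumes F_pred: "\<phi> \<in> fiber X M \<Longrightarrow> pred (elts M) (F \<phi>)"
    and F_reaches: "\<phi> \<in> fiber X M \<Longrightarrow> \<psi> \<in> fiber X N \<Longrightarrow> u \<in> Hom SET M N \<Longrightarrow>
      reaches X \<phi> u \<psi> \<longleftrightarrow> rle (elts M) (F \<phi>) (\<lambda>m. F \<psi> (sfun u m))"
    and F_surj: "pred (elts M) \<rho> \<Longrightarrow> \<exists>\<phi>\<in>fiber X M. rle (elts M) (F \<phi>) \<rho> \<and> rle (elts M) \<rho> (F \<phi>)"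
begin

definition req :: "'u \<Rightarrow> ('u \<Rightarrow> 'u set) \<Rightarrow> ('u \<Rightarrow> 'u set) \<Rightarrow> bool" where
  "req M \<rho> \<sigma> \<longleftrightarrow> pred (elts M) \<rho> \<and> pred (elts M) \<sigma> \<and> rle (elts M) \<rho> \<sigma> \<and> rle (elts M) \<sigma> \<rho>"

lemma req_refl: "pred (elts M) \<rho> \<Longrightarrow> req M \<rho> \<rho>"
  by (simp add: req_def rle_refl)

lemma req_sym: "req M \<rho> \<sigma> \<Longrightarrow> req M \<sigma> \<rho>"
  by (auto simp: req_def)

lemma req_trans [trans]: "req M \<rho> \<sigma> \<Longrightarrow> req M \<sigma> \<tau> \<Longrightarrow> req M \<rho> \<tau>"
  unfolding req_def using rle_trans by blast

lemma req_comp: "req M \<rho> \<sigma> \<Longrightarrow> f \<in> elts N \<rightarrow> elts M \<Longrightarrow> req N (\<lambda>n. \<rho> (f n)) (\<lambda>n. \<sigma> (f n))"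
  unfolding req_def using rle_comp pred_comp by blast

lemma req_le: "req M \<rho> \<rho>' \<Longrightarrow> req M \<sigma> \<sigma>' \<Longrightarrow> rle (elts M) \<rho> \<sigma> \<longleftrightarrow> rle (elts M) \<rho>' \<sigma>'"
  unfolding req_def using rle_trans by blast

lemma req_cong: "req M \<rho> \<sigma> \<Longrightarrow> (\<And>m. m \<in> elts M \<Longrightarrow> \<rho> m = \<rho>' m) \<Longrightarrow> (\<And>m. m \<in> elts M \<Longrightarrow> \<sigma> m = \<sigma>' m) \<Longrightarrow> req M \<rho>' \<sigma>'"
  by (auto simp: req_def rle_def pred_def)

lemma F_surjE:
  assumes "pred (elts M) \<rho>"
  obtains \<phi> where "\<phi> \<in> fiber X M" "req M (F \<phi>) \<rho>"
  using F_surj[OF assms] F_pred assms unfolding req_def by blast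

lemma F_le: "\<phi> \<in> fiber X M \<Longrightarrow> \<psi> \<in> fiber X M \<Longrightarrow> \<phi> \<preceq> \<psi> \<longleftrightarrow> rle (elts M) (F \<phi>) (F \<psi>)"
proof -
  assume p: "\<phi> \<in> fiber X M" "\<psi> \<in> fiber X M"
  have "rle (elts M) (F \<phi>) (\<lambda>m. F \<psi> (sfun (Id SET M) m)) \<longleftrightarrow> rle (elts M) (F \<phi>) (F \<psi>)"
    by (rule rle_cong) (simp_all add: Id_smap)
  thus ?thesis using F_reaches[OF p Id_hom] p by (simp add: fib_le_reaches fiber_iff)
qed

lemma F_iso: "\<phi> \<in> fiber X M \<Longrightarrow> \<psi> \<in> fiber X M \<Longrightarrow> \<phi> \<cong> \<psi> \<longleftrightarrow> req M (F \<phi>) (F \<psi>)"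
  by (simp add: fib_iso_def F_le req_def F_pred)

text \<open>\<open>reindex\<close> is a choice, so its image is found by the universal property:
  surjectivity of \<open>F\<close> supplies a predicate of \<open>X\<close> with the desired values,
  and this lies below the reindexing.\<close>

lemma F_pull:
  assumes "f \<in> elts N \<rightarrow> elts M" "\<phi> \<in> fiber X M"
  shows "req N (F (pull N M f \<phi>)) (\<lambda>n. F \<phi> (f n))"
proof -
  have p: "pred (elts N) (\<lambda>n. F \<phi> (f n))" using pred_comp[OF F_pred[OF assms(2)] assms(1)] .
  have iff: "reaches X \<theta> (smap N M f) \<phi> \<longleftrightarrow> rle (elts N) (F \<theta>) (\<lambda>n. F \<phi> (f n))" if "\<theta> \<in> fiber X N" for \<theta>
  proof -
    have "rle (elts N) (F \<theta>) (\<lambda>n. F \<phi> (sfun (smap N M f) n)) \<longleftrightarrow> rle (elts N) (F \<theta>) (\<lambda>n. F \<phi> (f n))"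
      by (rule rle_cong) simp_all
    thus ?thesis using F_reaches[OF that assms(2) smap_hom[OF assms(1)]] by simp
  qed
  note f = pull_fiber[OF assms]
  have 1: "rle (elts N) (F (pull N M f \<phi>)) (\<lambda>n. F \<phi> (f n))"
    using iff[OF f] reindex_reaches[OF smap_hom[OF assms(1)] assms(2)] by blast
  obtain \<theta> where t: "\<theta> \<in> fiber X N" "req N (F \<theta>) (\<lambda>n. F \<phi> (f n))" using p by (rule F_surjE)
  have "\<theta> \<preceq> pull N M f \<phi>" using iff[OF t(1)] t(2) le_reindex[OF smap_hom[OF assms(1)] assms(2) t(1)]
    by (simp add: req_def)
  hence "rle (elts N) (F \<theta>) (F (pull N M f \<phi>))" using F_le[OF t(1) f] by blast
  hence "rle (elts N) (\<lambda>n. F \<phi> (f n)) (F (pull N M f \<phi>))"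
    using t(2) p rle_trans by (meson req_def)
  with 1 show ?thesis using F_pred[OF f] p by (simp add: req_def)
qed

lemma is_top_iff: "\<tau> \<in> fiber X M \<Longrightarrow> is_top X M \<tau> \<longleftrightarrow> req M (F \<tau>) (\<lambda>_. elts C)"
proof
  assume t: "\<tau> \<in> fiber X M" "is_top X M \<tau>"
  have p: "pred (elts M) (\<lambda>_. elts C)" by (simp add: pred_def)
  obtain \<theta> where "\<theta> \<in> fiber X M" "req M (F \<theta>) (\<lambda>_. elts C)" using p by (rule F_surjE)
  moreover from this t have "rle (elts M) (F \<theta>) (F \<tau>)" using F_le by (simp add: is_top_def)
  ultimately have "rle (elts M) (\<lambda>_. elts C) (F \<tau>)" using rle_trans p by (meson req_def)
  thus "req M (F \<tau>) (\<lambda>_. elts C)" using F_pred[OF t(1)] p by (simp add: req_def rle_top)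
next
  assume t: "\<tau> \<in> fiber X M" "req M (F \<tau>) (\<lambda>_. elts C)"
  show "is_top X M \<tau>" unfolding is_top_def
  proof (intro conjI ballI)
    fix \<phi> assume f: "\<phi> \<in> fiber X M"
    have "rle (elts M) (F \<phi>) (F \<tau>)" using rle_trans[OF rle_top[OF F_pred[OF f]] _ F_pred[OF f]] t(2) by (simp add: req_def)
    thus "\<phi> \<preceq> \<tau>" using F_le f t by blast
  qed (fact t)
qed

text \<open>Preservation of a connective is demanded for every meet or implication, not for chosen
  ones, so each is characterized by its value under \<open>F\<close>.\<close>

lemma is_meet_iff:
  assumes f: "\<phi> \<in> fiber X M" "\<psi> \<in> fiber X M" "\<chi> \<in> fiber X M"
  shows "is_meet X M \<phi> \<psi> \<chi> \<longleftrightarrow> req M (F \<chi>) (rmeet (F \<phi>) (F \<psi>))"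
proof -
  have p: "pred (elts M) (rmeet (F \<phi>) (F \<psi>))" using F_pred f by blast
  have m: "rle (elts M) (F \<theta>) (rmeet (F \<phi>) (F \<psi>)) \<longleftrightarrow> \<theta> \<preceq> \<phi> \<and> \<theta> \<preceq> \<psi>" if "\<theta> \<in> fiber X M" for \<theta>
    using rle_rmeet[OF F_pred[OF that] F_pred[OF f(1)] F_pred[OF f(2)]]
      F_le[OF that f(1)] F_le[OF that f(2)] by simp
  show ?thesis
  proof
    assume a: "is_meet X M \<phi> \<psi> \<chi>"
    obtain \<theta> where t: "\<theta> \<in> fiber X M" "req M (F \<theta>) (rmeet (F \<phi>) (F \<psi>))" using p by (rule F_surjE)
    have "\<theta> \<preceq> \<chi>" using a t m[OF t(1)] by (simp add: is_meet_def req_def)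
    hence "rle (elts M) (rmeet (F \<phi>) (F \<psi>)) (F \<chi>)" using t F_le[OF t(1) f(3)] p rle_trans by (meson req_def)
    moreover have "rle (elts M) (F \<chi>) (rmeet (F \<phi>) (F \<psi>))"
      using a f le_refl[OF f(3)] m[OF f(3)] by (simp add: is_meet_def)
    ultimately show "req M (F \<chi>) (rmeet (F \<phi>) (F \<psi>))" using p F_pred f by (simp add: req_def)
  next
    assume a: "req M (F \<chi>) (rmeet (F \<phi>) (F \<psi>))"
    have "\<theta> \<preceq> \<chi> \<longleftrightarrow> \<theta> \<preceq> \<phi> \<and> \<theta> \<preceq> \<psi>" if t: "\<theta> \<in> fiber X M" for \<theta>
      using req_le[OF req_refl[OF F_pred[OF t]] a] m[OF t] F_le[OF t f(3)] by simp
    thus "is_meet X M \<phi> \<psi> \<chi>" using f by (simp add: is_meet_def)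
  qed
qed

lemma rmeet_mono: "pred M \<rho> \<Longrightarrow> pred M \<sigma> \<Longrightarrow> pred M \<rho>' \<Longrightarrow> pred M \<sigma>' \<Longrightarrow> rle M \<rho> \<rho>' \<Longrightarrow> rle M \<sigma> \<sigma>' \<Longrightarrow>
    rle M (rmeet \<rho> \<sigma>) (rmeet \<rho>' \<sigma>')"
  using rle_rmeet[of M "rmeet \<rho> \<sigma>"] rle_refl[of M "rmeet \<rho> \<sigma>"] rle_trans pred_rmeet by metis

lemma req_rmeet: "req M \<rho> \<rho>' \<Longrightarrow> req M \<sigma> \<sigma>' \<Longrightarrow> req M (rmeet \<rho> \<sigma>) (rmeet \<rho>' \<sigma>')"
  unfolding req_def using rmeet_mono pred_rmeet by blast

lemma rimp_mono:
  assumes "pred M \<rho>'" "pred M \<rho>" "rle M \<rho>' \<rho>" "rle M \<sigma> \<sigma>'"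
  shows "rle M (rimp \<rho> \<sigma>) (rimp \<rho>' \<sigma>')"
proof -
  have "rle M (rmeet (rimp \<rho> \<sigma>) \<rho>') (rmeet (rimp \<rho> \<sigma>) \<rho>)"
    using assms rle_refl by (intro rmeet_mono) auto
  moreover have "rle M (rmeet (rimp \<rho> \<sigma>) \<rho>) \<sigma>" using rle_rimp assms rle_refl by blast
  ultimately have "rle M (rmeet (rimp \<rho> \<sigma>) \<rho>') \<sigma>'"
    using rle_trans assms pred_rmeet pred_rimp by metis
  thus ?thesis using rle_rimp assms by blast
qed

lemma req_rimp: "req M \<rho> \<rho>' \<Longrightarrow> req M \<sigma> \<sigma>' \<Longrightarrow> req M (rimp \<rho> \<sigma>) (rimp \<rho>' \<sigma>')"
  unfolding req_def using rimp_mono pred_rimp by blast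

lemma is_meet_ex:
  assumes f: "\<phi> \<in> fiber X M" "\<psi> \<in> fiber X M"
  obtains \<chi> where "is_meet X M \<phi> \<psi> \<chi>"
proof -
  have "pred (elts M) (rmeet (F \<phi>) (F \<psi>))" using F_pred f by blast
  thus thesis using F_surjE is_meet_iff[OF f] that by metis
qed

lemma is_imp_iff:
  assumes f: "\<phi> \<in> fiber X M" "\<psi> \<in> fiber X M" "\<chi> \<in> fiber X M"
  shows "is_imp X M \<phi> \<psi> \<chi> \<longleftrightarrow> req M (F \<chi>) (rimp (F \<phi>) (F \<psi>))"
proof -
  have p: "pred (elts M) (rimp (F \<phi>) (F \<psi>))" by blast
  have m: "rle (elts M) (F \<theta>) (rimp (F \<phi>) (F \<psi>)) \<longleftrightarrow> \<mu> \<preceq> \<psi>" if t: "is_meet X M \<theta> \<phi> \<mu>" for \<theta> \<mu>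
  proof -
    have f': "\<theta> \<in> fiber X M" "\<mu> \<in> fiber X M" using t by (auto simp: is_meet_def)
    have "req M (F \<mu>) (rmeet (F \<theta>) (F \<phi>))" using is_meet_iff[OF f'(1) f(1) f'(2)] t by blast
    from req_le[OF this req_refl[OF F_pred[OF f(2)]]] show ?thesis
      using rle_rimp[OF F_pred[OF f'(1)] F_pred[OF f(1)]] F_le[OF f'(2) f(2)] by blast
  qed
  show ?thesis
  proof
    assume a: "is_imp X M \<phi> \<psi> \<chi>"
    obtain \<theta> where t: "\<theta> \<in> fiber X M" "req M (F \<theta>) (rimp (F \<phi>) (F \<psi>))" using p by (rule F_surjE)
    obtain \<mu> where mu: "is_meet X M \<theta> \<phi> \<mu>" using is_meet_ex[OF t(1) f(1)] .
    have "\<theta> \<preceq> \<chi>" using a t(2) mu m[OF mu] by (simp add: is_imp_def req_def)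
    hence 1: "rle (elts M) (rimp (F \<phi>) (F \<psi>)) (F \<chi>)" using t F_le[OF t(1) f(3)] p rle_trans by (meson req_def)
    obtain \<nu> where nu: "is_meet X M \<chi> \<phi> \<nu>" using is_meet_ex[OF f(3,1)] .
    hence "rle (elts M) (F \<chi>) (rimp (F \<phi>) (F \<psi>))" using a le_refl[OF f(3)] m[OF nu] by (simp add: is_imp_def)
    with 1 show "req M (F \<chi>) (rimp (F \<phi>) (F \<psi>))" using p F_pred f by (simp add: req_def)
  next
    assume a: "req M (F \<chi>) (rimp (F \<phi>) (F \<psi>))"
    have "\<theta> \<preceq> \<chi> \<longleftrightarrow> \<mu> \<preceq> \<psi>" if t: "is_meet X M \<theta> \<phi> \<mu>" for \<theta> \<mu>
    proof -
      have f': "\<theta> \<in> fiber X M" using t by (auto simp: is_meet_def)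
      show ?thesis using req_le[OF req_refl[OF F_pred[OF f']] a] m[OF t] F_le[OF f' f(3)] by simp
    qed
    thus "is_imp X M \<phi> \<psi> \<chi>" using f by (simp add: is_imp_def)
  qed
qed

lemma models_top_X: "models_top X"
  unfolding models_top_def
proof (intro conjI allI ballI impI)
  fix M :: 'u
  have p: "pred (elts M) (\<lambda>_. elts C)" by (simp add: pred_def)
  thus "\<exists>\<tau>. is_top X M \<tau>" using F_surjE is_top_iff by metis
next
  fix N M u \<tau> assume u: "u \<in> Hom SET N M" and t: "is_top X M \<tau>"
  obtain f where f: "u = smap N M f" "f \<in> elts N \<rightarrow> elts M" using u by (rule hom_smapE)
  have t': "\<tau> \<in> fiber X M" using t by (simp add: is_top_def)
  have "req N (F (pull N M f \<tau>)) (\<lambda>_. elts C)"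
    using req_trans[OF F_pull[OF f(2) t']] req_comp[OF _ f(2), of "F \<tau>" "\<lambda>_. elts C"] t is_top_iff[OF t'] by blast
  thus "is_top X N (reindex X u \<tau>)" using is_top_iff pull_fiber[OF f(2) t'] f(1) by simp
qed

lemma models_and_X: "models_and X"
  unfolding models_and_def
proof (intro conjI allI ballI impI)
  fix M \<phi> \<psi> assume "\<phi> \<in> fiber X M" "\<psi> \<in> fiber X M"
  thus "\<exists>\<chi>. is_meet X M \<phi> \<psi> \<chi>" using is_meet_ex by metis
next
  fix N M u \<phi> \<psi> \<chi> assume u: "u \<in> Hom SET N M" and a: "is_meet X M \<phi> \<psi> \<chi>"
  obtain f where f: "u = smap N M f" "f \<in> elts N \<rightarrow> elts M" using u by (rule hom_smapE)
  have t: "\<phi> \<in> fiber X M" "\<psi> \<in> fiber X M" "\<chi> \<in> fiber X M" using a by (auto simp: is_meet_def)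
  have "req M (F \<chi>) (rmeet (F \<phi>) (F \<psi>))" using a is_meet_iff[OF t] by blast
  from req_comp[OF this f(2)]
  have "req N (\<lambda>n. F \<chi> (f n)) (rmeet (\<lambda>n. F \<phi> (f n)) (\<lambda>n. F \<psi> (f n)))"
    by (rule req_cong) (simp_all add: rmeet_def)
  hence "req N (F (pull N M f \<chi>)) (rmeet (F (pull N M f \<phi>)) (F (pull N M f \<psi>)))"
    using F_pull[OF f(2)] t req_trans req_sym req_rmeet by meson
  thus "is_meet X N (reindex X u \<phi>) (reindex X u \<psi>) (reindex X u \<chi>)"
    using is_meet_iff pull_fiber[OF f(2)] t f(1) by simp
qed

lemma models_imp_X: "models_imp X"
  unfolding models_imp_def
proof (intro conjI allI ballI impI)
  fix M \<phi> \<psi> assume f: "\<phi> \<in> fiber X M" "\<psi> \<in> fiber X M"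
  have "pred (elts M) (rimp (F \<phi>) (F \<psi>))" by blast
  thus "\<exists>\<chi>. is_imp X M \<phi> \<psi> \<chi>" using F_surjE is_imp_iff[OF f] by metis
next
  fix N M u \<phi> \<psi> \<chi> assume u: "u \<in> Hom SET N M" and a: "is_imp X M \<phi> \<psi> \<chi>"
  obtain f where f: "u = smap N M f" "f \<in> elts N \<rightarrow> elts M" using u by (rule hom_smapE)
  have t: "\<phi> \<in> fiber X M" "\<psi> \<in> fiber X M" "\<chi> \<in> fiber X M" using a by (auto simp: is_imp_def)
  have "req M (F \<chi>) (rimp (F \<phi>) (F \<psi>))" using a is_imp_iff[OF t] by blast
  from req_comp[OF this f(2)]
  have "req N (\<lambda>n. F \<chi> (f n)) (rimp (\<lambda>n. F \<phi> (f n)) (\<lambda>n. F \<psi> (f n)))"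
    by (rule req_cong) (simp_all add: rimp_def)
  hence "req N (F (pull N M f \<chi>)) (rimp (F (pull N M f \<phi>)) (F (pull N M f \<psi>)))"
    using F_pull[OF f(2)] t req_trans req_sym req_rimp by meson
  thus "is_imp X N (reindex X u \<phi>) (reindex X u \<psi>) (reindex X u \<chi>)"
    using is_imp_iff pull_fiber[OF f(2)] t f(1) by simp
qed

section \<open>Quantifiers along maps and Beck-Chevalley\<close>

lemma left_adjoint_ex:
  assumes f: "f \<in> elts N \<rightarrow> elts M" shows "\<exists>L. left_adjoint X (smap N M f) L"
proof
  define L where "L \<phi> = (SOME \<psi>. \<psi> \<in> fiber X M \<and> req M (F \<psi>) (rex (elts N) f (F \<phi>)))" for \<phi>
  have L: "L \<phi> \<in> fiber X M \<and> req M (F (L \<phi>)) (rex (elts N) f (F \<phi>))" if "\<phi> \<in> fiber X N" for \<phi>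
  proof -
    have "pred (elts M) (rex (elts N) f (F \<phi>))" using F_pred[OF that] by blast
    hence "\<exists>\<psi>. \<psi> \<in> fiber X M \<and> req M (F \<psi>) (rex (elts N) f (F \<phi>))" using F_surjE by metis
    from someI_ex[OF this] show ?thesis unfolding L_def .
  qed
  have "L \<phi> \<preceq> \<psi> \<longleftrightarrow> \<phi> \<preceq> pull N M f \<psi>" if p: "\<phi> \<in> fiber X N" "\<psi> \<in> fiber X M" for \<phi> \<psi>
  proof -
    have "L \<phi> \<preceq> \<psi> \<longleftrightarrow> rle (elts M) (F (L \<phi>)) (F \<psi>)" using F_le L p by blast
    also have "\<dots> \<longleftrightarrow> rle (elts M) (rex (elts N) f (F \<phi>)) (F \<psi>)"
      using req_le L p req_refl F_pred by blast
    also have "\<dots> \<longleftrightarrow> rle (elts N) (F \<phi>) (\<lambda>n. F \<psi> (f n))" by (rule rle_rex[OF f])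
    also have "\<dots> \<longleftrightarrow> rle (elts N) (F \<phi>) (F (pull N M f \<psi>))"
      using req_le[OF req_refl[OF F_pred[OF p(1)]] F_pull[OF f p(2)]] by blast
    also have "\<dots> \<longleftrightarrow> \<phi> \<preceq> pull N M f \<psi>" using F_le[OF p(1) pull_fiber[OF f p(2)]] by blast
    finally show ?thesis .
  qed
  thus "left_adjoint X (smap N M f) L" using L by (simp add: left_adjoint_def)
qed

lemma right_adjoint_ex:
  assumes f: "f \<in> elts N \<rightarrow> elts M" shows "\<exists>L. right_adjoint X (smap N M f) L"
proof
  define L where "L \<phi> = (SOME \<psi>. \<psi> \<in> fiber X M \<and> req M (F \<psi>) (rall (elts N) f (F \<phi>)))" for \<phi>
  have L: "L \<phi> \<in> fiber X M \<and> req M (F (L \<phi>)) (rall (elts N) f (F \<phi>))" if "\<phi> \<in> fiber X N" for \<phi>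
  proof -
    have "pred (elts M) (rall (elts N) f (F \<phi>))" by blast
    hence "\<exists>\<psi>. \<psi> \<in> fiber X M \<and> req M (F \<psi>) (rall (elts N) f (F \<phi>))" using F_surjE by metis
    from someI_ex[OF this] show ?thesis unfolding L_def .
  qed
  have "\<psi> \<preceq> L \<phi> \<longleftrightarrow> pull N M f \<psi> \<preceq> \<phi>" if p: "\<phi> \<in> fiber X N" "\<psi> \<in> fiber X M" for \<phi> \<psi>
  proof -
    have "\<psi> \<preceq> L \<phi> \<longleftrightarrow> rle (elts M) (F \<psi>) (F (L \<phi>))" using F_le L p by blast
    also have "\<dots> \<longleftrightarrow> rle (elts M) (F \<psi>) (rall (elts N) f (F \<phi>))"
      using req_le L p req_refl F_pred by blast
    also have "\<dots> \<longleftrightarrow> rle (elts N) (\<lambda>n. F \<psi> (f n)) (F \<phi>)" by (rule rle_rall[OF f F_pred[OF p(2)]])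
    also have "\<dots> \<longleftrightarrow> rle (elts N) (F (pull N M f \<psi>)) (F \<phi>)"
      using req_le[OF F_pull[OF f p(2)] req_refl[OF F_pred[OF p(1)]]] by blast
    also have "\<dots> \<longleftrightarrow> pull N M f \<psi> \<preceq> \<phi>" using F_le[OF pull_fiber[OF f p(2)] p(1)] by blast
    finally show ?thesis .
  qed
  thus "right_adjoint X (smap N M f) L" using L by (simp add: right_adjoint_def)
qed

lemma ex_along_adjoint: "f \<in> elts N \<rightarrow> elts M \<Longrightarrow> left_adjoint X (smap N M f) (ex_along X (smap N M f))"
  unfolding ex_along_def by (rule someI_ex[OF left_adjoint_ex])

lemma all_along_adjoint: "f \<in> elts N \<rightarrow> elts M \<Longrightarrow> right_adjoint X (smap N M f) (all_along X (smap N M f))"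
  unfolding all_along_def by (rule someI_ex[OF right_adjoint_ex])

text \<open>A Yoneda argument with a preimage of \<open>\<rho>\<close> as the test predicate. With
  its dual it computes the Hilbert choices \<open>ex_along\<close> and \<open>all_along\<close>
  under \<open>F\<close>.\<close>

lemma req_by_upper:
  assumes "\<chi> \<in> fiber X M" "pred (elts M) \<rho>"
    and "\<And>\<psi>. \<psi> \<in> fiber X M \<Longrightarrow> \<chi> \<preceq> \<psi> \<longleftrightarrow> rle (elts M) \<rho> (F \<psi>)"
  shows "req M (F \<chi>) \<rho>"
proof -
  obtain \<theta> where t: "\<theta> \<in> fiber X M" "req M (F \<theta>) \<rho>" using assms(2) by (rule F_surjE)
  have "\<chi> \<preceq> \<theta>" using assms(3)[OF t(1)] t(2) by (simp add: req_def)
  moreover have "rle (elts M) \<rho> (F \<chi>)" using assms(1,3) le_refl by blast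
  ultimately show ?thesis using t assms(2) F_le[OF assms(1) t(1)] F_pred[OF assms(1)] rle_trans
    unfolding req_def by blast
qed

lemma req_by_lower:
  assumes "\<chi> \<in> fiber X M" "pred (elts M) \<rho>"
    and "\<And>\<psi>. \<psi> \<in> fiber X M \<Longrightarrow> \<psi> \<preceq> \<chi> \<longleftrightarrow> rle (elts M) (F \<psi>) \<rho>"
  shows "req M (F \<chi>) \<rho>"
proof -
  obtain \<theta> where t: "\<theta> \<in> fiber X M" "req M (F \<theta>) \<rho>" using assms(2) by (rule F_surjE)
  have "\<theta> \<preceq> \<chi>" using assms(3)[OF t(1)] t(2) by (simp add: req_def)
  moreover have "rle (elts M) (F \<chi>) \<rho>" using assms(1,3) le_refl by blast
  ultimately show ?thesis using t assms(2) F_le[OF t(1) assms(1)] F_pred[OF assms(1)] rle_trans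
    unfolding req_def by blast
qed

lemma F_ex:
  assumes f: "f \<in> elts N \<rightarrow> elts M" and p: "\<phi> \<in> fiber X N"
  shows "ex_along X (smap N M f) \<phi> \<in> fiber X M"
    "req M (F (ex_along X (smap N M f) \<phi>)) (rex (elts N) f (F \<phi>))"
proof -
  note a = ex_along_adjoint[OF f, unfolded left_adjoint_def smap_sel]
  show 1: "ex_along X (smap N M f) \<phi> \<in> fiber X M" using a p by blast
  show "req M (F (ex_along X (smap N M f) \<phi>)) (rex (elts N) f (F \<phi>))"
  proof (rule req_by_upper[OF 1])
    show "pred (elts M) (rex (elts N) f (F \<phi>))" using F_pred[OF p] by blast
    fix \<psi> assume q: "\<psi> \<in> fiber X M"
    show "ex_along X (smap N M f) \<phi> \<preceq> \<psi> \<longleftrightarrow> rle (elts M) (rex (elts N) f (F \<phi>)) (F \<psi>)"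
      using a p q rle_rex[OF f] F_le[OF p pull_fiber[OF f q]]
        req_le[OF req_refl[OF F_pred[OF p]] F_pull[OF f q]] by blast
  qed
qed

lemma F_all:
  assumes f: "f \<in> elts N \<rightarrow> elts M" and p: "\<phi> \<in> fiber X N"
  shows "all_along X (smap N M f) \<phi> \<in> fiber X M"
    "req M (F (all_along X (smap N M f) \<phi>)) (rall (elts N) f (F \<phi>))"
proof -
  note a = all_along_adjoint[OF f, unfolded right_adjoint_def smap_sel]
  show 1: "all_along X (smap N M f) \<phi> \<in> fiber X M" using a p by blast
  show "req M (F (all_along X (smap N M f) \<phi>)) (rall (elts N) f (F \<phi>))"
  proof (rule req_by_lower[OF 1])
    show "pred (elts M) (rall (elts N) f (F \<phi>))" by blast
    fix \<psi> assume q: "\<psi> \<in> fiber X M"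
    show "\<psi> \<preceq> all_along X (smap N M f) \<phi> \<longleftrightarrow> rle (elts M) (F \<psi>) (rall (elts N) f (F \<phi>))"
      using a p q rle_rall[OF f F_pred[OF q]] F_le[OF pull_fiber[OF f q] p]
        req_le[OF F_pull[OF f q] req_refl[OF F_pred[OF p]]] by blast
  qed
qed

lemma req_rex: "u \<in> elts N \<rightarrow> elts M \<Longrightarrow> req N \<rho> \<sigma> \<Longrightarrow> req M (rex (elts N) u \<rho>) (rex (elts N) u \<sigma>)"
proof -
  have "rle (elts M) (rex (elts N) u \<rho>) (rex (elts N) u \<sigma>)" if "u \<in> elts N \<rightarrow> elts M" "rle (elts N) \<rho> \<sigma>" for \<rho> \<sigma>
    using that(2) unfolding rle_def rex_def by fastforce
  thus "u \<in> elts N \<rightarrow> elts M \<Longrightarrow> req N \<rho> \<sigma> \<Longrightarrow> ?thesis" by (auto simp: req_def)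
qed

text \<open>Monotonicity is read off from the adjunction, which spares writing a realizer.\<close>

lemma req_rall: "u \<in> elts N \<rightarrow> elts M \<Longrightarrow> req N \<rho> \<sigma> \<Longrightarrow> req M (rall (elts N) u \<rho>) (rall (elts N) u \<sigma>)"
proof -
  have "rle (elts M) (rall (elts N) u \<rho>) (rall (elts N) u \<sigma>)"
    if u: "u \<in> elts N \<rightarrow> elts M" and r: "req N \<rho> \<sigma>" for \<rho> \<sigma>
  proof -
    have "rle (elts N) (\<lambda>n. rall (elts N) u \<rho> (u n)) \<rho>"
      using rle_rall[OF u pred_rall] rle_refl[OF pred_rall] by blast
    hence "rle (elts N) (\<lambda>n. rall (elts N) u \<rho> (u n)) \<sigma>"
      using rle_trans r pred_comp[OF pred_rall u] unfolding req_def by blast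
    thus ?thesis using rle_rall[OF u pred_rall] by blast
  qed
  thus "u \<in> elts N \<rightarrow> elts M \<Longrightarrow> req N \<rho> \<sigma> \<Longrightarrow> ?thesis" using req_sym by (auto simp: req_def[of M])
qed

text \<open>For \<open>rex\<close> Beck-Chevalley is an equality: a pullback square matches the
  points of P over k with the points of J over the image of k, so both unions range over the same
  values.\<close>

lemma models_ex_X: "models_ex X"
  unfolding models_ex_def
proof (intro conjI allI ballI impI)
  fix u :: "'u set_map" assume "u \<in> Arr SET"
  hence "u \<in> Hom SET (sdom u) (scod u)" by (simp add: Hom_def)
  thus "\<exists>L. left_adjoint X u L" using left_adjoint_ex by (metis hom_smapE)
next
  fix p q u v \<phi> assume pb: "is_pullback SET p q u v" and \<phi>: "\<phi> \<in> fiber X (sdom u)"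
  from pb obtain P J K I p' q' u' v' where
    [simp]: "p = smap P J p'" "q = smap P K q'" "u = smap J I u'" "v = smap K I v'" and
    f: "p' \<in> elts P \<rightarrow> elts J" "q' \<in> elts P \<rightarrow> elts K" "u' \<in> elts J \<rightarrow> elts I" "v' \<in> elts K \<rightarrow> elts I" and
    c: "\<And>x. x \<in> elts P \<Longrightarrow> u' (p' x) = v' (q' x)" and
    e: "\<And>j k. j \<in> elts J \<Longrightarrow> k \<in> elts K \<Longrightarrow> u' j = v' k \<Longrightarrow> \<exists>x\<in>elts P. p' x = j \<and> q' x = k"
    by (rule is_pullbackD) blast
  have \<phi>: "\<phi> \<in> fiber X J" using \<phi> by simp
  note 1 = F_ex[OF f(2) pull_fiber[OF f(1) \<phi>]] and 2 = F_ex[OF f(3) \<phi>]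
  have "req K (F (ex_along X q (reindex X p \<phi>))) (rex (elts P) q' (F (pull P J p' \<phi>)))" using 1 by simp
  also have "req K \<dots> (rex (elts P) q' (\<lambda>x. F \<phi> (p' x)))" by (rule req_rex[OF f(2) F_pull[OF f(1) \<phi>]])
  also have "req K \<dots> (\<lambda>k. rex (elts J) u' (F \<phi>) (v' k))"
  proof (rule req_cong[OF req_refl])
    show "pred (elts K) (rex (elts P) q' (\<lambda>x. F \<phi> (p' x)))"
      using pred_comp[OF F_pred[OF \<phi>] f(1)] by blast
    show "rex (elts P) q' (\<lambda>x. F \<phi> (p' x)) k = rex (elts J) u' (F \<phi>) (v' k)" if "k \<in> elts K" for k
      unfolding rex_def using e[OF _ that] c f(1) by fastforce
  qed simp
  also have "req K \<dots> (\<lambda>k. F (ex_along X u \<phi>) (v' k))" using req_sym[OF req_comp[OF 2(2) f(4)]] by simp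
  also have "req K \<dots> (F (reindex X v (ex_along X u \<phi>)))"
    using req_sym[OF F_pull[OF f(4)]] 2(1) by simp
  finally have r: "req K (F (ex_along X q (reindex X p \<phi>))) (F (reindex X v (ex_along X u \<phi>)))" .
  have "ex_along X q (reindex X p \<phi>) \<in> fiber X K" "reindex X v (ex_along X u \<phi>) \<in> fiber X K"
    using 1(1) pull_fiber[OF f(4) 2(1)] by simp_all
  from F_iso[OF this] r show "ex_along X q (reindex X p \<phi>) \<cong> reindex X v (ex_along X u \<phi>)" by blast
qed

lemma models_all_X: "models_all X"
  unfolding models_all_def
proof (intro conjI allI ballI impI)
  fix u :: "'u set_map" assume "u \<in> Arr SET"
  hence "u \<in> Hom SET (sdom u) (scod u)" by (simp add: Hom_def)
  thus "\<exists>L. right_adjoint X u L" using right_adjoint_ex by (metis hom_smapE)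
next
  fix p q u v \<phi> assume pb: "is_pullback SET p q u v" and \<phi>: "\<phi> \<in> fiber X (sdom u)"
  from pb obtain P J K I p' q' u' v' where
    [simp]: "p = smap P J p'" "q = smap P K q'" "u = smap J I u'" "v = smap K I v'" and
    f: "p' \<in> elts P \<rightarrow> elts J" "q' \<in> elts P \<rightarrow> elts K" "u' \<in> elts J \<rightarrow> elts I" "v' \<in> elts K \<rightarrow> elts I" and
    c: "\<And>x. x \<in> elts P \<Longrightarrow> u' (p' x) = v' (q' x)" and
    e: "\<And>j k. j \<in> elts J \<Longrightarrow> k \<in> elts K \<Longrightarrow> u' j = v' k \<Longrightarrow> \<exists>x\<in>elts P. p' x = j \<and> q' x = k"
    by (rule is_pullbackD) blast
  have \<phi>: "\<phi> \<in> fiber X J" using \<phi> by simp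
  note 1 = F_all[OF f(2) pull_fiber[OF f(1) \<phi>]] and 2 = F_all[OF f(3) \<phi>]
  have "req K (F (all_along X q (reindex X p \<phi>))) (rall (elts P) q' (F (pull P J p' \<phi>)))" using 1 by simp
  also have "req K \<dots> (rall (elts P) q' (\<lambda>x. F \<phi> (p' x)))" by (rule req_rall[OF f(2) F_pull[OF f(1) \<phi>]])
  also have "req K \<dots> (\<lambda>k. rall (elts J) u' (F \<phi>) (v' k))"
  proof (rule req_cong[OF req_refl])
    show "pred (elts K) (rall (elts P) q' (\<lambda>x. F \<phi> (p' x)))" by blast
    show "rall (elts P) q' (\<lambda>x. F \<phi> (p' x)) k = rall (elts J) u' (F \<phi>) (v' k)" if k: "k \<in> elts K" for k
    proof -
      \<comment> \<open>The same matching of points, now as an equivalence of bounded quantifiers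
        for an arbitrary property \<open>Q\<close>.\<close>
      have "(\<forall>x\<in>elts P. q' x = k \<longrightarrow> Q (p' x)) \<longleftrightarrow> (\<forall>j\<in>elts J. u' j = v' k \<longrightarrow> Q j)" for Q
        using e[OF _ k] c f(1) by (metis PiE)
      from this[of "\<lambda>n. \<forall>b\<in>elts C. \<exists>d. app c b = Some d \<and> d \<in> F \<phi> n" for c]
      show ?thesis unfolding rall_def by simp
    qed
  qed simp
  also have "req K \<dots> (\<lambda>k. F (all_along X u \<phi>) (v' k))" using req_sym[OF req_comp[OF 2(2) f(4)]] by simp
  also have "req K \<dots> (F (reindex X v (all_along X u \<phi>)))"
    using req_sym[OF F_pull[OF f(4)]] 2(1) by simp
  finally have r: "req K (F (all_along X q (reindex X p \<phi>))) (F (reindex X v (all_along X u \<phi>)))" .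
  have "all_along X q (reindex X p \<phi>) \<in> fiber X K" "reindex X v (all_along X u \<phi>) \<in> fiber X K"
    using 1(1) pull_fiber[OF f(4) 2(1)] by simp_all
  from F_iso[OF this] r show "all_along X q (reindex X p \<phi>) \<cong> reindex X v (all_along X u \<phi>)" by blast
qed

end

section \<open>The generic predicate c -> {c} as a modest prime generator\<close>

context rr_model
begin

lemma F_le_pull: "\<theta> \<in> fiber X M \<Longrightarrow> f \<in> elts M \<rightarrow> elts N \<Longrightarrow> \<phi> \<in> fiber X N \<Longrightarrow>
    \<theta> \<preceq> pull M N f \<phi> \<longleftrightarrow> rle (elts M) (F \<theta>) (\<lambda>m. F \<phi> (f m))"
  using F_le[OF _ pull_fiber] req_le[OF req_refl[OF F_pred] F_pull] by blast

context
  fixes \<pi> :: 'o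
  assumes \<pi>_fiber: "\<pi> \<in> fiber X C" and \<pi>_req: "req C (F \<pi>) (\<lambda>c. {c})"
begin

lemma F_pull_generic: "f \<in> elts M \<rightarrow> elts C \<Longrightarrow> req M (F (pull M C f \<pi>)) (\<lambda>m. {f m})"
  using req_trans[OF F_pull[OF _ \<pi>_fiber] req_comp[OF \<pi>_req]] by blast

definition "gen_index = code {C}"

lemma elts_gen_index [simp]: "elts gen_index = {C}"
  by (simp add: gen_index_def)

abbreviation "gen \<equiv> generated gen_index (\<lambda>_. C) (\<lambda>_. \<pi>)"

text \<open>Singletons make realizers behave as functions: over each point a generated predicate
  offers, up to equivalence, just one element to apply them to.\<close>

lemma gen_iff:
  assumes "\<phi> \<in> fiber X M"
  shows "\<phi> \<in> gen \<longleftrightarrow> (\<exists>f\<in>elts M \<rightarrow> elts C. req M (F \<phi>) (\<lambda>m. {f m}))"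
proof -
  have "\<phi> \<cong> pull M C f \<pi> \<longleftrightarrow> req M (F \<phi>) (\<lambda>m. {f m})" if f: "f \<in> elts M \<rightarrow> elts C" for f
    using F_iso[OF assms pull_fiber[OF f \<pi>_fiber]] F_pull_generic[OF f] req_trans req_sym by blast
  thus ?thesis using generated_iff[of gen_index "\<lambda>_. \<pi>" "\<lambda>_. C" \<phi> M] assms \<pi>_fiber by auto
qed

text \<open>A realizer of the hypothesis sends the single element \<open>f j\<close> into some
  \<open>F \<theta> n\<close> with \<open>n\<close> over \<open>j\<close>. Choosing such an
  \<open>n\<close> for every \<open>j\<close> gives a section of \<open>v\<close>, so the identity
  serves as the covering.\<close>

lemma ex_prime_generic: "ex_prime X \<pi>"
  unfolding ex_prime_def
proof (intro conjI allI ballI impI)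
  show "\<pi> \<in> Obj X" using \<pi>_fiber by (simp add: fiber_iff)
  fix J K u v \<theta>
  assume "u \<in> Hom SET J (pobj X \<pi>)" and v: "v \<in> Hom SET K J" and t: "\<theta> \<in> fiber X K"
    and a: "reindex X u \<pi> \<preceq> ex_along X v \<theta>"
  hence u: "u \<in> Hom SET J C" using \<pi>_fiber by (simp add: fiber_iff)
  obtain f where f: "u = smap J C f" "f \<in> elts J \<rightarrow> elts C" using u by (rule hom_smapE)
  obtain g where g: "v = smap K J g" "g \<in> elts K \<rightarrow> elts J" using v by (rule hom_smapE)
  note ex = F_ex[OF g(2) t]
  have "rle (elts J) (\<lambda>j. {f j}) (rex (elts K) g (F \<theta>))"
    using a F_le[OF pull_fiber[OF f(2) \<pi>_fiber] ex(1)] req_le[OF F_pull_generic[OF f(2)] ex(2)] f g by simp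
  then obtain e where e: "e \<in> B'" "\<forall>j\<in>elts J. \<exists>b. app e (f j) = Some b \<and> b \<in> rex (elts K) g (F \<theta>) j"
    by (auto simp: rle_def)
  hence "\<forall>j\<in>elts J. \<exists>n b. n \<in> elts K \<and> g n = j \<and> app e (f j) = Some b \<and> b \<in> F \<theta> n"
    by (fastforce simp: rex_def)
  then obtain w where w: "\<forall>j\<in>elts J. w j \<in> elts K \<and> g (w j) = j \<and> (\<exists>b. app e (f j) = Some b \<and> b \<in> F \<theta> (w j))"
    by metis
  have wf: "w \<in> elts J \<rightarrow> elts K" using w by auto
  have "rle (elts J) (\<lambda>j. {f j}) (\<lambda>j. F \<theta> (w j))" using w e(1) by (auto simp: rle_def)
  hence "pull J C f \<pi> \<preceq> pull J K w \<theta>"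
    using F_le_pull[OF pull_fiber[OF f(2) \<pi>_fiber] wf t]
      req_le[OF F_pull_generic[OF f(2)] req_refl[OF pred_comp[OF F_pred[OF t] wf]]] by blast
  moreover have "Comp SET v (smap J K w) = Id SET J"
    using wf w by (auto simp: g(1) Id_smap intro: smap_cong)
  moreover have "surjection (Id SET J)" using smap_arr[of "\<lambda>x. x" J J] by (auto simp: surjection_def Id_smap)
  ultimately show "\<exists>L. \<exists>e\<in>Hom SET L J. \<exists>w\<in>Hom SET L K. surjection e \<and> Comp SET v w = e \<and>
      reindex X (Comp SET u e) \<pi> \<preceq> reindex X w \<theta>"
    using wf comp_id(1)[OF u] f(1) by (intro exI[of _ J] bexI[of _ "Id SET J"] bexI[of _ "smap J K w"]) auto
qed

lemma generic_closed_under_finite_meets: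
  "closed_under_finite_meets X (generated_sub X gen_index (\<lambda>_. C) (\<lambda>_. \<pi>))"
  unfolding closed_under_finite_meets_def
proof (intro conjI allI impI)
  note O = generated_Obj[of gen_index "\<lambda>_. \<pi>" "\<lambda>_. C", OF \<pi>_fiber]
  {
    fix M \<tau> assume t: "is_top X M \<tau>"
    hence t': "\<tau> \<in> fiber X M" by (simp add: is_top_def)
    \<comment> \<open>Top is represented by a constant map; the value \<open>k\<close> is
      convenient, since the realizer \<open>kx k\<close> of the nontrivial inequality then lies in
      the sub-pca.\<close>
    have "req M (\<lambda>_. elts C) (\<lambda>_. {k})"
    proof -
      have "rle (elts M) (\<lambda>_. elts C) (\<lambda>_. {k})" by (rule rleI[of "kx k"]) (auto simp: kx_app k')
      moreover have "rle (elts M) (\<lambda>_. {k}) (\<lambda>_. elts C)" by (rule rle_top) (simp add: pred_def)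
      ultimately show ?thesis by (simp add: req_def pred_def)
    qed
    hence "req M (F \<tau>) (\<lambda>_. {k})" using t is_top_iff[OF t'] req_trans by blast
    thus "\<tau> \<in> Obj (generated_sub X gen_index (\<lambda>_. C) (\<lambda>_. \<pi>))"
      unfolding O gen_iff[OF t'] by (rule bexI[of _ "\<lambda>_. k"]) auto
  }
  fix M \<phi> \<psi> \<chi> assume p: "\<phi> \<in> Obj (generated_sub X gen_index (\<lambda>_. C) (\<lambda>_. \<pi>))"
    "\<psi> \<in> Obj (generated_sub X gen_index (\<lambda>_. C) (\<lambda>_. \<pi>))" and m: "is_meet X M \<phi> \<psi> \<chi>"
  hence f: "\<phi> \<in> fiber X M" "\<psi> \<in> fiber X M" "\<chi> \<in> fiber X M" by (auto simp: is_meet_def)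
  obtain g h where g: "g \<in> elts M \<rightarrow> elts C" "req M (F \<phi>) (\<lambda>m. {g m})"
    and h: "h \<in> elts M \<rightarrow> elts C" "req M (F \<psi>) (\<lambda>m. {h m})"
    using p[unfolded O] unfolding gen_iff[OF f(1)] gen_iff[OF f(2)] by blast
  have "req M (F \<chi>) (rmeet (\<lambda>m. {g m}) (\<lambda>m. {h m}))"
    using m is_meet_iff[OF f] req_trans req_rmeet[OF g(2) h(2)] by blast
  moreover have "rmeet (\<lambda>m. {g m}) (\<lambda>m. {h m}) = (\<lambda>m. {pr (g m) (h m)})" by (auto simp: rmeet_def)
  moreover have "(\<lambda>m. pr (g m) (h m)) \<in> elts M \<rightarrow> elts C" using g(1) h(1) by auto
  ultimately show "\<chi> \<in> Obj (generated_sub X gen_index (\<lambda>_. C) (\<lambda>_. \<pi>))"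
    unfolding O using gen_iff[OF f(3)] by auto
qed

text \<open>A realizer \<open>r\<close> of the hypothesis takes \<open>g (e' n)\<close> to
  \<open>f' n\<close>, so \<open>f'\<close> factors through \<open>e'\<close> by j -> r (g j).
  Surjectivity of \<open>e'\<close> makes r (g j) defined for every j.\<close>

lemma modest_generic: "modest (generated_sub X gen_index (\<lambda>_. C) (\<lambda>_. \<pi>)) \<pi>"
proof -
  have 0: "\<pi> \<in> gen" using gen_iff[OF \<pi>_fiber] \<pi>_req by (intro iffD2[OF gen_iff[OF \<pi>_fiber]] bexI[of _ "\<lambda>c. c"]) auto
  have pC: "pobj X \<pi> = C" "\<pi> \<in> Obj X" using \<pi>_fiber by (auto simp: fiber_iff)
  have "\<exists>h\<in>Hom SET J C. Comp SET h e = f \<and> \<phi> \<preceq> reindex X h \<pi>"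
    if e: "e \<in> Hom SET K J" and f: "f \<in> Hom SET K C" and p: "\<phi> \<in> fiber X J" "\<phi> \<in> gen"
      and s: "surjection e" and l: "reindex X e \<phi> \<preceq> reindex X f \<pi>" for J K e f \<phi>
  proof -
    obtain e' where e': "e = smap K J e'" "e' \<in> elts K \<rightarrow> elts J" using e by (rule hom_smapE)
    obtain f' where f': "f = smap K C f'" "f' \<in> elts K \<rightarrow> elts C" using f by (rule hom_smapE)
    obtain g where g: "g \<in> elts J \<rightarrow> elts C" "req J (F \<phi>) (\<lambda>m. {g m})"
      using p(2) unfolding gen_iff[OF p(1)] by blast
    have im: "e' ` elts K = elts J" using s by (simp add: surjection_def e'(1))
    have "req K (F (pull K J e' \<phi>)) (\<lambda>n. {g (e' n)})"
      using req_trans[OF F_pull[OF e'(2) p(1)] req_comp[OF g(2) e'(2)]] .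
    hence "rle (elts K) (\<lambda>n. {g (e' n)}) (\<lambda>n. {f' n})"
      using l F_le[OF pull_fiber[OF e'(2) p(1)] pull_fiber[OF f'(2) \<pi>_fiber]]
        req_le[OF _ F_pull_generic[OF f'(2)]] by (simp add: e'(1) f'(1))
    then obtain r where r: "r \<in> B'" "\<And>n. n \<in> elts K \<Longrightarrow> app r (g (e' n)) = Some (f' n)"
      by (auto simp: rle_def)
    define h where "h j = the (app r (g j))" for j
    have he: "h (e' n) = f' n" if "n \<in> elts K" for n using r(2)[OF that] by (simp add: h_def)
    have "h j \<in> elts C \<and> app r (g j) = Some (h j)" if "j \<in> elts J" for j
    proof -
      obtain n where "n \<in> elts K" "j = e' n" using im \<open>j \<in> elts J\<close> by blast
      thus ?thesis using he r(2) f'(2) by auto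
    qed
    hence hf: "h \<in> elts J \<rightarrow> elts C" and hr: "rle (elts J) (\<lambda>j. {g j}) (\<lambda>j. {h j})"
      using r(1) by (auto simp: rle_def)
    have "\<phi> \<preceq> pull J C h \<pi>"
      using hr F_le[OF p(1) pull_fiber[OF hf \<pi>_fiber]] req_le[OF g(2) F_pull_generic[OF hf]] by blast
    moreover have "Comp SET (smap J C h) e = f" using e'(2) he by (auto simp: e'(1) f'(1) intro: smap_cong)
    ultimately show ?thesis using smap_hom[OF hf] by blast
  qed
  thus ?thesis using generated_modest[where I = gen_index and \<pi> = "\<lambda>_. \<pi>" and A = "\<lambda>_. C" and \<mu> = \<pi>] \<pi>_fiber 0 pC by auto
qed

text \<open>A predicate is the existential quantification, along the projection of its graph, of the
  generic predicate on realizers. The graph is a set because its fibers are subsets of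
  \<open>elts C\<close>.\<close>

lemma generic_generates: "generates_under_ex (generated_sub X gen_index (\<lambda>_. C) (\<lambda>_. \<pi>)) X"
  unfolding generates_under_ex_def
proof (intro allI ballI)
  fix M \<phi> assume p: "\<phi> \<in> fiber X M"
  define N where "N = usigma M (F \<phi>)"
  have "small (F \<phi> m)" if "m \<in> elts M" for m
    by (rule small_subset[OF small_elts[of C]]) (use F_pred[OF p] that in \<open>auto simp: pred_def\<close>)
  hence N: "elts N = case_prod opair ` (SIGMA m:elts M. F \<phi> m)" unfolding N_def by (rule elts_usigma)
  have u: "ufst \<in> elts N \<rightarrow> elts M" and v: "usnd \<in> elts N \<rightarrow> elts C"
    using predD[OF F_pred[OF p]] by (auto simp: N)
  let ?\<psi> = "pull N C usnd \<pi>"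
  have f: "?\<psi> \<in> fiber X N" using pull_fiber[OF v \<pi>_fiber] .
  have "?\<psi> \<in> fiber (generated_sub X gen_index (\<lambda>_. C) (\<lambda>_. \<pi>)) N"
    using generated_fiber[where I = gen_index and \<pi> = "\<lambda>_. \<pi>" and A = "\<lambda>_. C"] \<pi>_fiber f gen_iff[OF f] F_pull_generic[OF v] v by auto
  moreover have "req M (F \<phi>) (F (ex_along X (smap N M ufst) ?\<psi>))"
  proof -
    have 1: "req M (F (ex_along X (smap N M ufst) ?\<psi>)) (rex (elts N) ufst (\<lambda>z. {usnd z}))"
      using req_trans[OF F_ex(2)[OF u f] req_rex[OF u F_pull_generic[OF v]]] .
    have "rex (elts N) ufst (\<lambda>z. {usnd z}) m = F \<phi> m" if "m \<in> elts M" for m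
      using that by (force simp: rex_def N)
    with req_cong[OF req_sym[OF 1]] show ?thesis by blast
  qed
  ultimately show "\<exists>N. \<exists>u\<in>Hom SET N M. \<exists>\<psi>\<in>fiber (generated_sub X gen_index (\<lambda>_. C) (\<lambda>_. \<pi>)) N.
      \<phi> \<cong> ex_along X u \<psi>"
    using F_iso[OF p F_ex(1)[OF u f]] smap_hom[OF u] by blast
qed

end

lemma modest_prime_generators_X:
  "\<exists>I A \<pi>. modest_prime_generators X I A \<pi> \<and> (\<exists>i. elts I = {i})"
proof -
  have "pred (elts C) (\<lambda>c. {c})" by (simp add: pred_def)
  then obtain \<pi> where p: "\<pi> \<in> fiber X C" "req C (F \<pi>) (\<lambda>c. {c})" by (rule F_surjE)
  have "modest_prime_generators X gen_index (\<lambda>_. C) (\<lambda>_. \<pi>)"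
    unfolding modest_prime_generators_def
    using p ex_prime_generic[OF p] generic_closed_under_finite_meets[OF p] modest_generic[OF p]
      generic_generates[OF p] by blast
  thus ?thesis using elts_gen_index[OF p] by blast
qed

end

lemma fibered_equivalent_rr_models:
  fixes X :: "('o, 'a, 'u::set_universe) over_set" and C :: 'u
  assumes X: "posetal_fibration X" and incl: "pca_inclusion B' (elts C) app"
    and eq: "fibered_equivalent X (rr_tripos B' (elts C) app)"
  shows "models_top X \<and> models_and X \<and> models_imp X \<and> models_ex X \<and> models_all X \<and>
    (\<exists>I A \<pi>. modest_prime_generators X I A \<pi> \<and> (\<exists>i. elts I = {i}))"
proof -
  obtain k s where "pca_incl (elts C) B' app k s" using incl by (rule pca_inclusionE)
  then interpret P: pca_incl "elts C" B' app k s .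
  obtain G where G: "reflecting X P.R G" using fibered_equivalentE[OF X P.rr_posetal eq] .
  have obj: "G \<phi> = (M, snd (G \<phi>)) \<and> snd (G \<phi>) \<in> elts M \<rightarrow>\<^sub>E Pow (elts C)" if "\<phi> \<in> fiber X M" for \<phi> M
  proof -
    have "G \<phi> \<in> Obj P.R" "pobj P.R (G \<phi>) = M"
      using G that by (simp_all add: reflecting_def fiber_iff)
    thus ?thesis by (cases "G \<phi>") (simp add: rr_Obj rr_pobj)
  qed
  interpret posetal X by unfold_locales fact
  interpret R: posetal P.R by unfold_locales (rule P.rr_posetal)
  have 1: "reaches X \<phi> u \<psi> \<longleftrightarrow> P.rle (elts M) (snd (G \<phi>)) (\<lambda>m. snd (G \<psi>) (sfun u m))"
    if "\<phi> \<in> fiber X M" "\<psi> \<in> fiber X N" "u \<in> Hom SET M N" for \<phi> M \<psi> N u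
  proof -
    have "reaches X \<phi> u \<psi> \<longleftrightarrow> reaches P.R (G \<phi>) u (G \<psi>)"
      using G that by (simp add: reflecting_def fiber_iff)
    also have "\<dots> \<longleftrightarrow> reaches P.R (M, snd (G \<phi>)) u (N, snd (G \<psi>))"
      using obj[OF that(1)] obj[OF that(2)] by metis
    finally show ?thesis unfolding P.rr_reaches_iff using obj[OF that(1)] obj[OF that(2)] that(3) by blast
  qed
  have 2: "\<exists>\<phi>\<in>fiber X M. P.rle (elts M) (snd (G \<phi>)) \<rho> \<and> P.rle (elts M) \<rho> (snd (G \<phi>))"
    if "P.pred (elts M) \<rho>" for M \<rho>
  proof -
    \<comment> \<open>Objects of the tripos are extensional functions, whereas \<open>pred\<close>
      constrains values on \<open>elts M\<close> only.\<close>
    let ?\<rho> = "restrict \<rho> (elts M)"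
    have o: "(M, ?\<rho>) \<in> Obj P.R" using that by (auto simp: rr_Obj P.pred_def)
    then obtain \<phi> where f: "\<phi> \<in> Obj X" "fib_iso P.R (G \<phi>) (M, ?\<rho>)" using G by (auto simp: reflecting_def)
    have "pobj X \<phi> = M" using G f(1) R.iso_pobj[OF f(2)] by (simp add: reflecting_def rr_pobj)
    hence p: "\<phi> \<in> fiber X M" using f(1) by (simp add: fiber_iff)
    obtain \<sigma> where s: "G \<phi> = (M, \<sigma>)" using obj[OF p] by blast
    have r: "P.rle (elts M) \<sigma> (\<lambda>m. ?\<rho> (sfun (Id SET M) m))" "P.rle (elts M) ?\<rho> (\<lambda>m. \<sigma> (sfun (Id SET M) m))"
      using f(2) unfolding fib_iso_def fib_le_reaches s by (simp_all add: rr_pobj P.rr_reaches_iff)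
    have "P.rle (elts M) \<sigma> (\<lambda>m. ?\<rho> (sfun (Id SET M) m)) \<longleftrightarrow> P.rle (elts M) \<sigma> \<rho>"
      "P.rle (elts M) ?\<rho> (\<lambda>m. \<sigma> (sfun (Id SET M) m)) \<longleftrightarrow> P.rle (elts M) \<rho> \<sigma>"
      by (rule P.rle_cong; simp add: Id_smap)+
    with r s p show ?thesis by (intro bexI[of _ \<phi>]) simp_all
  qed
  interpret rr_model X C B' app k s "\<lambda>\<phi>. snd (G \<phi>)"
    using obj 1 2 by unfold_locales (auto simp: P.pred_def)
  show ?thesis using models_top_X models_and_X models_imp_X models_ex_X models_all_X
      modest_prime_generators_X by blast
qed

section \<open>Pre-stacks with a modest prime generator\<close>

definition pb :: "'u::set_universe \<Rightarrow> 'u \<Rightarrow> ('u \<Rightarrow> 'u) \<Rightarrow> ('u \<Rightarrow> 'u) \<Rightarrow> 'u" where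
  "pb J K u v = usigma J (\<lambda>j. {k \<in> elts K. u j = v k})"

lemma elts_pb: "elts (pb J K u v) = {opair j k | j k. j \<in> elts J \<and> k \<in> elts K \<and> u j = v k}"
proof -
  have "elts (pb J K u v) = case_prod opair ` (SIGMA j:elts J. {k \<in> elts K. u j = v k})"
    unfolding pb_def by (rule elts_usigma) (rule small_subset[OF small_elts[of K]], auto)
  thus ?thesis by auto
qed

lemma is_pullback_pb:
  assumes "u \<in> elts J \<rightarrow> elts I" "v \<in> elts K \<rightarrow> elts I"
  shows "is_pullback SET (smap (pb J K u v) J ufst) (smap (pb J K u v) K usnd) (smap J I u) (smap K I v)"
proof (rule is_pullbackI)
  fix j k assume "j \<in> elts J" "k \<in> elts K" "u j = v k"
  thus "\<exists>x\<in>elts (pb J K u v). ufst x = j \<and> usnd x = k"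
    by (intro bexI[of _ "opair j k"]) (auto simp: elts_pb)
qed (use assms in \<open>auto simp: elts_pb\<close>)

lemma pb_maps: "ufst \<in> elts (pb J K u v) \<rightarrow> elts J" "usnd \<in> elts (pb J K u v) \<rightarrow> elts K"
  by (auto simp: elts_pb)

locale modest_prime = posetal X for X :: "('o, 'a, 'u::set_universe) over_set" +
  fixes I :: 'u and A' :: "'u \<Rightarrow> 'u" and \<pi>' :: "'u \<Rightarrow> 'o" and i :: 'u
  assumes models: "models_top X" "models_and X" "models_imp X" "models_ex X" "models_all X"
    and generators: "modest_prime_generators X I A' \<pi>'" and elts_I: "elts I = {i}"
begin

definition "A = A' i"
definition "\<pi> = \<pi>' i"

abbreviation "ex N M f \<equiv> ex_along X (smap N M f)"
abbreviation "al N M f \<equiv> all_along X (smap N M f)"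

lemma ex_adjoint:
  assumes f: "f \<in> elts N \<rightarrow> elts M" and p: "\<phi> \<in> fiber X N"
  shows "ex N M f \<phi> \<in> fiber X M" "\<psi> \<in> fiber X M \<Longrightarrow> ex N M f \<phi> \<preceq> \<psi> \<longleftrightarrow> \<phi> \<preceq> pull N M f \<psi>"
proof -
  have "\<exists>L. left_adjoint X (smap N M f) L"
    using models(4) smap_arr[OF f] unfolding models_ex_def by blast
  hence "left_adjoint X (smap N M f) (ex N M f)" unfolding ex_along_def by (rule someI_ex)
  thus "ex N M f \<phi> \<in> fiber X M" "\<psi> \<in> fiber X M \<Longrightarrow> ex N M f \<phi> \<preceq> \<psi> \<longleftrightarrow> \<phi> \<preceq> pull N M f \<psi>"
    using p unfolding left_adjoint_def smap_sel by blast+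
qed

lemma al_adjoint:
  assumes f: "f \<in> elts N \<rightarrow> elts M" and p: "\<phi> \<in> fiber X N"
  shows "al N M f \<phi> \<in> fiber X M" "\<psi> \<in> fiber X M \<Longrightarrow> \<psi> \<preceq> al N M f \<phi> \<longleftrightarrow> pull N M f \<psi> \<preceq> \<phi>"
proof -
  have "\<exists>L. right_adjoint X (smap N M f) L"
    using models(5) smap_arr[OF f] unfolding models_all_def by blast
  hence "right_adjoint X (smap N M f) (al N M f)" unfolding all_along_def by (rule someI_ex)
  thus "al N M f \<phi> \<in> fiber X M" "\<psi> \<in> fiber X M \<Longrightarrow> \<psi> \<preceq> al N M f \<phi> \<longleftrightarrow> pull N M f \<psi> \<preceq> \<phi>"
    using p unfolding right_adjoint_def smap_sel by blast+
qed

lemma ex_unit: "f \<in> elts N \<rightarrow> elts M \<Longrightarrow> \<phi> \<in> fiber X N \<Longrightarrow> \<phi> \<preceq> pull N M f (ex N M f \<phi>)"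
  using ex_adjoint le_refl by blast

lemma al_counit: "f \<in> elts N \<rightarrow> elts M \<Longrightarrow> \<phi> \<in> fiber X N \<Longrightarrow> pull N M f (al N M f \<phi>) \<preceq> \<phi>"
  using al_adjoint le_refl by blast

lemma ex_Beck_Chevalley:
  assumes u: "u \<in> elts J \<rightarrow> elts L" and v: "v \<in> elts K \<rightarrow> elts L" and p: "\<phi> \<in> fiber X J"
  shows "pull K L v (ex J L u \<phi>) \<preceq> ex (pb J K u v) K usnd (pull (pb J K u v) J ufst \<phi>)"
  using models(4) is_pullback_pb[OF u v] p unfolding models_ex_def fib_iso_def by (metis smap_sel(1))

lemma al_Beck_Chevalley:
  assumes u: "u \<in> elts J \<rightarrow> elts L" and v: "v \<in> elts K \<rightarrow> elts L" and p: "\<phi> \<in> fiber X J"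
  shows "al (pb J K u v) K usnd (pull (pb J K u v) J ufst \<phi>) \<preceq> pull K L v (al J L u \<phi>)"
  using models(5) is_pullback_pb[OF u v] p unfolding models_all_def fib_iso_def by (metis smap_sel(1))

lemma \<pi>_fiber: "\<pi> \<in> fiber X A"
  using generators elts_I by (simp add: modest_prime_generators_def A_def \<pi>_def)

lemma generators_fiber: "j \<in> elts I \<Longrightarrow> \<pi>' j \<in> fiber X (A' j)"
  using generators by (simp add: modest_prime_generators_def)

lemma generators_sub_Obj: "Obj (generated_sub X I A' \<pi>') = generated I A' \<pi>'"
  by (rule generated_Obj[OF generators_fiber])

text \<open>\<open>pf M f\<close> is the predicate \<open>f\<^sup>*\<pi>\<close>, and \<open>lef\<close> the fiberwise preorder on the representing maps \<open>f\<close>.\<close>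

definition pf :: "'u \<Rightarrow> ('u \<Rightarrow> 'u) \<Rightarrow> 'o" where
  "pf M f = pull M A f \<pi>"

definition lef :: "'u \<Rightarrow> ('u \<Rightarrow> 'u) \<Rightarrow> ('u \<Rightarrow> 'u) \<Rightarrow> bool" where
  "lef M f g \<longleftrightarrow> pf M f \<preceq> pf M g"

lemma pf_fiber [simp, intro]: "f \<in> elts M \<rightarrow> elts A \<Longrightarrow> pf M f \<in> fiber X M"
  unfolding pf_def by (rule pull_fiber[OF _ \<pi>_fiber])

lemma pf_cong: "(\<And>m. m \<in> elts M \<Longrightarrow> f m = g m) \<Longrightarrow> pf M f = pf M g"
  unfolding pf_def using smap_cong by metis

lemma pull_pf:
  assumes "h \<in> elts K \<rightarrow> elts M" "f \<in> elts M \<rightarrow> elts A"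
  shows "pull K M h (pf M f) \<preceq> pf K (\<lambda>x. f (h x))" "pf K (\<lambda>x. f (h x)) \<preceq> pull K M h (pf M f)"
  unfolding pf_def using pull_pull[OF assms \<pi>_fiber] by auto

lemma pf_le_pull:
  assumes "h \<in> elts K \<rightarrow> elts M" "f \<in> elts M \<rightarrow> elts A" "\<phi> \<in> fiber X M" "pf M f \<preceq> \<phi>"
  shows "pf K (\<lambda>x. f (h x)) \<preceq> pull K M h \<phi>"
  using le_trans[OF pull_pf(2)[OF assms(1,2)] pull_mono[OF assms(1,4,3)]] .

lemma lef_comp:
  assumes "lef M f g" "h \<in> elts K \<rightarrow> elts M" "f \<in> elts M \<rightarrow> elts A" "g \<in> elts M \<rightarrow> elts A"
  shows "lef K (\<lambda>x. f (h x)) (\<lambda>x. g (h x))"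
  using le_trans[OF pf_le_pull[OF assms(2,3) pf_fiber[OF assms(4)] assms(1)[unfolded lef_def]] pull_pf(1)[OF assms(2,4)]]
  unfolding lef_def .

lemma lef_refl: "f \<in> elts M \<rightarrow> elts A \<Longrightarrow> lef M f f"
  unfolding lef_def by (rule le_refl[OF pf_fiber])

lemma lef_trans [trans]: "lef M f g \<Longrightarrow> lef M g h \<Longrightarrow> lef M f h"
  unfolding lef_def by (rule le_trans)

lemma lef_cong: "(\<And>m. m \<in> elts M \<Longrightarrow> f m = f' m) \<Longrightarrow> (\<And>m. m \<in> elts M \<Longrightarrow> g m = g' m) \<Longrightarrow>
    lef M f g \<longleftrightarrow> lef M f' g'"
  unfolding lef_def using pf_cong by metis

section \<open>Modesty, primeness and generation in terms of representing maps\<close>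

lemma generated_pf_iff:
  "\<phi> \<in> fiber X M \<Longrightarrow> \<phi> \<in> generated I A' \<pi>' \<longleftrightarrow> (\<exists>f\<in>elts M \<rightarrow> elts A. \<phi> \<cong> pf M f)"
  using generated_iff[where I = I and A = A' and \<pi> = \<pi>', OF generators_fiber] elts_I
  by (simp add: A_def \<pi>_def pf_def)

lemma pf_generated: "f \<in> elts M \<rightarrow> elts A \<Longrightarrow> pf M f \<in> generated I A' \<pi>'"
  using generated_pf_iff[OF pf_fiber] le_refl[OF pf_fiber] unfolding fib_iso_def by blast

lemma generatedE:
  assumes "\<phi> \<in> generated I A' \<pi>'" "\<phi> \<in> fiber X M"
  obtains f where "f \<in> elts M \<rightarrow> elts A" "\<phi> \<cong> pf M f"
  using generated_pf_iff[OF assms(2)] assms(1) by blast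

text \<open>Modesty is applied to the surjection of \<open>M\<close> onto the image of
  \<open>f\<close>. The inclusion of this image into \<open>A\<close> represents a predicate that
  pulls back to the one given by \<open>f\<close>, hence below the one given by \<open>g\<close>; so
  \<open>g\<close> factors through \<open>f\<close>.\<close>

lemma single_valued:
  assumes l: "lef M f g" and f: "f \<in> elts M \<rightarrow> elts A" and g: "g \<in> elts M \<rightarrow> elts A"
    and m: "m \<in> elts M" "m' \<in> elts M" "f m = f m'"
  shows "g m = g m'"
proof -
  define J where "J = code (f ` elts M)"
  have J: "elts J = f ` elts M" unfolding J_def by (rule elts_code) (simp add: small_image)
  have e: "f \<in> elts M \<rightarrow> elts J" and j: "(\<lambda>x. x) \<in> elts J \<rightarrow> elts A" using f by (auto simp: J)
  have s: "surjection (smap M J f)" using smap_arr[OF e] by (simp add: surjection_def J)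
  have "modest (generated_sub X I A' \<pi>') \<pi>"
    using generators elts_I by (simp add: modest_prime_generators_def \<pi>_def)
  hence md: "\<exists>h\<in>Hom SET J (pobj X \<pi>). Comp SET h e = g \<and> \<phi> \<preceq> reindex X h \<pi>"
    if "e \<in> Hom SET K J" "g \<in> Hom SET K (pobj X \<pi>)" "\<phi> \<in> fiber X J" "\<phi> \<in> generated I A' \<pi>'"
      "surjection e" "reindex X e \<phi> \<preceq> reindex X g \<pi>" for J K e g \<phi>
    using that by (simp only: generated_modest[where I = I and A = A' and \<pi> = \<pi>', OF generators_fiber]) blast
  have "reindex X (smap M J f) (pf J (\<lambda>x. x)) \<preceq> reindex X (smap M A g) \<pi>"
    using le_trans[OF pull_pf(1)[OF e j]] l unfolding lef_def by (simp add: pf_def)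
  moreover have "pobj X \<pi> = A" using \<pi>_fiber by (simp add: fiber_iff)
  ultimately obtain h where h: "h \<in> Hom SET J A" "Comp SET h (smap M J f) = smap M A g"
    using md[OF smap_hom[OF e] _ pf_fiber[OF j] pf_generated[OF j] s] smap_hom[OF g] by metis
  obtain h' where h': "h = smap J A h'" "h' \<in> elts J \<rightarrow> elts A" using h(1) by (rule hom_smapE)
  have "smap M A (\<lambda>x. h' (f x)) = smap M A g" using h(2) e by (simp add: h'(1))
  from smap_eqD[OF this] m show ?thesis by metis
qed

text \<open>Primeness gives a lift through \<open>g\<close> over a covering of \<open>J\<close>.
  Composing with a section of the covering moves both the lift and the inequality back to
  \<open>J\<close>.\<close>

lemma prime_section:
  assumes f: "f \<in> elts J \<rightarrow> elts A" and g: "g \<in> elts K \<rightarrow> elts J" and t: "\<theta> \<in> fiber X K"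
    and l: "pf J f \<preceq> ex K J g \<theta>"
  obtains w where "w \<in> elts J \<rightarrow> elts K" "\<And>j. j \<in> elts J \<Longrightarrow> g (w j) = j" "pf J f \<preceq> pull J K w \<theta>"
proof -
  have "ex_prime X \<pi>" using generators elts_I by (simp add: modest_prime_generators_def \<pi>_def)
  moreover have "pobj X \<pi> = A" using \<pi>_fiber by (simp add: fiber_iff)
  ultimately obtain L e w where e: "e \<in> Hom SET L J" "surjection e" and w: "w \<in> Hom SET L K"
    and c: "Comp SET (smap K J g) w = e" and le: "reindex X (Comp SET (smap J A f) e) \<pi> \<preceq> reindex X w \<theta>"
    using smap_hom[OF f] smap_hom[OF g] t l unfolding ex_prime_def pf_def by metis
  obtain s where s: "s \<in> Hom SET J L" "Comp SET e s = Id SET J" using e by (rule surjection_split)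
  obtain e' where e': "e = smap L J e'" "e' \<in> elts L \<rightarrow> elts J" using e(1) by (rule hom_smapE)
  obtain w' where w': "w = smap L K w'" "w' \<in> elts L \<rightarrow> elts K" using w by (rule hom_smapE)
  obtain s' where s': "s = smap J L s'" "s' \<in> elts J \<rightarrow> elts L" using s(1) by (rule hom_smapE)
  have es: "e' (s' j) = j" if j: "j \<in> elts J" for j
  proof -
    have "smap J J (\<lambda>x. e' (s' x)) = smap J J (\<lambda>x. x)" using s(2) s'(2) by (simp add: e'(1) s'(1) Id_smap)
    from smap_eqD[OF this j] show ?thesis .
  qed
  have ge: "g (w' x) = e' x" if x: "x \<in> elts L" for x
  proof -
    have "smap L J (\<lambda>x. g (w' x)) = smap L J e'" using c w'(2) by (simp add: e'(1) w'(1))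
    from smap_eqD[OF this x] show ?thesis .
  qed
  have fe: "(\<lambda>x. f (e' x)) \<in> elts L \<rightarrow> elts A" using f e'(2) by auto
  have "pf L (\<lambda>x. f (e' x)) \<preceq> pull L K w' \<theta>" using le e'(2) by (simp add: pf_def e'(1) w'(1))
  from pf_le_pull[OF s'(2) fe pull_fiber[OF w'(2) t] this]
  have "pf J (\<lambda>x. f (e' (s' x))) \<preceq> pull J K (\<lambda>x. w' (s' x)) \<theta>"
    using le_trans pull_pull(1)[OF s'(2) w'(2) t] by blast
  moreover have "pf J (\<lambda>x. f (e' (s' x))) = pf J f" by (rule pf_cong) (simp add: es)
  moreover have "(\<lambda>x. w' (s' x)) \<in> elts J \<rightarrow> elts K" using s'(2) w'(2) by auto
  moreover have "g (w' (s' j)) = j" if "j \<in> elts J" for j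
    using ge[of "s' j"] es[OF that] s'(2) that by auto
  ultimately show thesis using that[of "\<lambda>x. w' (s' x)"] by metis
qed

lemma generateE:
  assumes "\<phi> \<in> fiber X M"
  obtains N u f where "u \<in> elts N \<rightarrow> elts M" "f \<in> elts N \<rightarrow> elts A" "\<phi> \<cong> ex N M u (pf N f)"
proof -
  obtain N v \<psi> where v: "v \<in> Hom SET N M" and p: "\<psi> \<in> fiber (generated_sub X I A' \<pi>') N"
    and i: "\<phi> \<cong> ex_along X v \<psi>"
    using generators assms unfolding modest_prime_generators_def generates_under_ex_def by blast
  obtain u where u: "v = smap N M u" "u \<in> elts N \<rightarrow> elts M" using v by (rule hom_smapE)
  have p': "\<psi> \<in> fiber X N" "\<psi> \<in> generated I A' \<pi>'"
    using p generated_fiber[where I = I and A = A' and \<pi> = \<pi>', OF generators_fiber] by auto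
  obtain f where f: "f \<in> elts N \<rightarrow> elts A" "\<psi> \<cong> pf N f" using p'(2,1) by (rule generatedE)
  note q = pf_fiber[OF f(1)]
  have "ex N M u \<psi> \<preceq> ex N M u (pf N f)"
    using ex_adjoint(2)[OF u(2) p'(1) ex_adjoint(1)[OF u(2) q]] ex_unit[OF u(2) q] f(2) le_trans
    unfolding fib_iso_def by blast
  moreover have "ex N M u (pf N f) \<preceq> ex N M u \<psi>"
    using ex_adjoint(2)[OF u(2) q ex_adjoint(1)[OF u(2) p'(1)]] ex_unit[OF u(2) p'(1)] f(2) le_trans
    unfolding fib_iso_def by blast
  ultimately have "\<phi> \<cong> ex N M u (pf N f)" using i le_trans unfolding fib_iso_def u(1) by blast
  with u(2) f(1) show thesis by (rule that)
qed

section \<open>Top, pairing and implication for representing maps\<close>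

lemma top_ex: "\<exists>t\<in>elts A. \<forall>M f. f \<in> elts M \<rightarrow> elts A \<longrightarrow> lef M f (\<lambda>_. t)"
proof -
  \<comment> \<open>Over a one-point set top is represented by one element of \<open>A\<close>;
    pulled back along the map to that set, this element represents top over every
    \<open>M\<close>.\<close>
  define T where "T = code {A}"
  have T: "elts T = {A}" by (simp add: T_def)
  obtain \<tau> where t: "is_top X T \<tau>" using models(1) unfolding models_top_def by blast
  hence tf: "\<tau> \<in> fiber X T" by (simp add: is_top_def)
  have "\<tau> \<in> generated I A' \<pi>'"
    using generators t unfolding modest_prime_generators_def closed_under_finite_meets_def generators_sub_Obj by blast
  then obtain h where h: "h \<in> elts T \<rightarrow> elts A" "\<tau> \<cong> pf T h" using tf by (rule generatedE)
  have hA: "h A \<in> elts A" using h(1) T by auto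
  have "lef M f (\<lambda>_. h A)" if f: "f \<in> elts M \<rightarrow> elts A" for M f
  proof -
    have c: "(\<lambda>_. A) \<in> elts M \<rightarrow> elts T" by (simp add: T)
    have "is_top X M (pull M T (\<lambda>_. A) \<tau>)"
      using models(1) smap_hom[OF c] t unfolding models_top_def by blast
    hence "pf M f \<preceq> pull M T (\<lambda>_. A) \<tau>" using pf_fiber[OF f] by (simp add: is_top_def)
    also have "\<dots> \<preceq> pull M T (\<lambda>_. A) (pf T h)"
      using pull_mono[OF c] h pf_fiber[OF h(1)] by (simp add: fib_iso_def)
    also have "\<dots> \<preceq> pf M (\<lambda>_. h A)" by (rule pull_pf(1)[OF c h(1)])
    finally show ?thesis by (simp add: lef_def)
  qed
  with hA show ?thesis by blast
qed

definition "top_elt = (SOME t. t \<in> elts A \<and> (\<forall>M f. f \<in> elts M \<rightarrow> elts A \<longrightarrow> lef M f (\<lambda>_. t)))"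

lemma top_elt_A [simp, intro]: "top_elt \<in> elts A" and lef_top_elt: "f \<in> elts M \<rightarrow> elts A \<Longrightarrow> lef M f (\<lambda>_. top_elt)"
proof -
  have "\<exists>t. t \<in> elts A \<and> (\<forall>M f. f \<in> elts M \<rightarrow> elts A \<longrightarrow> lef M f (\<lambda>_. t))" using top_ex by blast
  from someI_ex[OF this] show "top_elt \<in> elts A" "f \<in> elts M \<rightarrow> elts A \<Longrightarrow> lef M f (\<lambda>_. top_elt)"
    unfolding top_elt_def by blast+
qed

text \<open>The test predicate \<open>\<theta>\<close> is arbitrary, not just representable, so that
  \<open>meet\<close> yields genuine meets of \<open>X\<close>, as the definition of
  \<open>is_imp\<close> expects.\<close>

definition meet_map :: "('u \<Rightarrow> 'u \<Rightarrow> 'u) \<Rightarrow> bool" where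
  "meet_map h \<longleftrightarrow> (\<forall>a\<in>elts A. \<forall>b\<in>elts A. h a b \<in> elts A) \<and>
     (\<forall>M f g \<theta>. f \<in> elts M \<rightarrow> elts A \<longrightarrow> g \<in> elts M \<rightarrow> elts A \<longrightarrow> \<theta> \<in> fiber X M \<longrightarrow>
       (\<theta> \<preceq> pf M (\<lambda>m. h (f m) (g m)) \<longleftrightarrow> \<theta> \<preceq> pf M f \<and> \<theta> \<preceq> pf M g))"

text \<open>The meet of the two projections of A x A is generated, hence represented by a map; every
  other pair \<open>f\<close>, \<open>g\<close> is a pullback of this universal case.\<close>

lemma meet_map_ex: "\<exists>h. meet_map h"
proof -
  define P where "P = usigma A (\<lambda>_. elts A)"
  have P: "elts P = case_prod opair ` (elts A \<times> elts A)" unfolding P_def by (rule elts_usigma) simp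
  have fs: "ufst \<in> elts P \<rightarrow> elts A" "usnd \<in> elts P \<rightarrow> elts A" by (auto simp: P)
  obtain \<chi> where c: "is_meet X P (pf P ufst) (pf P usnd) \<chi>"
    using models(2) pf_fiber[OF fs(1)] pf_fiber[OF fs(2)] unfolding models_and_def by blast
  have "\<chi> \<in> generated I A' \<pi>'"
    using generators c pf_generated fs
    unfolding modest_prime_generators_def closed_under_finite_meets_def generators_sub_Obj by blast
  moreover have cf: "\<chi> \<in> fiber X P" using c by (simp add: is_meet_def)
  ultimately obtain h where h: "h \<in> elts P \<rightarrow> elts A" "\<chi> \<cong> pf P h" by (rule generatedE)
  have hA: "h (opair a b) \<in> elts A" if "a \<in> elts A" "b \<in> elts A" for a b using that h(1) by (auto simp: P)
  have "\<theta> \<preceq> pf M (\<lambda>m. h (opair (f m) (g m))) \<longleftrightarrow> \<theta> \<preceq> pf M f \<and> \<theta> \<preceq> pf M g"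
    if f: "f \<in> elts M \<rightarrow> elts A" and g: "g \<in> elts M \<rightarrow> elts A" and t: "\<theta> \<in> fiber X M" for M f g \<theta>
  proof -
    let ?k = "\<lambda>m. opair (f m) (g m)"
    have k: "?k \<in> elts M \<rightarrow> elts P" using f g by (auto simp: P)
    have "is_meet X M (pull M P ?k (pf P ufst)) (pull M P ?k (pf P usnd)) (pull M P ?k \<chi>)"
      using models(2) smap_hom[OF k] c unfolding models_and_def by blast
    hence 1: "\<theta> \<preceq> pull M P ?k \<chi> \<longleftrightarrow> \<theta> \<preceq> pull M P ?k (pf P ufst) \<and> \<theta> \<preceq> pull M P ?k (pf P usnd)"
      using t by (simp add: is_meet_def)
    have 2: "\<theta> \<preceq> pull M P ?k (pf P ufst) \<longleftrightarrow> \<theta> \<preceq> pf M f"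
      using pull_pf[OF k fs(1)] le_trans by auto
    have 3: "\<theta> \<preceq> pull M P ?k (pf P usnd) \<longleftrightarrow> \<theta> \<preceq> pf M g"
      using pull_pf[OF k fs(2)] le_trans by auto
    have "pull M P ?k \<chi> \<preceq> pull M P ?k (pf P h)" "pull M P ?k (pf P h) \<preceq> pull M P ?k \<chi>"
      using pull_mono[OF k] h pf_fiber[OF h(1)] cf by (auto simp: fib_iso_def)
    hence "\<theta> \<preceq> pull M P ?k \<chi> \<longleftrightarrow> \<theta> \<preceq> pf M (\<lambda>m. h (opair (f m) (g m)))"
      using pull_pf[OF k h(1)] le_trans by blast
    with 1 2 3 show ?thesis by blast
  qed
  with hA show ?thesis unfolding meet_map_def by (intro exI[of _ "\<lambda>a b. h (opair a b)"]) blast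
qed

definition "meet = (SOME h. meet_map h)"

lemma meet_A [simp, intro]: "a \<in> elts A \<Longrightarrow> b \<in> elts A \<Longrightarrow> meet a b \<in> elts A"
  and le_meet: "f \<in> elts M \<rightarrow> elts A \<Longrightarrow> g \<in> elts M \<rightarrow> elts A \<Longrightarrow> \<theta> \<in> fiber X M \<Longrightarrow>
     \<theta> \<preceq> pf M (\<lambda>m. meet (f m) (g m)) \<longleftrightarrow> \<theta> \<preceq> pf M f \<and> \<theta> \<preceq> pf M g"
  using someI_ex[OF meet_map_ex, folded meet_def] unfolding meet_map_def by blast+

lemma meet_fun [intro]: "f \<in> elts M \<rightarrow> elts A \<Longrightarrow> g \<in> elts M \<rightarrow> elts A \<Longrightarrow> (\<lambda>m. meet (f m) (g m)) \<in> elts M \<rightarrow> elts A"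
  by auto

lemma lef_meet:
  assumes "f \<in> elts M \<rightarrow> elts A" "g \<in> elts M \<rightarrow> elts A" "h \<in> elts M \<rightarrow> elts A"
  shows "lef M h (\<lambda>m. meet (f m) (g m)) \<longleftrightarrow> lef M h f \<and> lef M h g"
  unfolding lef_def by (rule le_meet[OF assms(1,2) pf_fiber[OF assms(3)]])

lemma lef_meet1: "f \<in> elts M \<rightarrow> elts A \<Longrightarrow> g \<in> elts M \<rightarrow> elts A \<Longrightarrow> lef M (\<lambda>m. meet (f m) (g m)) f"
  and lef_meet2: "f \<in> elts M \<rightarrow> elts A \<Longrightarrow> g \<in> elts M \<rightarrow> elts A \<Longrightarrow> lef M (\<lambda>m. meet (f m) (g m)) g"
  using lef_meet[OF _ _ meet_fun] lef_refl[OF meet_fun] by blast+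

text \<open>Stability under reindexing is built in, so that the implication can be tested by
  representable predicates over any family of points of \<open>M\<close>.\<close>

lemma impE:
  assumes g: "g \<in> elts M \<rightarrow> elts A" and p: "\<psi> \<in> fiber X M"
  obtains \<chi> where "\<chi> \<in> fiber X M"
    "\<And>K h f. h \<in> elts K \<rightarrow> elts M \<Longrightarrow> f \<in> elts K \<rightarrow> elts A \<Longrightarrow>
      pf K f \<preceq> pull K M h \<chi> \<longleftrightarrow> pf K (\<lambda>m. meet (f m) (g (h m))) \<preceq> pull K M h \<psi>"
proof -
  obtain \<chi> where c: "is_imp X M (pf M g) \<psi> \<chi>" using models(3) pf_fiber[OF g] p unfolding models_imp_def by blast
  hence cf: "\<chi> \<in> fiber X M" by (simp add: is_imp_def)
  have 1: "pf K f \<preceq> pull K M h \<chi> \<longleftrightarrow> pf K (\<lambda>m. meet (f m) (g (h m))) \<preceq> pull K M h \<psi>"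
    if h: "h \<in> elts K \<rightarrow> elts M" and f: "f \<in> elts K \<rightarrow> elts A" for K h f
  proof -
    have i: "is_imp X K (pull K M h (pf M g)) (pull K M h \<psi>) (pull K M h \<chi>)"
      using models(3) smap_hom[OF h] c unfolding models_imp_def by blast
    have gh: "(\<lambda>m. g (h m)) \<in> elts K \<rightarrow> elts A" using g h by auto
    have "\<theta> \<preceq> pf K (\<lambda>m. meet (f m) (g (h m))) \<longleftrightarrow> \<theta> \<preceq> pf K f \<and> \<theta> \<preceq> pull K M h (pf M g)"
      if "\<theta> \<in> fiber X K" for \<theta>
      using le_meet[OF f gh that] pull_pf[OF h g] le_trans by blast
    hence "is_meet X K (pf K f) (pull K M h (pf M g)) (pf K (\<lambda>m. meet (f m) (g (h m))))"
      unfolding is_meet_def using pf_fiber[OF f] pull_fiber[OF h pf_fiber[OF g]] pf_fiber[OF meet_fun[OF f gh]] by blast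
    thus ?thesis using i unfolding is_imp_def by blast
  qed
  show thesis by (rule that[OF cf 1])
qed

section \<open>Codes of partial functions and the application they define\<close>

text \<open>The predicate \<open>\<Omega>\<close> on relations \<open>S \<subseteq> A \<times> A\<close> given by
  \<open>\<Omega>(S) = \<forall>(b, d) \<in> S. \<pi>(b) \<Rightarrow> \<pi>(d)\<close> is of the form \<open>\<exists>\<^sub>u f\<^sup>*\<pi>\<close>. An element \<open>n\<close> with \<open>u n = S\<close> then
  makes \<open>f n\<close> a code for the partial map \<open>S\<close>, which yields the application of the pca.\<close>

definition codes :: "'u \<Rightarrow> ('u \<Rightarrow> 'u) \<Rightarrow> ('u \<Rightarrow> 'u) \<Rightarrow> bool" where
  "codes N u f \<longleftrightarrow>
     (\<forall>n\<in>elts N. \<forall>p\<in>elts (u n). \<exists>b\<in>elts A. \<exists>d\<in>elts A. p = opair b d) \<and> f \<in> elts N \<rightarrow> elts A \<and>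
     (\<forall>K x b d. x \<in> elts K \<rightarrow> elts N \<longrightarrow> b \<in> elts K \<rightarrow> elts A \<longrightarrow> d \<in> elts K \<rightarrow> elts A \<longrightarrow>
        (\<forall>z\<in>elts K. opair (b z) (d z) \<in> elts (u (x z))) \<longrightarrow> lef K (\<lambda>z. meet (f (x z)) (b z)) d) \<and>
     (\<forall>L x y z. x \<in> elts L \<rightarrow> elts A \<longrightarrow> y \<in> elts L \<rightarrow> elts A \<longrightarrow> z \<in> elts L \<rightarrow> elts A \<longrightarrow>
        lef L (\<lambda>l. meet (x l) (y l)) z \<longrightarrow>
        (\<exists>n\<in>elts A \<rightarrow> elts N. lef A (\<lambda>a. a) (\<lambda>a. f (n a)) \<and>
           (\<forall>l\<in>elts L. opair (y l) (z l) \<in> elts (u (n (x l))))))"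

text \<open>Evaluation is the counit of \<forall>, pulled back along the points (u (x z), (b z, d
  z)) of the membership relation \<open>E\<close>. For currying, send a \<in> A to the relation
  \<open>q a\<close> of all pairs (y l, z l) with x l = a. The hypothesis then says \<pi>(a) \<le>
  \<Omega>(q a), and primeness chooses a code of \<open>q a\<close> as a function of a.\<close>

lemma codes_ex: "\<exists>N u f. codes N u f"
proof -
  define AA where "AA = usigma A (\<lambda>_. elts A)"
  have AA: "elts AA = case_prod opair ` (elts A \<times> elts A)" unfolding AA_def by (rule elts_usigma) simp
  define M where "M = code {z. elts z \<subseteq> elts AA}"
  have M: "elts M = {z. elts z \<subseteq> elts AA}" unfolding M_def by (rule elts_code[OF small_subsets])
  \<comment> \<open>\<open>M\<close> is the set of relations on \<open>A\<close> and
    \<open>E\<close> pairs a relation with its members, so quantifying along \<open>ufst\<close> is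
    quantifying over (b, d) \<in> S.\<close>
  define E where "E = usigma M elts"
  have E: "elts E = case_prod opair ` (SIGMA S:elts M. elts S)" unfolding E_def by (rule elts_usigma) simp
  have Ef: "ufst \<in> elts E \<rightarrow> elts M" by (auto simp: E)
  have Eb: "(\<lambda>x. ufst (usnd x)) \<in> elts E \<rightarrow> elts A" and Ed: "(\<lambda>x. usnd (usnd x)) \<in> elts E \<rightarrow> elts A"
    by (auto simp: E M AA)
  obtain \<chi> where cf: "\<chi> \<in> fiber X E" and
    c: "\<And>K h f. h \<in> elts K \<rightarrow> elts E \<Longrightarrow> f \<in> elts K \<rightarrow> elts A \<Longrightarrow> pf K f \<preceq> pull K E h \<chi> \<longleftrightarrow>
      pf K (\<lambda>m. meet (f m) (ufst (usnd (h m)))) \<preceq> pull K E h (pf E (\<lambda>x. usnd (usnd x)))"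
    by (rule impE[OF Eb pf_fiber[OF Ed]]) blast
  have c': "pf K f \<preceq> pull K E h \<chi> \<longleftrightarrow> lef K (\<lambda>m. meet (f m) (ufst (usnd (h m)))) (\<lambda>m. usnd (usnd (h m)))"
    if "h \<in> elts K \<rightarrow> elts E" "f \<in> elts K \<rightarrow> elts A" for K h f
    using c[OF that] pull_pf[OF that(1) Ed] le_trans unfolding lef_def by blast
  note \<Omega> = al_adjoint[OF Ef cf]
  obtain N u f where u: "u \<in> elts N \<rightarrow> elts M" and f: "f \<in> elts N \<rightarrow> elts A"
    and i: "al E M ufst \<chi> \<cong> ex N M u (pf N f)" using \<Omega>(1) by (rule generateE)
  have rep: "pf N f \<preceq> pull N M u (al E M ufst \<chi>)"
    using ex_adjoint(2)[OF u pf_fiber[OF f] \<Omega>(1)] i by (simp add: fib_iso_def)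
  have 1: "lef K (\<lambda>z. meet (f (x z)) (b z)) d"
    if x: "x \<in> elts K \<rightarrow> elts N" and b: "b \<in> elts K \<rightarrow> elts A" and d: "d \<in> elts K \<rightarrow> elts A"
      and z: "\<forall>z\<in>elts K. opair (b z) (d z) \<in> elts (u (x z))" for K x b d
  proof -
    define h where "h y = opair (u (x y)) (opair (b y) (d y))" for y
    have h: "h \<in> elts K \<rightarrow> elts E" using x u z by (fastforce simp: h_def E)
    have ux: "(\<lambda>y. u (x y)) \<in> elts K \<rightarrow> elts M" and fx: "(\<lambda>y. f (x y)) \<in> elts K \<rightarrow> elts A" using u f x by auto
    have "pf K (\<lambda>y. f (x y)) \<preceq> pull K N x (pull N M u (al E M ufst \<chi>))"
      by (rule pf_le_pull[OF x f pull_fiber[OF u \<Omega>(1)] rep])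
    also have "\<dots> \<preceq> pull K M (\<lambda>y. u (x y)) (al E M ufst \<chi>)" by (rule pull_pull(1)[OF x u \<Omega>(1)])
    also have "\<dots> = pull K M (\<lambda>y. ufst (h y)) (al E M ufst \<chi>)" by (simp add: h_def)
    also have "\<dots> \<preceq> pull K E h (pull E M ufst (al E M ufst \<chi>))" by (rule pull_pull(2)[OF h Ef \<Omega>(1)])
    also have "\<dots> \<preceq> pull K E h \<chi>" by (rule pull_mono[OF h al_counit[OF Ef cf] cf])
    finally show ?thesis using c'[OF h fx] by (simp add: h_def)
  qed
  have 2: "\<exists>n\<in>elts A \<rightarrow> elts N. lef A (\<lambda>a. a) (\<lambda>a. f (n a)) \<and> (\<forall>l\<in>elts L. opair (y l) (z l) \<in> elts (u (n (x l))))"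
    if x: "x \<in> elts L \<rightarrow> elts A" and y: "y \<in> elts L \<rightarrow> elts A" and z: "z \<in> elts L \<rightarrow> elts A"
      and l: "lef L (\<lambda>l. meet (x l) (y l)) z" for L x y z
  proof -
    define q where "q a = code {opair (y l) (z l) | l. l \<in> elts L \<and> x l = a}" for a
    have q: "elts (q a) = {opair (y l) (z l) | l. l \<in> elts L \<and> x l = a}" for a
      unfolding q_def
    proof (rule elts_code, rule small_subset)
      show "small ((\<lambda>l. opair (y l) (z l)) ` elts L)" by (simp add: small_image)
    qed auto
    have qM: "q \<in> elts A \<rightarrow> elts M" using funcset_mem[OF y] funcset_mem[OF z] by (auto simp: M q AA)
    have idA: "(\<lambda>a. a) \<in> elts A \<rightarrow> elts A" by simp
    let ?P = "pb E A ufst q"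
    note P1 = pb_maps(1)[of E A ufst q] and P2 = pb_maps(2)[of E A ufst q]
    \<comment> \<open>A point of the pullback consists of \<open>a\<close> and a member of
      \<open>q a\<close>, hence comes from some l. Choosing l by \<open>s\<close> carries the
      hypothesis from \<open>L\<close> to the pullback.\<close>
    have "\<forall>w\<in>elts ?P. \<exists>l. l \<in> elts L \<and> x l = usnd w \<and> y l = ufst (usnd (ufst w)) \<and> z l = usnd (usnd (ufst w))"
    proof
      fix w assume "w \<in> elts ?P"
      then obtain S p a where w: "w = opair (opair S p) a" "p \<in> elts S" "S = q a"
        by (auto simp: elts_pb E)
      then obtain l where "l \<in> elts L" "x l = a" "p = opair (y l) (z l)" by (auto simp: q)
      with w show "\<exists>l. l \<in> elts L \<and> x l = usnd w \<and> y l = ufst (usnd (ufst w)) \<and> z l = usnd (usnd (ufst w))"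
        by (intro exI[of _ l]) simp
    qed
    then obtain s where s: "\<forall>w\<in>elts ?P. s w \<in> elts L \<and> x (s w) = usnd w \<and>
        y (s w) = ufst (usnd (ufst w)) \<and> z (s w) = usnd (usnd (ufst w))" by metis
    have sL: "s \<in> elts ?P \<rightarrow> elts L" using s by auto
    have "lef ?P (\<lambda>w. meet (x (s w)) (y (s w))) (\<lambda>w. z (s w))" by (rule lef_comp[OF l sL meet_fun[OF x y] z])
    moreover have "lef ?P (\<lambda>w. meet (x (s w)) (y (s w))) (\<lambda>w. z (s w)) \<longleftrightarrow>
        lef ?P (\<lambda>w. meet (usnd w) (ufst (usnd (ufst w)))) (\<lambda>w. usnd (usnd (ufst w)))"
      by (rule lef_cong) (simp_all add: s)
    ultimately have "pf ?P usnd \<preceq> pull ?P E ufst \<chi>" using c'[OF P1 P2] by blast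
    hence "pull ?P A usnd (pf A (\<lambda>a. a)) \<preceq> pull ?P E ufst \<chi>"
      using pull_pf(1)[OF P2 idA] le_trans by blast
    hence "pf A (\<lambda>a. a) \<preceq> al ?P A usnd (pull ?P E ufst \<chi>)"
      using al_adjoint(2)[OF P2 pull_fiber[OF P1 cf] pf_fiber[OF idA]] by blast
    also have "\<dots> \<preceq> pull A M q (al E M ufst \<chi>)" by (rule al_Beck_Chevalley[OF Ef qM cf])
    also have "\<dots> \<preceq> pull A M q (ex N M u (pf N f))"
      using pull_mono[OF qM _ ex_adjoint(1)[OF u pf_fiber[OF f]]] i by (simp add: fib_iso_def)
    also have "\<dots> \<preceq> ex (pb N A u q) A usnd (pull (pb N A u q) N ufst (pf N f))"
      by (rule ex_Beck_Chevalley[OF u qM pf_fiber[OF f]])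
    finally have t: "pf A (\<lambda>a. a) \<preceq> ex (pb N A u q) A usnd (pull (pb N A u q) N ufst (pf N f))" .
    note Q1 = pb_maps(1)[of N A u q] and Q2 = pb_maps(2)[of N A u q]
    \<comment> \<open>The section picks for each a a point (n, a) of the pullback of
      \<open>u\<close> and \<open>q\<close>, that is, some n with u n = q a.\<close>
    obtain w where w: "w \<in> elts A \<rightarrow> elts (pb N A u q)" "\<And>a. a \<in> elts A \<Longrightarrow> usnd (w a) = a"
      "pf A (\<lambda>a. a) \<preceq> pull A (pb N A u q) w (pull (pb N A u q) N ufst (pf N f))"
      using prime_section[OF idA Q2 pull_fiber[OF Q1 pf_fiber[OF f]] t] by metis
    let ?n = "\<lambda>a. ufst (w a)"
    have n: "?n \<in> elts A \<rightarrow> elts N" using Q1 w(1) by auto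
    have uq: "u (?n a) = q a" if "a \<in> elts A" for a
    proof -
      have "w a \<in> elts (pb N A u q)" using w(1) that by auto
      thus ?thesis using w(2)[OF that] by (auto simp: elts_pb)
    qed
    have "opair (y l) (z l) \<in> elts (u (?n (x l)))" if l: "l \<in> elts L" for l
      unfolding uq[OF funcset_mem[OF x l]] q using l by blast
    moreover have "lef A (\<lambda>a. a) (\<lambda>a. f (?n a))"
      unfolding lef_def using w(3) pull_pull(1)[OF w(1) Q1 pf_fiber[OF f]] pull_pf(1)[OF n f] le_trans by blast
    ultimately show ?thesis using n by (intro bexI[of _ ?n]) auto
  qed
  have 0: "\<exists>b\<in>elts A. \<exists>d\<in>elts A. p = opair b d" if "n \<in> elts N" "p \<in> elts (u n)" for n p
  proof -
    have "u n \<in> elts M" using u that(1) by blast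
    thus ?thesis using that(2) by (auto simp: M AA)
  qed
  have "codes N u f" unfolding codes_def
  proof (intro conjI)
    show "\<forall>n\<in>elts N. \<forall>p\<in>elts (u n). \<exists>b\<in>elts A. \<exists>d\<in>elts A. p = opair b d" by (intro ballI) (rule 0)
  qed (rule f, (intro allI impI, rule 1; assumption), (intro allI impI, rule 2; assumption))
  thus ?thesis by blast
qed

text \<open>Evaluation and currying for a partial application. Defined values are tracked uniformly
  over any family, and codes come from one map \<open>s\<close> on all of \<open>A\<close>, although
  \<open>y\<close> and \<open>z\<close> live over \<open>L\<close>.\<close>

definition application :: "('u \<Rightarrow> 'u \<Rightarrow> 'u option) \<Rightarrow> bool" where
  "application app \<longleftrightarrow> closed_app (elts A) app \<and>
     (\<forall>K x y z. x \<in> elts K \<rightarrow> elts A \<longrightarrow> y \<in> elts K \<rightarrow> elts A \<longrightarrow>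
        (\<forall>l\<in>elts K. app (x l) (y l) = Some (z l)) \<longrightarrow> z \<in> elts K \<rightarrow> elts A \<and> lef K (\<lambda>l. meet (x l) (y l)) z) \<and>
     (\<forall>L x y z. x \<in> elts L \<rightarrow> elts A \<longrightarrow> y \<in> elts L \<rightarrow> elts A \<longrightarrow> z \<in> elts L \<rightarrow> elts A \<longrightarrow>
        lef L (\<lambda>l. meet (x l) (y l)) z \<longrightarrow>
        (\<exists>s\<in>elts A \<rightarrow> elts A. lef A (\<lambda>a. a) s \<and> (\<forall>l\<in>elts L. app (s (x l)) (y l) = Some (z l))))"

text \<open>Put a b = d when some n with f n = a has (b, d) in its relation. Different n with the
  same f n may carry different relations, so uniqueness of d concerns their union; it follows from
  \<open>single_valued\<close> on the set of all triples (n, b, d).\<close>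

lemma application_ex: "\<exists>app. application app"
proof -
  obtain N u f where c: "codes N u f" using codes_ex by blast
  note c = c[unfolded codes_def]
  note u = c[THEN conjunct1] and f = c[THEN conjunct2, THEN conjunct1]
    and ev = c[THEN conjunct2, THEN conjunct2, THEN conjunct1, THEN spec, THEN spec, THEN spec, THEN spec,
      THEN mp, THEN mp, THEN mp, THEN mp]
    and cu = c[THEN conjunct2, THEN conjunct2, THEN conjunct2, THEN spec, THEN spec, THEN spec, THEN spec,
      THEN mp, THEN mp, THEN mp, THEN mp]
  define Q where "Q a b d \<longleftrightarrow> (\<exists>n\<in>elts N. f n = a \<and> opair b d \<in> elts (u n))" for a b d
  have QA: "b \<in> elts A \<and> d \<in> elts A" if "Q a b d" for a b d
    using that u unfolding Q_def by fastforce
  have Q1: "d = d'" if QQ: "Q a b d" "Q a b d'" for a b d d'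
  proof -
    define K where "K = usigma N (\<lambda>n. elts (u n))"
    have K: "elts K = case_prod opair ` (SIGMA n:elts N. elts (u n))" unfolding K_def by (rule elts_usigma) simp
    have maps: "ufst \<in> elts K \<rightarrow> elts N" "(\<lambda>z. ufst (usnd z)) \<in> elts K \<rightarrow> elts A" "(\<lambda>z. usnd (usnd z)) \<in> elts K \<rightarrow> elts A"
      using u by (fastforce simp: K)+
    have "lef K (\<lambda>z. meet (f (ufst z)) (ufst (usnd z))) (\<lambda>z. usnd (usnd z))"
      by (rule ev[OF maps]) (use u in \<open>fastforce simp: K\<close>)
    moreover have "(\<lambda>z. f (ufst z)) \<in> elts K \<rightarrow> elts A" using f maps(1) by auto
    ultimately have *: "usnd (usnd z) = usnd (usnd z')" if "z \<in> elts K" "z' \<in> elts K"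
      "meet (f (ufst z)) (ufst (usnd z)) = meet (f (ufst z')) (ufst (usnd z'))" for z z'
      using single_valued[OF _ meet_fun[OF _ maps(2)] maps(3) that] by blast
    obtain n where n: "n \<in> elts N" "f n = a" "opair b d \<in> elts (u n)" using QQ(1) unfolding Q_def by blast
    obtain n' where n': "n' \<in> elts N" "f n' = a" "opair b d' \<in> elts (u n')" using QQ(2) unfolding Q_def by blast
    have "opair n (opair b d) \<in> elts K" "opair n' (opair b d') \<in> elts K" using n n' by (auto simp: K)
    from *[OF this] n n' show ?thesis by simp
  qed
  define app where "app a b = (if \<exists>d. Q a b d then Some (THE d. Q a b d) else None)" for a b
  have app: "app a b = Some d \<longleftrightarrow> Q a b d" for a b d
  proof -
    have "(THE d. Q a b d) = d" if "Q a b d" for d using that Q1 by blast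
    thus ?thesis by (auto simp: app_def)
  qed
  have c1: "closed_app (elts A) app" unfolding closed_app_def app using QA by blast
  have c2: "z \<in> elts K \<rightarrow> elts A \<and> lef K (\<lambda>l. meet (x l) (y l)) z"
    if x: "x \<in> elts K \<rightarrow> elts A" and y: "y \<in> elts K \<rightarrow> elts A" and a: "\<forall>l\<in>elts K. app (x l) (y l) = Some (z l)" for K x y z
  proof -
    have z: "z \<in> elts K \<rightarrow> elts A" using a QA unfolding app by blast
    have "\<forall>l\<in>elts K. \<exists>n. n \<in> elts N \<and> f n = x l \<and> opair (y l) (z l) \<in> elts (u n)"
      using a unfolding app Q_def by blast
    then obtain n where n: "\<forall>l\<in>elts K. n l \<in> elts N \<and> f (n l) = x l \<and> opair (y l) (z l) \<in> elts (u (n l))" by metis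
    have "lef K (\<lambda>l. meet (f (n l)) (y l)) z" using n by (intro ev[OF _ y z]) auto
    moreover have "lef K (\<lambda>l. meet (f (n l)) (y l)) z \<longleftrightarrow> lef K (\<lambda>l. meet (x l) (y l)) z"
      by (rule lef_cong) (simp_all add: n)
    ultimately show ?thesis using z by blast
  qed
  have c3: "\<exists>s\<in>elts A \<rightarrow> elts A. lef A (\<lambda>a. a) s \<and> (\<forall>l\<in>elts L. app (s (x l)) (y l) = Some (z l))"
    if h: "x \<in> elts L \<rightarrow> elts A" "y \<in> elts L \<rightarrow> elts A" "z \<in> elts L \<rightarrow> elts A" "lef L (\<lambda>l. meet (x l) (y l)) z" for L x y z
  proof -
    obtain n where n: "n \<in> elts A \<rightarrow> elts N" "lef A (\<lambda>a. a) (\<lambda>a. f (n a))"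
      "\<forall>l\<in>elts L. opair (y l) (z l) \<in> elts (u (n (x l)))" using cu[OF h] by blast
    have "(\<lambda>a. f (n a)) \<in> elts A \<rightarrow> elts A" using f n(1) by auto
    moreover have "\<forall>l\<in>elts L. app (f (n (x l))) (y l) = Some (z l)" unfolding app Q_def using n h(1) by blast
    ultimately show ?thesis using n(2) by blast
  qed
  have "application app" unfolding application_def
    by (intro conjI, rule c1, (intro allI impI, rule c2; assumption), intro allI impI, rule c3)
  thus ?thesis by blast
qed

definition "app = (SOME app. application app)"

lemma closed_app: "closed_app (elts A) app"
  and lef_app: "x \<in> elts K \<rightarrow> elts A \<Longrightarrow> y \<in> elts K \<rightarrow> elts A \<Longrightarrow>
    (\<And>l. l \<in> elts K \<Longrightarrow> app (x l) (y l) = Some (z l)) \<Longrightarrow> z \<in> elts K \<rightarrow> elts A \<and> lef K (\<lambda>l. meet (x l) (y l)) z"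
  and curry_ex: "x \<in> elts K \<rightarrow> elts A \<Longrightarrow> y \<in> elts K \<rightarrow> elts A \<Longrightarrow> z \<in> elts K \<rightarrow> elts A \<Longrightarrow>
    lef K (\<lambda>l. meet (x l) (y l)) z \<Longrightarrow>
    \<exists>s\<in>elts A \<rightarrow> elts A. lef A (\<lambda>a. a) s \<and> (\<forall>l\<in>elts K. app (s (x l)) (y l) = Some (z l))"
proof -
  note a = someI_ex[OF application_ex, folded app_def, unfolded application_def]
  show "closed_app (elts A) app" using a by (rule conjunct1)
  show "x \<in> elts K \<rightarrow> elts A \<Longrightarrow> y \<in> elts K \<rightarrow> elts A \<Longrightarrow>
    (\<And>l. l \<in> elts K \<Longrightarrow> app (x l) (y l) = Some (z l)) \<Longrightarrow> z \<in> elts K \<rightarrow> elts A \<and> lef K (\<lambda>l. meet (x l) (y l)) z"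
    by (rule a[THEN conjunct2, THEN conjunct1, THEN spec, THEN spec, THEN spec, THEN spec,
          THEN mp, THEN mp, THEN mp]) simp_all
  show "x \<in> elts K \<rightarrow> elts A \<Longrightarrow> y \<in> elts K \<rightarrow> elts A \<Longrightarrow> z \<in> elts K \<rightarrow> elts A \<Longrightarrow>
    lef K (\<lambda>l. meet (x l) (y l)) z \<Longrightarrow>
    \<exists>s\<in>elts A \<rightarrow> elts A. lef A (\<lambda>a. a) s \<and> (\<forall>l\<in>elts K. app (s (x l)) (y l) = Some (z l))"
    by (rule a[THEN conjunct2, THEN conjunct2, THEN spec, THEN spec, THEN spec, THEN spec,
          THEN mp, THEN mp, THEN mp, THEN mp])
qed

section \<open>The sub-pca and its combinators\<close>

definition "B' = {a \<in> elts A. \<forall>M. lef M (\<lambda>_. top_elt) (\<lambda>_. a)}"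

lemma B'_sub: "B' \<subseteq> elts A" by (auto simp: B'_def)

lemma B'_lef: "a \<in> B' \<Longrightarrow> f \<in> elts M \<rightarrow> elts A \<Longrightarrow> lef M f (\<lambda>_. a)"
  using lef_trans[OF lef_top_elt] by (auto simp: B'_def)

lemma lef_A_comp:
  assumes "lef A (\<lambda>a. a) s" "s \<in> elts A \<rightarrow> elts A" "f \<in> elts M \<rightarrow> elts A"
  shows "lef M f (\<lambda>m. s (f m))"
  using lef_comp[OF assms(1,3) _ assms(2)] by simp

lemma B'_of_lef:
  assumes "lef A (\<lambda>a. a) s" "s \<in> elts A \<rightarrow> elts A" shows "s top_elt \<in> B'"
proof -
  have "lef M (\<lambda>_. top_elt) (\<lambda>_. s top_elt)" for M by (rule lef_A_comp[OF assms]) simp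
  thus ?thesis using assms(2) by (auto simp: B'_def)
qed

text \<open>Currying with the constant map \<open>top_elt\<close> as parameter makes the single code
  \<open>s top_elt\<close> work for all k, and this code lies in \<open>B'\<close>.\<close>

lemma realizer_ex:
  assumes l: "lef K y z" and y: "y \<in> elts K \<rightarrow> elts A" and z: "z \<in> elts K \<rightarrow> elts A"
  obtains a where "a \<in> B'" "\<And>k. k \<in> elts K \<Longrightarrow> app a (y k) = Some (z k)"
proof -
  have t: "(\<lambda>_. top_elt) \<in> elts K \<rightarrow> elts A" by simp
  have "lef K (\<lambda>l. meet top_elt (y l)) z" by (rule lef_trans[OF lef_meet2[OF t y] l])
  from curry_ex[OF t y z this] obtain s where
    s: "s \<in> elts A \<rightarrow> elts A" "lef A (\<lambda>a. a) s" "\<forall>l\<in>elts K. app (s top_elt) (y l) = Some (z l)" by blast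
  show thesis using that[OF B'_of_lef[OF s(2,1)]] s(3) by blast
qed

text \<open>An element \<open>a\<close> of \<open>B'\<close> is implied by every representable
  predicate, so \<open>y\<close> lies below the meet of \<open>a\<close> and \<open>y\<close>, where
  application is tracked.\<close>

lemma lef_of_realizer:
  assumes a: "a \<in> B'" and y: "y \<in> elts K \<rightarrow> elts A" and z: "\<And>k. k \<in> elts K \<Longrightarrow> app a (y k) = Some (z k)"
  shows "z \<in> elts K \<rightarrow> elts A \<and> lef K y z"
proof -
  have c: "(\<lambda>_. a) \<in> elts K \<rightarrow> elts A" using a B'_sub by auto
  have "lef K y (\<lambda>k. meet a (y k))" using lef_meet[OF c y y] B'_lef[OF a y] lef_refl[OF y] by blast
  thus ?thesis using lef_app[OF c y z] lef_trans by blast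
qed

lemma closed_B': "closed_app B' app"
  unfolding closed_app_def
proof (intro ballI allI impI)
  fix a b c assume a: "a \<in> B'" and b: "b \<in> B'" and c: "app a b = Some c"
  have "c \<in> elts A \<and> lef M (\<lambda>_. b) (\<lambda>_. c)" for M
  proof
    show "c \<in> elts A" using closed_app a b c B'_sub unfolding closed_app_def by blast
    have "(\<lambda>_. b) \<in> elts M \<rightarrow> elts A" using b B'_sub by auto
    thus "lef M (\<lambda>_. b) (\<lambda>_. c)" using lef_of_realizer[OF a, of _ M "\<lambda>_. c"] c by blast
  qed
  thus "c \<in> B'" using b lef_trans unfolding B'_def by blast
qed

text \<open>Currying the first projection of A x A gives a tracked map x -> (code of the constant
  function x); naming this map by an element of \<open>B'\<close> gives k.\<close>

lemma k_ex: "\<exists>k\<in>B'. \<forall>x\<in>elts A. \<exists>f. app k x = Some f \<and> (\<forall>y\<in>elts A. app f y = Some x)"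
proof -
  define P where "P = usigma A (\<lambda>_. elts A)"
  have P: "elts P = case_prod opair ` (elts A \<times> elts A)" unfolding P_def by (rule elts_usigma) simp
  have f: "ufst \<in> elts P \<rightarrow> elts A" "usnd \<in> elts P \<rightarrow> elts A" by (auto simp: P)
  obtain s where s: "s \<in> elts A \<rightarrow> elts A" "lef A (\<lambda>a. a) s"
    "\<forall>l\<in>elts P. app (s (ufst l)) (usnd l) = Some (ufst l)"
    using curry_ex[OF f f(1) lef_meet1[OF f]] by blast
  obtain k where k: "k \<in> B'" "\<And>x. x \<in> elts A \<Longrightarrow> app k x = Some (s x)"
    using realizer_ex[OF s(2) _ s(1)] by auto
  have "app (s x) y = Some x" if "x \<in> elts A" "y \<in> elts A" for x y
    using s(3)[THEN bspec, of "opair x y"] that by (simp add: P)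
  with k show ?thesis by (intro bexI[of _ k]) auto
qed

text \<open>The map (x, y, z) -> xz(yz) is tracked on the set \<open>T\<close> of triples where it
  is defined. To curry out z, the pair (x, y) is packed by \<open>meet\<close>: the value of s x y
  is \<open>s1 (meet x y)\<close>. It always exists because \<open>s1\<close> is total on
  \<open>A\<close>; only its application to z depends on membership in \<open>T\<close>.\<close>

lemma s_ex: "\<exists>s\<in>B'. \<forall>x\<in>elts A. \<exists>f. app s x = Some f \<and> (\<forall>y\<in>elts A. \<exists>g. app f y = Some g \<and>
    (\<forall>z\<in>elts A. \<forall>a b r. app x z = Some a \<longrightarrow> app y z = Some b \<longrightarrow> app a b = Some r \<longrightarrow> app g z = Some r))"
proof -
  define P where "P = usigma A (\<lambda>_. elts A)"
  have P: "elts P = case_prod opair ` (elts A \<times> elts A)" unfolding P_def by (rule elts_usigma) simp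
  have f: "ufst \<in> elts P \<rightarrow> elts A" "usnd \<in> elts P \<rightarrow> elts A" by (auto simp: P)
  define T where "T = usigma P (\<lambda>p. {z \<in> elts A. \<exists>a b r. app (ufst p) z = Some a \<and> app (usnd p) z = Some b \<and> app a b = Some r})"
  have T: "elts T = case_prod opair ` (SIGMA p:elts P. {z \<in> elts A. \<exists>a b r. app (ufst p) z = Some a \<and> app (usnd p) z = Some b \<and> app a b = Some r})"
    unfolding T_def by (rule elts_usigma) (rule small_subset[OF small_elts[of A]], auto)
  define x where "x t = ufst (ufst t)" for t :: 'u
  define y where "y t = usnd (ufst t)" for t :: 'u
  define z where "z t = usnd t" for t :: 'u
  define a where "a t = the (app (x t) (z t))" for t
  define b where "b t = the (app (y t) (z t))" for t
  define r where "r t = the (app (a t) (b t))" for t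
  have x: "x \<in> elts T \<rightarrow> elts A" and y: "y \<in> elts T \<rightarrow> elts A" and z: "z \<in> elts T \<rightarrow> elts A"
    by (auto simp: T P x_def y_def z_def)
  have a: "app (x t) (z t) = Some (a t)" and b: "app (y t) (z t) = Some (b t)" and r: "app (a t) (b t) = Some (r t)"
    if "t \<in> elts T" for t
    using that by (auto simp: T P x_def y_def z_def a_def b_def r_def)
  note xy = meet_fun[OF x y]
  note h = meet_fun[OF xy z]
  note aA = lef_app[OF x z a, THEN conjunct1] and la = lef_app[OF x z a, THEN conjunct2]
  note bA = lef_app[OF y z b, THEN conjunct1] and lb = lef_app[OF y z b, THEN conjunct2]
  note rA = lef_app[OF aA bA r, THEN conjunct1] and lr = lef_app[OF aA bA r, THEN conjunct2]
  have hx: "lef T (\<lambda>t. meet (meet (x t) (y t)) (z t)) x" and hy: "lef T (\<lambda>t. meet (meet (x t) (y t)) (z t)) y"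
    using lef_trans[OF lef_meet1[OF xy z]] lef_meet1[OF x y] lef_meet2[OF x y] by blast+
  have hz: "lef T (\<lambda>t. meet (meet (x t) (y t)) (z t)) z" by (rule lef_meet2[OF xy z])
  have ha: "lef T (\<lambda>t. meet (meet (x t) (y t)) (z t)) a" using lef_trans[OF _ la] lef_meet[OF x z h] hx hz by blast
  have hb: "lef T (\<lambda>t. meet (meet (x t) (y t)) (z t)) b" using lef_trans[OF _ lb] lef_meet[OF y z h] hy hz by blast
  have "lef T (\<lambda>t. meet (meet (x t) (y t)) (z t)) r" using lef_trans[OF _ lr] lef_meet[OF aA bA h] ha hb by blast
  from curry_ex[OF xy z rA this] obtain s1 where s1: "s1 \<in> elts A \<rightarrow> elts A" "lef A (\<lambda>a. a) s1"
    "\<forall>t\<in>elts T. app (s1 (meet (x t) (y t))) (z t) = Some (r t)" by blast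
  \<comment> \<open>The second currying is indexed by all pairs in \<open>P\<close> rather than by
    \<open>T\<close>, so that s x y is defined unconditionally.\<close>
  have s1f: "(\<lambda>p. s1 (meet (ufst p) (usnd p))) \<in> elts P \<rightarrow> elts A" using s1(1) f by auto
  from curry_ex[OF f s1f lef_A_comp[OF s1(2,1) meet_fun[OF f]]] obtain s2 where
    s2: "s2 \<in> elts A \<rightarrow> elts A" "lef A (\<lambda>a. a) s2"
    "\<forall>p\<in>elts P. app (s2 (ufst p)) (usnd p) = Some (s1 (meet (ufst p) (usnd p)))" by blast
  obtain s where s: "s \<in> B'" "\<And>x. x \<in> elts A \<Longrightarrow> app s x = Some (s2 x)"
    using realizer_ex[OF s2(2) _ s2(1)] by auto
  have 2: "app (s2 u) v = Some (s1 (meet u v))" if "u \<in> elts A" "v \<in> elts A" for u v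
    using s2(3)[THEN bspec, of "opair u v"] that by (simp add: P)
  have 3: "app (s1 (meet u v)) w = Some d"
    if A: "u \<in> elts A" "v \<in> elts A" "w \<in> elts A" and d: "app u w = Some p" "app v w = Some q" "app p q = Some d" for u v w p q d
  proof -
    have t: "opair (opair u v) w \<in> elts T" using A d by (auto simp: T P)
    show ?thesis using s1(3)[THEN bspec, OF t] d by (simp add: x_def y_def z_def r_def a_def b_def)
  qed
  show ?thesis
  proof (intro bexI[OF _ s(1)] ballI)
    fix u assume u: "u \<in> elts A"
    show "\<exists>f. app s u = Some f \<and> (\<forall>y\<in>elts A. \<exists>g. app f y = Some g \<and>
      (\<forall>z\<in>elts A. \<forall>a b r. app u z = Some a \<longrightarrow> app y z = Some b \<longrightarrow> app a b = Some r \<longrightarrow> app g z = Some r))"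
      using s(2)[OF u] 2[OF u] 3[OF u] by simp
  qed
qed

lemma pca_inclusion: "pca_inclusion B' (elts A) app"
proof -
  obtain k where k: "k \<in> B'" "\<And>x. x \<in> elts A \<Longrightarrow> \<exists>f. app k x = Some f \<and> (\<forall>y\<in>elts A. app f y = Some x)"
    using k_ex by blast
  obtain s where s: "s \<in> B'" and s': "\<And>x. x \<in> elts A \<Longrightarrow> \<exists>f. app s x = Some f \<and> (\<forall>y\<in>elts A. \<exists>g. app f y = Some g \<and>
    (\<forall>z\<in>elts A. \<forall>a b r. app x z = Some a \<longrightarrow> app y z = Some b \<longrightarrow> app a b = Some r \<longrightarrow> app g z = Some r))"
    using s_ex by blast
  have 1: "papp app (papp app (Some k) (Some x)) (Some y) = Some x" if xy: "x \<in> elts A" "y \<in> elts A" for x y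
    using k(2)[OF xy(1)] xy(2) by (auto simp: papp_def)
  have 2: "\<exists>g. papp app (papp app (Some s) (Some x)) (Some y) = Some g \<and>
      (\<forall>z\<in>elts A. \<forall>a b r. app x z = Some a \<longrightarrow> app y z = Some b \<longrightarrow> app a b = Some r \<longrightarrow> app g z = Some r)"
    if xy: "x \<in> elts A" "y \<in> elts A" for x y
  proof -
    obtain f where f: "app s x = Some f" "\<forall>y\<in>elts A. \<exists>g. app f y = Some g \<and>
      (\<forall>z\<in>elts A. \<forall>a b r. app x z = Some a \<longrightarrow> app y z = Some b \<longrightarrow> app a b = Some r \<longrightarrow> app g z = Some r)"
      using s'[OF xy(1)] by blast
    show ?thesis using f(2)[THEN bspec, OF xy(2)] f(1) by (auto simp: papp_def)
  qed
  have 3: "papp app (papp app (papp app (Some s) (Some x)) (Some y)) (Some z) = Some r"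
    if A: "x \<in> elts A" "y \<in> elts A" "z \<in> elts A"
      and r: "papp app (papp app (Some x) (Some z)) (papp app (Some y) (Some z)) = Some r" for x y z r
  proof -
    obtain a b where ab: "app x z = Some a" "app y z = Some b" "app a b = Some r"
      using r by (auto simp: papp_def split: bind_splits)
    obtain g where g: "papp app (papp app (Some s) (Some x)) (Some y) = Some g" "app g z = Some r"
      using 2[OF A(1,2)] A(3) ab by blast
    show ?thesis unfolding g(1) using g(2) by (simp add: papp_def)
  qed
  have c: "combinators (elts A) app k s"
    unfolding combinators_def using k(1) s B'_sub 1 2 3 by (intro conjI ballI allI impI) (blast, blast, metis, metis option.distinct(1), metis)
  show ?thesis unfolding pca_inclusion_def pca_def
    using closed_app closed_B' B'_sub k(1) s c by blast
qed

section \<open>Comparison with the realizability tripos\<close>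

definition Gr :: "'u \<Rightarrow> ('u \<Rightarrow> 'u set) \<Rightarrow> 'u" where
  "Gr M \<rho> = usigma M \<rho>"

text \<open>In logical notation this is the predicate \<exists>a \<in> \<rho>(m). \<pi>(a), written
  as a quantification along the projection of the graph of \<open>\<rho>\<close>.\<close>

definition G :: "'u \<times> ('u \<Rightarrow> 'u set) \<Rightarrow> 'o" where
  "G x = ex (Gr (fst x) (snd x)) (fst x) ufst (pf (Gr (fst x) (snd x)) usnd)"

lemma elts_Gr:
  assumes "\<rho> \<in> elts M \<rightarrow>\<^sub>E Pow (elts A)"
  shows "elts (Gr M \<rho>) = case_prod opair ` (SIGMA m:elts M. \<rho> m)"
  unfolding Gr_def by (rule elts_usigma) (rule small_subset[OF small_elts[of A]], use assms in blast)

lemma Gr_maps: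
  assumes "\<rho> \<in> elts M \<rightarrow>\<^sub>E Pow (elts A)"
  shows "ufst \<in> elts (Gr M \<rho>) \<rightarrow> elts M" "usnd \<in> elts (Gr M \<rho>) \<rightarrow> elts A"
proof -
  have "a \<in> elts A" if "m \<in> elts M" "a \<in> \<rho> m" for m a using assms that by blast
  thus "ufst \<in> elts (Gr M \<rho>) \<rightarrow> elts M" "usnd \<in> elts (Gr M \<rho>) \<rightarrow> elts A" by (auto simp: elts_Gr[OF assms])
qed

lemma G_fiber: "\<rho> \<in> elts M \<rightarrow>\<^sub>E Pow (elts A) \<Longrightarrow> G (M, \<rho>) \<in> fiber X M"
  unfolding G_def fst_conv snd_conv by (intro ex_adjoint(1) Gr_maps pf_fiber)

lemma G_le:
  assumes \<rho>: "\<rho> \<in> elts M \<rightarrow>\<^sub>E Pow (elts A)" and \<phi>: "\<phi> \<in> fiber X M"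
  shows "G (M, \<rho>) \<preceq> \<phi> \<longleftrightarrow> pf (Gr M \<rho>) usnd \<preceq> pull (Gr M \<rho>) M ufst \<phi>"
  unfolding G_def fst_conv snd_conv by (rule ex_adjoint(2)[OF Gr_maps(1)[OF \<rho>] pf_fiber[OF Gr_maps(2)[OF \<rho>]] \<phi>])

text \<open>By Beck-Chevalley and primeness, the inequality amounts to a map of graphs over
  \<open>g\<close> that is tracked on second components. Tracking is the same as having a realizer
  in \<open>B'\<close>, by \<open>realizer_ex\<close> and \<open>lef_of_realizer\<close>.\<close>

lemma G_reaches:
  assumes \<rho>: "\<rho> \<in> elts M \<rightarrow>\<^sub>E Pow (elts A)" and \<sigma>: "\<sigma> \<in> elts N \<rightarrow>\<^sub>E Pow (elts A)" and g: "g \<in> elts M \<rightarrow> elts N"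
  shows "G (M, \<rho>) \<preceq> pull M N g (G (N, \<sigma>)) \<longleftrightarrow>
    (\<exists>e\<in>B'. \<forall>m\<in>elts M. \<forall>a\<in>\<rho> m. \<exists>b. app e a = Some b \<and> b \<in> \<sigma> (g m))"
proof -
  let ?E = "Gr M \<rho>" and ?F = "Gr N \<sigma>"
  let ?v = "\<lambda>z. g (ufst z)"
  note E1 = Gr_maps(1)[OF \<rho>] and E2 = Gr_maps(2)[OF \<rho>] and F1 = Gr_maps(1)[OF \<sigma>] and F2 = Gr_maps(2)[OF \<sigma>]
  note pF = pf_fiber[OF F2]
  have v: "?v \<in> elts ?E \<rightarrow> elts N" using E1 g by auto
  have "G (M, \<rho>) \<preceq> pull M N g (G (N, \<sigma>)) \<longleftrightarrow> pf ?E usnd \<preceq> pull ?E M ufst (pull M N g (G (N, \<sigma>)))"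
    by (rule G_le[OF \<rho> pull_fiber[OF g G_fiber[OF \<sigma>]]])
  also have "\<dots> \<longleftrightarrow> pf ?E usnd \<preceq> pull ?E N ?v (G (N, \<sigma>))"
    using pull_pull[OF E1 g G_fiber[OF \<sigma>]] le_trans by blast
  also have "\<dots> \<longleftrightarrow> (\<exists>w\<in>elts ?E \<rightarrow> elts ?F. (\<forall>z\<in>elts ?E. ufst (w z) = g (ufst z)) \<and> lef ?E usnd (\<lambda>z. usnd (w z)))"
  proof
    assume "pf ?E usnd \<preceq> pull ?E N ?v (G (N, \<sigma>))"
    also have "\<dots> \<preceq> ex (pb ?F ?E ufst ?v) ?E usnd (pull (pb ?F ?E ufst ?v) ?F ufst (pf ?F usnd))"
      unfolding G_def fst_conv snd_conv by (rule ex_Beck_Chevalley[OF F1 v pF])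
    finally have l: "pf ?E usnd \<preceq> ex (pb ?F ?E ufst ?v) ?E usnd (pull (pb ?F ?E ufst ?v) ?F ufst (pf ?F usnd))" .
    note P1 = pb_maps(1)[of ?F ?E ufst ?v] and P2 = pb_maps(2)[of ?F ?E ufst ?v]
    obtain w where w: "w \<in> elts ?E \<rightarrow> elts (pb ?F ?E ufst ?v)" "\<And>z. z \<in> elts ?E \<Longrightarrow> usnd (w z) = z"
      "pf ?E usnd \<preceq> pull ?E (pb ?F ?E ufst ?v) w (pull (pb ?F ?E ufst ?v) ?F ufst (pf ?F usnd))"
      using prime_section[OF E2 P2 pull_fiber[OF P1 pF] l] by metis
    let ?w = "\<lambda>z. ufst (w z)"
    have wF: "?w \<in> elts ?E \<rightarrow> elts ?F" using P1 w(1) by auto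
    have "ufst (?w z) = g (ufst z)" if z: "z \<in> elts ?E" for z
    proof -
      have "w z \<in> elts (pb ?F ?E ufst ?v)" using w(1) z by blast
      thus ?thesis using w(2)[OF z] by (auto simp: elts_pb)
    qed
    moreover have "lef ?E usnd (\<lambda>z. usnd (?w z))"
      unfolding lef_def using w(3) pull_pull(1)[OF w(1) P1 pF] pull_pf(1)[OF wF F2] le_trans by blast
    ultimately show "\<exists>w\<in>elts ?E \<rightarrow> elts ?F. (\<forall>z\<in>elts ?E. ufst (w z) = g (ufst z)) \<and> lef ?E usnd (\<lambda>z. usnd (w z))"
      using wF by (intro bexI[of _ ?w]) auto
  next
    assume "\<exists>w\<in>elts ?E \<rightarrow> elts ?F. (\<forall>z\<in>elts ?E. ufst (w z) = g (ufst z)) \<and> lef ?E usnd (\<lambda>z. usnd (w z))"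
    then obtain w where w: "w \<in> elts ?E \<rightarrow> elts ?F" "\<And>z. z \<in> elts ?E \<Longrightarrow> ufst (w z) = g (ufst z)"
      "lef ?E usnd (\<lambda>z. usnd (w z))" by blast
    have u: "pf ?F usnd \<preceq> pull ?F N ufst (G (N, \<sigma>))"
      unfolding G_def fst_conv snd_conv by (rule ex_unit[OF F1 pF])
    have "pf ?E usnd \<preceq> pf ?E (\<lambda>z. usnd (w z))" using w(3) by (simp add: lef_def)
    also have "\<dots> \<preceq> pull ?E ?F w (pull ?F N ufst (G (N, \<sigma>)))"
      by (rule pf_le_pull[OF w(1) F2 pull_fiber[OF F1 G_fiber[OF \<sigma>]] u])
    also have "\<dots> \<preceq> pull ?E N (\<lambda>z. ufst (w z)) (G (N, \<sigma>))" by (rule pull_pull(1)[OF w(1) F1 G_fiber[OF \<sigma>]])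
    also have "\<dots> = pull ?E N ?v (G (N, \<sigma>))" using smap_cong[OF w(2)] by simp
    finally show "pf ?E usnd \<preceq> pull ?E N ?v (G (N, \<sigma>))" .
  qed
  also have "\<dots> \<longleftrightarrow> (\<exists>e\<in>B'. \<forall>m\<in>elts M. \<forall>a\<in>\<rho> m. \<exists>b. app e a = Some b \<and> b \<in> \<sigma> (g m))"
  proof
    assume "\<exists>w\<in>elts ?E \<rightarrow> elts ?F. (\<forall>z\<in>elts ?E. ufst (w z) = g (ufst z)) \<and> lef ?E usnd (\<lambda>z. usnd (w z))"
    then obtain w where w: "w \<in> elts ?E \<rightarrow> elts ?F" "\<And>z. z \<in> elts ?E \<Longrightarrow> ufst (w z) = g (ufst z)"
      "lef ?E usnd (\<lambda>z. usnd (w z))" by blast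
    have wA: "(\<lambda>z. usnd (w z)) \<in> elts ?E \<rightarrow> elts A" using w(1) F2 by auto
    obtain e where e: "e \<in> B'" "\<And>z. z \<in> elts ?E \<Longrightarrow> app e (usnd z) = Some (usnd (w z))"
      using realizer_ex[OF w(3) E2 wA] by metis
    have "\<exists>b. app e a = Some b \<and> b \<in> \<sigma> (g m)" if ma: "m \<in> elts M" "a \<in> \<rho> m" for m a
    proof -
      have z: "opair m a \<in> elts ?E" using ma by (simp add: elts_Gr[OF \<rho>])
      have "w (opair m a) \<in> elts ?F" using w(1) z by blast
      thus ?thesis using w(2)[OF z] e(2)[OF z] by (auto simp: elts_Gr[OF \<sigma>])
    qed
    with e(1) show "\<exists>e\<in>B'. \<forall>m\<in>elts M. \<forall>a\<in>\<rho> m. \<exists>b. app e a = Some b \<and> b \<in> \<sigma> (g m)" by blast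
  next
    assume "\<exists>e\<in>B'. \<forall>m\<in>elts M. \<forall>a\<in>\<rho> m. \<exists>b. app e a = Some b \<and> b \<in> \<sigma> (g m)"
    then obtain e where e: "e \<in> B'" "\<And>m a. m \<in> elts M \<Longrightarrow> a \<in> \<rho> m \<Longrightarrow> \<exists>b. app e a = Some b \<and> b \<in> \<sigma> (g m)" by blast
    let ?b = "\<lambda>z. the (app e (usnd z))"
    have b: "app e (usnd z) = Some (?b z) \<and> ?b z \<in> \<sigma> (g (ufst z)) \<and> ufst z \<in> elts M" if z: "z \<in> elts ?E" for z
    proof -
      obtain m a where "z = opair m a" "m \<in> elts M" "a \<in> \<rho> m" using z by (auto simp: elts_Gr[OF \<rho>])
      thus ?thesis using e(2)[of m a] by auto
    qed
    let ?w = "\<lambda>z. opair (g (ufst z)) (?b z)"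
    have wF: "?w \<in> elts ?E \<rightarrow> elts ?F" using b funcset_mem[OF g] by (auto simp: elts_Gr[OF \<sigma>])
    have "lef ?E usnd ?b" using lef_of_realizer[OF e(1) E2, of ?b] b by blast
    thus "\<exists>w\<in>elts ?E \<rightarrow> elts ?F. (\<forall>z\<in>elts ?E. ufst (w z) = g (ufst z)) \<and> lef ?E usnd (\<lambda>z. usnd (w z))"
      using wF by (intro bexI[of _ ?w]) auto
  qed
  finally show ?thesis .
qed

text \<open>A presentation of \<open>\<phi>\<close> by \<open>u\<close> and \<open>f\<close> may be
  collapsed to the image of (u, f), which is the graph of \<open>\<rho>\<close>: \<open>N\<close>
  maps onto it, and a section of this map gives the reverse comparison of the two
  quantifications.\<close>

lemma G_surj:
  assumes \<phi>: "\<phi> \<in> fiber X M"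
  obtains \<rho> where "\<rho> \<in> elts M \<rightarrow>\<^sub>E Pow (elts A)" "G (M, \<rho>) \<cong> \<phi>"
proof -
  obtain N u f where u: "u \<in> elts N \<rightarrow> elts M" and f: "f \<in> elts N \<rightarrow> elts A" and i: "\<phi> \<cong> ex N M u (pf N f)"
    using \<phi> by (rule generateE)
  define \<rho> where "\<rho> = restrict (\<lambda>m. {f n | n. n \<in> elts N \<and> u n = m}) (elts M)"
  have \<rho>m: "\<rho> m = {f n | n. n \<in> elts N \<and> u n = m}" if "m \<in> elts M" for m using that by (simp add: \<rho>_def)
  have \<rho>: "\<rho> \<in> elts M \<rightarrow>\<^sub>E Pow (elts A)" using f by (auto simp: \<rho>_def)
  let ?E = "Gr M \<rho>"
  note E1 = Gr_maps(1)[OF \<rho>] and E2 = Gr_maps(2)[OF \<rho>] and E = elts_Gr[OF \<rho>]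
  note pN = pf_fiber[OF f] and g = G_fiber[OF \<rho>]
  let ?c = "\<lambda>n. opair (u n) (f n)"
  have c: "?c \<in> elts N \<rightarrow> elts ?E" using funcset_mem[OF u] by (auto simp: E \<rho>m)
  have "pf ?E usnd \<preceq> pull ?E M ufst (G (M, \<rho>))" using G_le[OF \<rho> g] le_refl[OF g] by blast
  from pf_le_pull[OF c E2 pull_fiber[OF E1 g] this]
  have "pf N f \<preceq> pull N ?E ?c (pull ?E M ufst (G (M, \<rho>)))" by simp
  also have "\<dots> \<preceq> pull N M u (G (M, \<rho>))" using pull_pull(1)[OF c E1 g] by simp
  finally have 1: "ex N M u (pf N f) \<preceq> G (M, \<rho>)" using ex_adjoint(2)[OF u pN g] by blast
  have "\<forall>z\<in>elts ?E. \<exists>n. n \<in> elts N \<and> u n = ufst z \<and> f n = usnd z" by (auto simp: E \<rho>m)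
  then obtain s where s: "\<forall>z\<in>elts ?E. s z \<in> elts N \<and> u (s z) = ufst z \<and> f (s z) = usnd z" by metis
  have sN: "s \<in> elts ?E \<rightarrow> elts N" using s by auto
  note e = ex_adjoint(1)[OF u pN]
  have "pf ?E usnd = pf ?E (\<lambda>z. f (s z))" by (rule pf_cong) (simp add: s)
  also have "\<dots> \<preceq> pull ?E N s (pull N M u (ex N M u (pf N f)))"
    by (rule pf_le_pull[OF sN f pull_fiber[OF u e] ex_unit[OF u pN]])
  also have "\<dots> \<preceq> pull ?E M (\<lambda>z. u (s z)) (ex N M u (pf N f))" by (rule pull_pull(1)[OF sN u e])
  also have "\<dots> = pull ?E M ufst (ex N M u (pf N f))"
    using smap_cong[of ?E "\<lambda>z. u (s z)" ufst M] s by simp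
  finally have "G (M, \<rho>) \<preceq> ex N M u (pf N f)" using G_le[OF \<rho> e] by blast
  hence "G (M, \<rho>) \<cong> \<phi>" using 1 i le_trans unfolding fib_iso_def by blast
  with \<rho> show thesis by (rule that)
qed

lemma equivalent: "fibered_equivalent X (rr_tripos B' (elts A) app)"
proof -
  obtain k s where "pca_incl (elts A) B' app k s" using pca_inclusion by (rule pca_inclusionE)
  then interpret P: pca_incl "elts A" B' app k s .
  have "reflecting P.R X G"
    unfolding reflecting_def
  proof (intro conjI ballI allI)
    fix x :: "'u \<times> ('u \<Rightarrow> 'u set)" assume "x \<in> Obj P.R"
    then obtain M \<rho> where x: "x = (M, \<rho>)" "\<rho> \<in> elts M \<rightarrow>\<^sub>E Pow (elts A)" by (auto simp: rr_Obj)
    show "G x \<in> Obj X" "pobj X (G x) = pobj P.R x"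
      using G_fiber[OF x(2)] by (simp_all add: x(1) rr_pobj fiber_iff)
  next
    fix x y :: "'u \<times> ('u \<Rightarrow> 'u set)" and v assume "x \<in> Obj P.R" "y \<in> Obj P.R"
    then obtain M \<rho> N \<sigma> where x: "x = (M, \<rho>)" and \<rho>: "\<rho> \<in> elts M \<rightarrow>\<^sub>E Pow (elts A)"
      and y: "y = (N, \<sigma>)" and \<sigma>: "\<sigma> \<in> elts N \<rightarrow>\<^sub>E Pow (elts A)" by (auto simp: rr_Obj)
    note gx = G_fiber[OF \<rho>] and gy = G_fiber[OF \<sigma>]
    show "reaches P.R x v y \<longleftrightarrow> reaches X (G x) v (G y)"
    proof (cases "v \<in> Hom SET M N")
      case True
      then obtain g where g: "v = smap M N g" "g \<in> elts M \<rightarrow> elts N" by (rule hom_smapE)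
      have "reaches P.R x v y \<longleftrightarrow> P.rle (elts M) \<rho> (\<lambda>m. \<sigma> (sfun v m))"
        using True \<rho> \<sigma> by (simp add: x y P.rr_reaches_iff)
      also have "\<dots> \<longleftrightarrow> P.rle (elts M) \<rho> (\<lambda>m. \<sigma> (g m))" by (rule P.rle_cong) (simp_all add: g(1))
      also have "\<dots> \<longleftrightarrow> G x \<preceq> reindex X v (G y)"
        using G_reaches[OF \<rho> \<sigma> g(2)] by (simp add: P.rle_def x y g(1))
      also have "\<dots> \<longleftrightarrow> reaches X (G x) v (G y)" unfolding x y by (rule le_reindex[OF True gy gx])
      finally show ?thesis .
    next
      case False
      have "\<not> reaches X (G x) v (G y)" using False reachesD(3)[of "G x" v "G y"] gx gy by (auto simp: x y fiber_iff)
      thus ?thesis using False by (simp add: x y P.rr_reaches_iff)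
    qed
  next
    fix \<phi> assume "\<phi> \<in> Obj X"
    hence "\<phi> \<in> fiber X (pobj X \<phi>)" by (simp add: fiber_iff)
    then obtain \<rho> where "\<rho> \<in> elts (pobj X \<phi>) \<rightarrow>\<^sub>E Pow (elts A)" "G (pobj X \<phi>, \<rho>) \<cong> \<phi>" by (rule G_surj)
    thus "\<exists>x\<in>Obj P.R. G x \<cong> \<phi>" by (intro bexI[of _ "(pobj X \<phi>, \<rho>)"]) (auto simp: rr_Obj)
  qed
  from fibered_equivalentI[OF P.rr_posetal posetal this] show ?thesis by (rule fibered_equivalent_sym)
qed

end

theorem corollary4p11p2:
  fixes X :: "('o, 'a, 'u::set_universe) over_set"
  assumes "posetal_fibration X" and "pre_stack X"
  shows "(\<exists>(B :: 'u) B' app. pca_inclusion B' (elts B) app \<and>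
            fibered_equivalent X (rr_tripos B' (elts B) app)) \<longleftrightarrow>
         models_top X \<and> models_and X \<and> models_imp X \<and> models_ex X \<and> models_all X \<and>
         (\<exists>I A \<pi>. modest_prime_generators X I A \<pi> \<and> (\<exists>i. elts I = {i}))"
proof
  assume "\<exists>(B :: 'u) B' app. pca_inclusion B' (elts B) app \<and>
      fibered_equivalent X (rr_tripos B' (elts B) app)"
  then obtain B :: 'u and B' app where "pca_inclusion B' (elts B) app"
    "fibered_equivalent X (rr_tripos B' (elts B) app)" by blast
  thus "models_top X \<and> models_and X \<and> models_imp X \<and> models_ex X \<and> models_all X \<and>
      (\<exists>I A \<pi>. modest_prime_generators X I A \<pi> \<and> (\<exists>i. elts I = {i}))"
    by (rule fibered_equivalent_rr_models[OF assms(1)])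
next
  assume m: "models_top X \<and> models_and X \<and> models_imp X \<and> models_ex X \<and> models_all X \<and>
      (\<exists>I A \<pi>. modest_prime_generators X I A \<pi> \<and> (\<exists>i. elts I = {i}))"
  then obtain I A \<pi> i where "modest_prime_generators X I A \<pi>" "elts I = {i}" by blast
  with m interpret modest_prime X I A \<pi> i by unfold_locales (auto intro: assms(1))
  show "\<exists>(B :: 'u) B' app. pca_inclusion B' (elts B) app \<and>
      fibered_equivalent X (rr_tripos B' (elts B) app)"
    using pca_inclusion equivalent by blast
qed

end
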